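(* Let $A$ be a real $m\times n$ matrix with $m\ge n>\max(k,2)$, $\operatorname{rank}(A)=n$, and singular values $\sigma_1\ge\cdots\ge\sigma_n$. Let $q\ge0$, $0<k\le\ell<n$ and $0\le p\le\ell-k$ be integers, and let $QB_k$ be the rank-$k$ approximation computed by Randomized Subspace Iteration with input $A,k,\ell,q$. Put $$\mathcal C_1=\sqrt{n-\ell+p}+\sqrt\ell+7,\quad \mathcal C_2=\frac{4e\sqrt\ell}{p+1},\quad \mathcal C=\mathcal C_1\mathcal C_2,\quad \tau_j=\frac{\sigma_{\ell-p+1}}{\sigma_j}.$$ Then for $j=1,\dots,k$, $$\mathbb E\bigl(\sigma_j(QB_k)\bigr)\ge\begin{cases}\dfrac{\sigma_j}{\sqrt{1+\mathcal C^2\tau_j^{4q+2}}}&\text{for }p\ge2,\\[2ex]\dfrac{\sigma_j}{1+\mathcal C^2\tau_j^{4q+2}\log\sqrt{\mathcal C^2+\tau_j^{-(4q+2)}}}&\text{for }p=1,\\[2ex]\dfrac{\sigma_j}{1+\mathcal C\,\tau_j^{2q+1}}&\text{for }p=0.\end{cases}$$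
   Context: $\sigma_j(X)$ is the $j$-th largest singular value of $X$; $\log$ is the natural logarithm and $e$ its base; $\mathbb E$ is expectation over $\Omega$. Randomized Subspace Iteration (exact arithmetic): draw an $n\times\ell$ standard Gaussian matrix $\Omega$ (independent entries, normal with mean $0$ and standard deviation $1$); compute $Y=(AA^T)^qA\Omega$; compute a matrix $Q$ whose columns form an orthonormal basis of the column space of $Y$; compute $B=Q^TA$; let $B_k$ be the rank-$k$ truncated SVD of $B$ (keep only the $k$ largest singular values and the corresponding singular vectors); return $QB_k$. The parameter $p$ is not used by the algorithm. *)

theory Defs
  imports
    "HOL-Probability.Probability"
    "Jordan_Normal_Form.DL_Rank"
    "Jordan_Normal_Form.Char_Poly"
begin

text \<open>Matrices are those of \<^theory>\<open>Jordan_Normal_Form.Matrix\<close>, whose entries are indexed from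
  \<open>0\<close>; singular values are indexed from \<open>1\<close>.

  The eigenvalues of \<open>X\<^sup>T X\<close> are taken with multiplicity. A matrix with \<open>n\<close> columns therefore gets
  \<open>n\<close> singular values, the last \<open>n - m\<close> of which are \<open>0\<close> if it has only \<open>m < n\<close> rows.
  \<open>singular_value X j\<close> is meaningful for \<open>1 \<le> j \<le> n\<close> only.\<close>

definition singular_values :: "real mat \<Rightarrow> real list" where
  "singular_values X =
     rev (sorted_list_of_multiset (image_mset sqrt (proots (char_poly (X\<^sup>T * X)))))"

definition singular_value :: "real mat \<Rightarrow> nat \<Rightarrow> real" where
  "singular_value X j = singular_values X ! (j - 1)"

definition orthonormal_cols :: "real mat \<Rightarrow> bool" where
  "orthonormal_cols Q \<longleftrightarrow> Q\<^sup>T * Q = 1\<^sub>m (dim_col Q)"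

definition is_svd :: "real mat \<Rightarrow> real mat \<Rightarrow> real mat \<Rightarrow> real mat \<Rightarrow> bool" where
  "is_svd X U S V \<longleftrightarrow>
     U \<in> carrier_mat (dim_row X) (dim_row X) \<and> orthonormal_cols U \<and>
     V \<in> carrier_mat (dim_col X) (dim_col X) \<and> orthonormal_cols V \<and>
     S \<in> carrier_mat (dim_row X) (dim_col X) \<and> diagonal_mat S \<and>
     (\<forall>i < min (dim_row X) (dim_col X). 0 \<le> S $$ (i, i)) \<and>
     (\<forall>i j. i \<le> j \<longrightarrow> j < min (dim_row X) (dim_col X) \<longrightarrow> S $$ (j, j) \<le> S $$ (i, i)) \<and>
     X = U * S * V\<^sup>T"

text \<open>The singular values, defined through \<open>X\<^sup>T X\<close>, are the diagonal entries of every SVD.\<close>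

lemma singular_value_eq_svd_diagonal:
  assumes svd: "is_svd X U S V" and j: "1 \<le> j" "j \<le> min (dim_row X) (dim_col X)"
  shows "singular_value X j = S $$ (j - 1, j - 1)"
proof -
  define m n where "m = dim_row X" and "n = dim_col X"
  define d where "d i = (if i < m then S $$ (i, i) else 0)" for i
  note svd' = svd[unfolded is_svd_def orthonormal_cols_def, folded m_def n_def]
  have Uc: "U \<in> carrier_mat m m" and Vc: "V \<in> carrier_mat n n"
    and S: "S \<in> carrier_mat m n" "diagonal_mat S" and X: "X = U * S * V\<^sup>T"
    using svd' by blast+
  have U: "U \<in> carrier_mat m m" "U\<^sup>T * U = 1\<^sub>m m" and V: "V \<in> carrier_mat n n" "V\<^sup>T * V = 1\<^sub>m n"
    using svd' unfolding carrier_matD(2)[OF Uc] carrier_matD(2)[OF Vc] by blast+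
  have nn: "\<And>i. i < m \<Longrightarrow> i < n \<Longrightarrow> 0 \<le> S $$ (i, i)"
    and dec: "\<And>i j. i \<le> j \<Longrightarrow> j < m \<Longrightarrow> j < n \<Longrightarrow> S $$ (j, j) \<le> S $$ (i, i)"
    using svd' by simp_all
  have VV: "V * V\<^sup>T = 1\<^sub>m n"
    using mat_mult_left_right_inverse[of "V\<^sup>T" n V] V by auto
  define D where "D = S\<^sup>T * S"
  have Dc: "D \<in> carrier_mat n n" using S unfolding D_def by auto
  have SV: "S * V\<^sup>T \<in> carrier_mat m n" using S V by auto
  have X': "X = U * (S * V\<^sup>T)" using X U(1) V(1) S(1) by simp
  have XT: "X\<^sup>T = (V * S\<^sup>T) * U\<^sup>T"
    unfolding X' transpose_mult[OF U(1) SV]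
    using transpose_mult[of S m n "V\<^sup>T" n] S V by simp
  have c: "U\<^sup>T \<in> carrier_mat m m" "S\<^sup>T \<in> carrier_mat n m" "V\<^sup>T \<in> carrier_mat n n"
    "V * S\<^sup>T \<in> carrier_mat n m"
    using U(1) S(1) V(1) by auto
  have "U\<^sup>T * X = S * V\<^sup>T"
    unfolding X' assoc_mult_mat[OF c(1) U(1) SV, symmetric] U(2) by (rule left_mult_one_mat[OF SV])
  moreover have "X \<in> carrier_mat m n" using m_def n_def by auto
  ultimately have "X\<^sup>T * X = (V * S\<^sup>T) * (S * V\<^sup>T)"
    unfolding XT using assoc_mult_mat[OF c(4) c(1), of X n] by simp
  also have "\<dots> = V * D * V\<^sup>T"
    unfolding D_def assoc_mult_mat[OF c(4) S(1) c(3), symmetric] assoc_mult_mat[OF V(1) c(2) S(1)] ..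
  finally have XX: "X\<^sup>T * X = V * D * V\<^sup>T" .
  have sim: "similar_mat (X\<^sup>T * X) D"
    by (rule similar_matI[of _ _ V "V\<^sup>T" n]) (use XX V VV Dc in auto)
  have Dij: "D $$ (i, i') = (if i = i' then (d i)\<^sup>2 else 0)" if "i < n" "i' < n" for i i'
  proof -
    have "D $$ (i, i') = (\<Sum>r\<in>{0..<m}. S $$ (r, i) * S $$ (r, i'))"
      unfolding D_def using S(1) that by (auto simp: scalar_prod_def)
    also have "\<dots> = (\<Sum>r\<in>{0..<m}. if r = i then (if i = i' then (d i)\<^sup>2 else 0) else 0)"
      using S that unfolding diagonal_mat_def d_def
      by (intro sum.cong) (auto simp: power2_eq_square)
    also have "\<dots> = (if i = i' then (d i)\<^sup>2 else 0)"
      by (auto simp: d_def)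
    finally show ?thesis .
  qed
  have "char_poly (X\<^sup>T * X) = (\<Prod>a\<leftarrow>diag_mat D. [:- a, 1:])"
    unfolding char_poly_similar[OF sim]
    by (rule char_poly_upper_triangular[OF Dc]) (use Dc Dij in \<open>auto simp: upper_triangular_def\<close>)
  moreover have "diag_mat D = map (\<lambda>i. (d i)\<^sup>2) [0..<n]"
    using Dc Dij by (auto simp: diag_mat_def)
  ultimately have cp: "char_poly (X\<^sup>T * X) = (\<Prod>a\<leftarrow>map (\<lambda>i. (d i)\<^sup>2) [0..<n]. [:- a, 1:])"
    by simp
  have pr: "proots (\<Prod>a\<leftarrow>as. [:- a, 1:]) = mset as" for as :: "real list"
  proof (induction as)
    case (Cons a as)
    have "(\<Prod>a\<leftarrow>as. [:- a, 1:]) \<noteq> 0" by (auto simp: prod_list_zero_iff)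
    then have "proots ([:- a, 1:] * (\<Prod>a\<leftarrow>as. [:- a, 1:])) = proots [:- a, 1:] + mset as"
      using Cons by (subst proots_mult) auto
    then show ?case by simp
  qed simp
  have d0: "i < n \<Longrightarrow> 0 \<le> d i" for i using nn unfolding d_def by auto
  have "image_mset sqrt (proots (char_poly (X\<^sup>T * X))) = mset (map d [0..<n])"
    unfolding cp pr using d0 by (auto simp flip: mset_map simp: o_def intro!: arg_cong[of _ _ mset])
  then have "singular_values X = rev (sort (map d [0..<n]))"
    unfolding singular_values_def by (simp only: sorted_list_of_multiset_mset)
  also have "sort (map d [0..<n]) = rev (map d [0..<n])"
  proof (rule properties_for_sort)
    show "sorted (rev (map d [0..<n]))"
      unfolding sorted_rev_iff_nth_mono by (auto simp: d_def dec nn)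
  qed simp
  finally have "singular_values X = map d [0..<n]" by simp
  then show ?thesis using j unfolding singular_value_def m_def[symmetric] n_def[symmetric] d_def
    by auto
qed

text \<open>A relation, since with repeated singular values the truncation depends on the chosen SVD.
  If \<open>k\<close> is at least the number of rows or of columns of \<open>B\<close>, then nothing is cut off.\<close>

definition is_truncated_svd :: "nat \<Rightarrow> real mat \<Rightarrow> real mat \<Rightarrow> bool" where
  "is_truncated_svd k B Bk \<longleftrightarrow>
     (\<exists>U S V. is_svd B U S V \<and>
        Bk = U * mat (dim_row B) (dim_col B) (\<lambda>(i, j). if i < k then S $$ (i, j) else 0) * V\<^sup>T)"

definition orthonormal_basis_of_col_space :: "real mat \<Rightarrow> real mat \<Rightarrow> bool" where
  "orthonormal_basis_of_col_space Q Y \<longleftrightarrow>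
     dim_row Q = dim_row Y \<and> orthonormal_cols Q \<and>
     vec_space.col_space (dim_row Y) Q = vec_space.col_space (dim_row Y) Y"

text \<open>\<open>randomized_subspace_iteration A k l q \<Omega> X\<close>: on input \<open>A\<close>, \<open>k\<close>, \<open>l\<close>, \<open>q\<close>, and with \<open>\<Omega>\<close> the
  Gaussian matrix drawn, the algorithm can return \<open>X = Q B\<^sub>k\<close>. The choices of \<open>Q\<close> and of the SVD
  are left open. \<open>Q\<close> has \<open>rank Y\<close> columns, which may be fewer than \<open>l\<close> for exceptional \<open>\<Omega>\<close>.\<close>

definition randomized_subspace_iteration ::
    "real mat \<Rightarrow> nat \<Rightarrow> nat \<Rightarrow> nat \<Rightarrow> real mat \<Rightarrow> real mat \<Rightarrow> bool" where
  "randomized_subspace_iteration A k l q \<Omega> X \<longleftrightarrow>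
     \<Omega> \<in> carrier_mat (dim_col A) l \<and>
     (\<exists>Q Bk.
        orthonormal_basis_of_col_space Q (((A * A\<^sup>T) ^\<^sub>m q) * A * \<Omega>) \<and>
        is_truncated_svd k (Q\<^sup>T * A) Bk \<and>
        X = Q * Bk)"

definition standard_gaussian_matrix :: "'w measure \<Rightarrow> nat \<Rightarrow> nat \<Rightarrow> ('w \<Rightarrow> real mat) \<Rightarrow> bool" where
  "standard_gaussian_matrix M n l \<Omega> \<longleftrightarrow>
     (\<forall>\<omega>\<in>space M. \<Omega> \<omega> \<in> carrier_mat n l) \<and>
     prob_space.indep_vars M (\<lambda>_. borel) (\<lambda>(i, j) \<omega>. \<Omega> \<omega> $$ (i, j)) ({..<n} \<times> {..<l}) \<and>
     (\<forall>i<n. \<forall>j<l. distributed M lborel (\<lambda>\<omega>. \<Omega> \<omega> $$ (i, j)) std_normal_density)"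

end

theory Submission
  imports Defs "HOL-Real_Asymp.Real_Asymp"
begin

text \<open>Let \<open>V\<close> hold the right singular vectors of \<open>A\<close>, and let \<open>G\<close> and \<open>H\<close> be the first \<open>l - p\<close> and the
  remaining rows of the Gaussian matrix \<open>V\<^sup>T \<Omega>\<close>. By Courant--Fischer, testing the column space of
  \<open>(A A\<^sup>T)\<^sup>q A \<Omega>\<close> on the image of \<open>G\<^sup>\<dagger> = G\<^sup>T (G G\<^sup>T)\<^sup>-\<^sup>1\<close> gives
  \<open>\<sigma>\<^sub>j(Q B\<^sub>k) \<ge> \<sigma>\<^sub>j / sqrt (1 + \<alpha>\<^sup>2 Z\<^sup>2)\<close> with \<open>\<alpha> = \<tau>\<^sub>j ^ (2 q + 1)\<close> and \<open>Z = \<parallel>H G\<^sup>\<dagger>\<parallel>\<close>.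

  For a Gaussian vector \<open>x\<close> independent of \<open>\<Omega>\<close>, \<open>|H G\<^sup>\<dagger> x|\<close> exceeds \<open>Z |N|\<close> for a standard normal \<open>N\<close>, and by
  rotation invariance it is distributed as \<open>|x|\<close> times a chi variable with \<open>n - l + p\<close> degrees of
  freedom, divided by an independent chi variable with \<open>d = p + 1\<close> degrees of freedom (the distance of
  a row of \<open>G\<close> to the span of the others). Hence \<open>P(Z > t) \<le> (D / t)\<^sup>d\<close>: the variable \<open>Z\<close> is dominated by
  a Pareto variable, for which the expectation of \<open>1 / sqrt (1 + \<alpha>\<^sup>2 Z\<^sup>2)\<close> is bounded by an elementary
  integral for \<open>p \<le> 1\<close> and by Jensen's inequality for \<open>p \<ge> 2\<close>.\<close>

section \<open>Rotation invariance of the Gaussian measure\<close>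

text \<open>The obstacle is that the tail bound for \<open>Z\<close> decays only like the power
  \<open>d = p + 1\<close>: it controls no mean for \<open>p = 0\<close> and no second moment for
  \<open>p = 1\<close>. This is why the three cases have three shapes, and why Jensen's inequality
  serves only \<open>p \<ge> 2\<close>.

  Testing the norm on one random vector costs the factor \<open>1 / P(|N| > s)\<close>. For
  \<open>s = sqrt d\<close> this is at most \<open>(2 * sqrt e) ^ d\<close>, and since the whole
  bound is a \<open>d\<close>-th power it enters \<open>D\<close> as the constant
  \<open>2 * sqrt e\<close>. The other \<open>sqrt e\<close> comes from the small ball estimate of a
  chi variable; together they are the \<open>e\<close> in \<open>C2\<close>.

  Two questions of measurability shape the rest. The norm \<open>Z\<close> is never formed: the bad
  event is the existence of an \<open>x\<close> with \<open>|H G\<^sup>\<dagger> x| > t |x|\<close>,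
  and it is only required to contain a measurable event given beforehand. The singular value of
  \<open>Q B\<^sub>k\<close>, on the other hand, must be a random variable although \<open>Q\<close>
  and the SVD may be chosen arbitrarily at each sample point; Courant--Fischer describes it by the
  column space alone, and a rational version of that description is measurable.\<close>

abbreviation std_gauss :: "real measure" where
  "std_gauss \<equiv> density lborel (\<lambda>x. ennreal (std_normal_density x))"

abbreviation gauss :: "'i set \<Rightarrow> ('i \<Rightarrow> real) measure" where
  "gauss I \<equiv> Pi\<^sub>M I (\<lambda>_. std_gauss)"

definition dot :: "'i set \<Rightarrow> ('i \<Rightarrow> real) \<Rightarrow> ('i \<Rightarrow> real) \<Rightarrow> real" where
  "dot I u v = (\<Sum>i\<in>I. u i * v i)"

lemma prob_space_std_gauss: "prob_space std_gauss"
  by (simp add: prob_space_normal_density)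

interpretation std_gauss: product_prob_space "\<lambda>_. std_gauss" I for I
  by (simp add: product_prob_spaceI prob_space_std_gauss)

lemma prob_space_gauss: "prob_space (gauss I)"
  by (rule prob_space_PiM) (rule prob_space_std_gauss)

lemma sets_gauss: "sets (gauss I) = sets (Pi\<^sub>M I (\<lambda>_. borel))"
  by (intro sets_PiM_cong) auto

lemma measurable_gauss_iff:
  "f \<in> measurable (gauss I) N \<longleftrightarrow> f \<in> measurable (Pi\<^sub>M I (\<lambda>_. borel)) N"
  by (rule measurable_cong_sets[THEN eqset_imp_iff]) (auto simp: sets_gauss)

lemma dot_measurable [measurable]:
  assumes "finite I" shows "dot I u \<in> borel_measurable (gauss I)"
  unfolding measurable_gauss_iff dot_def by (intro borel_measurable_sum) simp

lemma nn_integral_std_gauss: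
  assumes "f \<in> borel_measurable borel"
  shows "(\<integral>\<^sup>+x. f x \<partial>std_gauss) = (\<integral>\<^sup>+x. ennreal (std_normal_density x) * f x \<partial>lborel)"
  using assms by (simp add: nn_integral_density)

text \<open>The matrix with rows \<open>(a, b)\<close> and \<open>(b, - a)\<close> is a reflection,
  so it preserves the product of the two densities. The variables are changed one at a time:
  \<open>u = a * x + b * y\<close> replaces \<open>y\<close> for fixed \<open>x\<close>, then
  \<open>v = (x - a * u) / b\<close> replaces \<open>x\<close> for fixed \<open>u\<close>. The
  factors \<open>1 / |b|\<close> and \<open>|b|\<close> cancel.\<close>

lemma std_gauss_reflection:
  fixes a b :: real
  assumes f [measurable]: "f \<in> borel_measurable (borel \<Otimes>\<^sub>M borel)"
    and ab: "a\<^sup>2 + b\<^sup>2 = 1" and b: "b \<noteq> 0"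
  shows "(\<integral>\<^sup>+x. \<integral>\<^sup>+y. f (a * x + b * y, b * x - a * y) \<partial>std_gauss \<partial>std_gauss) =
    (\<integral>\<^sup>+x. \<integral>\<^sup>+y. f (x, y) \<partial>std_gauss \<partial>std_gauss)"
proof -
  define g where "g u v = ennreal (std_normal_density u) * (ennreal (std_normal_density v) * f (u, v))"
    for u v
  have g [measurable]: "(\<lambda>(u, v). g u v) \<in> borel_measurable (borel \<Otimes>\<^sub>M borel)"
    unfolding g_def by measurable
  have unfold: "(\<integral>\<^sup>+x. \<integral>\<^sup>+y. h (x, y) \<partial>std_gauss \<partial>std_gauss) =
    (\<integral>\<^sup>+x. \<integral>\<^sup>+y. ennreal (std_normal_density x) * (ennreal (std_normal_density y) * h (x, y)) \<partial>lborel \<partial>lborel)"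
    if [measurable]: "h \<in> borel_measurable (borel \<Otimes>\<^sub>M borel)" for h
  proof -
    have m: "(\<lambda>x. \<integral>\<^sup>+y. h (x, y) \<partial>std_gauss) \<in> borel_measurable borel" by measurable
    show ?thesis
      by (subst nn_integral_std_gauss[OF m], intro nn_integral_cong, subst nn_integral_std_gauss)
        (auto simp: nn_integral_cmult)
  qed
  have sub1: "(\<integral>\<^sup>+y. g (a * x + b * y) (b * x - a * y) \<partial>lborel) =
    ennreal (1 / \<bar>b\<bar>) * (\<integral>\<^sup>+u. g u ((x - a * u) / b) \<partial>lborel)" for x
  proof -
    have "(\<integral>\<^sup>+u. g u ((x - a * u) / b) \<partial>lborel) =
      \<bar>b\<bar> * (\<integral>\<^sup>+y. g (a * x + b * y) ((x - a * (a * x + b * y)) / b) \<partial>lborel)"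
      by (rule nn_integral_real_affine[OF _ b]) measurable
    moreover have "(x - a * (a * x + b * y)) / b = b * x - a * y" for y
      using b ab by (simp add: field_simps power2_eq_square)
        (metis add.commute distrib_right mult.left_neutral mult.assoc)
    ultimately have "(\<integral>\<^sup>+u. g u ((x - a * u) / b) \<partial>lborel) =
      \<bar>b\<bar> * (\<integral>\<^sup>+y. g (a * x + b * y) (b * x - a * y) \<partial>lborel)" by simp
    moreover have "ennreal (1 / \<bar>b\<bar>) * ennreal \<bar>b\<bar> = 1"
      using b by (simp flip: ennreal_mult)
    ultimately show ?thesis by (simp flip: mult.assoc)
  qed
  have sub2: "(\<integral>\<^sup>+x. g u ((x - a * u) / b) \<partial>lborel) = \<bar>b\<bar> * (\<integral>\<^sup>+v. g u v \<partial>lborel)" for u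
  proof -
    have "(\<integral>\<^sup>+v. g u v \<partial>lborel) = \<bar>1 / b\<bar> * (\<integral>\<^sup>+x. g u (- a * u / b + 1 / b * x) \<partial>lborel)"
      by (rule nn_integral_real_affine) (use b in auto)
    moreover have "- a * u / b + 1 / b * x = (x - a * u) / b" for x
      using b by (simp add: field_simps)
    ultimately have "(\<integral>\<^sup>+v. g u v \<partial>lborel) = \<bar>1 / b\<bar> * (\<integral>\<^sup>+x. g u ((x - a * u) / b) \<partial>lborel)"
      by simp
    moreover have "ennreal \<bar>b\<bar> * ennreal \<bar>1 / b\<bar> = 1"
      using b by (simp flip: ennreal_mult)
    ultimately show ?thesis by (simp flip: mult.assoc)
  qed
  have dens: "ennreal (std_normal_density x) * (ennreal (std_normal_density y) * F) =
    ennreal (std_normal_density (a * x + b * y)) * (ennreal (std_normal_density (b * x - a * y)) * F)"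
    for x y F
  proof -
    have "(a * x + b * y)\<^sup>2 + (b * x - a * y)\<^sup>2 = (a\<^sup>2 + b\<^sup>2) * (x\<^sup>2 + y\<^sup>2)"
      by (simp add: power2_eq_square algebra_simps)
    then have "std_normal_density x * std_normal_density y =
      std_normal_density (a * x + b * y) * std_normal_density (b * x - a * y)"
      unfolding ab by (simp add: std_normal_density_def divide_simps flip: exp_add)
    then show ?thesis by (simp flip: mult.assoc ennreal_mult)
  qed
  have "(\<integral>\<^sup>+x. \<integral>\<^sup>+y. f (a * x + b * y, b * x - a * y) \<partial>std_gauss \<partial>std_gauss) =
    (\<integral>\<^sup>+x. \<integral>\<^sup>+y. g (a * x + b * y) (b * x - a * y) \<partial>lborel \<partial>lborel)"
    unfolding g_def
    by (subst unfold[of "\<lambda>(x, y). f (a * x + b * y, b * x - a * y)", simplified]) (simp_all flip: dens)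
  also have "\<dots> = ennreal (1 / \<bar>b\<bar>) * (\<integral>\<^sup>+x. \<integral>\<^sup>+u. g u ((x - a * u) / b) \<partial>lborel \<partial>lborel)"
    unfolding sub1 by (rule nn_integral_cmult) measurable
  also have "(\<integral>\<^sup>+x. \<integral>\<^sup>+u. g u ((x - a * u) / b) \<partial>lborel \<partial>lborel) =
    (\<integral>\<^sup>+u. \<integral>\<^sup>+x. g u ((x - a * u) / b) \<partial>lborel \<partial>lborel)"
    by (rule lborel_pair.Fubini') measurable
  also have "\<dots> = \<bar>b\<bar> * (\<integral>\<^sup>+u. \<integral>\<^sup>+v. g u v \<partial>lborel \<partial>lborel)"
    unfolding sub2 by (rule nn_integral_cmult) measurable
  also have "ennreal (1 / \<bar>b\<bar>) * (\<bar>b\<bar> * (\<integral>\<^sup>+u. \<integral>\<^sup>+v. g u v \<partial>lborel \<partial>lborel)) =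
    (\<integral>\<^sup>+u. \<integral>\<^sup>+v. g u v \<partial>lborel \<partial>lborel)"
    using b by (simp flip: mult.assoc ennreal_mult)
  also have "\<dots> = (\<integral>\<^sup>+x. \<integral>\<^sup>+y. f (x, y) \<partial>std_gauss \<partial>std_gauss)"
    unfolding g_def by (rule unfold[symmetric]) measurable
  finally show ?thesis .
qed

lemma measurable_gauss_givens:
  fixes i j :: 'i
  assumes I: "i \<in> I" "j \<in> I"
  shows "(\<lambda>x. x(i := a * x i + b * x j, j := b * x i - a * x j)) \<in> measurable (gauss I) (gauss I)"
proof (rule measurable_PiM_single')
  show "(\<lambda>x. (x(i := a * x i + b * x j, j := b * x i - a * x j)) k) \<in> measurable (gauss I) std_gauss"
    if "k \<in> I" for k
    using I that
    by (cases "k = j"; cases "k = i") (auto intro!: borel_measurable_add borel_measurable_diff borel_measurable_times)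
  show "(\<lambda>x. x(i := a * x i + b * x j, j := b * x i - a * x j)) \<in> space (gauss I) \<rightarrow> (\<Pi>\<^sub>E i\<in>I. space std_gauss)"
    using I by (auto simp: space_PiM PiE_def extensional_def)
qed

lemma nn_integral_gauss_givens:
  fixes i j :: 'i
  assumes I: "finite I" "i \<in> I" "j \<in> I" "i \<noteq> j"
    and ab: "a\<^sup>2 + b\<^sup>2 = 1" "b \<noteq> 0"
    and f [measurable]: "f \<in> borel_measurable (gauss I)"
  shows "(\<integral>\<^sup>+x. f (x(i := a * x i + b * x j, j := b * x i - a * x j)) \<partial>gauss I) = (\<integral>\<^sup>+x. f x \<partial>gauss I)"
proof -
  define T where "T x = x(i := a * x i + b * x j, j := b * x i - a * x j)" for x :: "'i \<Rightarrow> real"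
  define J where "J = I - {i, j}"
  have J: "finite J" "i \<notin> insert j J" "j \<notin> J" "I = insert i (insert j J)"
    using I by (auto simp: J_def)
  have T: "T \<in> measurable (gauss I) (gauss I)"
    unfolding T_def by (rule measurable_gauss_givens) (use I in auto)
  have split: "(\<integral>\<^sup>+x. h x \<partial>gauss I) = (\<integral>\<^sup>+z. \<integral>\<^sup>+y. \<integral>\<^sup>+x. h (z(j := y, i := x)) \<partial>std_gauss \<partial>std_gauss \<partial>gauss J)"
    if h: "h \<in> borel_measurable (gauss I)" for h
  proof -
    have h' [measurable]: "h \<in> borel_measurable (gauss (insert i (insert j J)))"
      using h J(4) by simp
    have m: "(\<lambda>z. \<integral>\<^sup>+x. h (z(i := x)) \<partial>std_gauss) \<in> borel_measurable (gauss (insert j J))"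
    proof (rule sigma_finite_measure.borel_measurable_nn_integral[OF prob_space_imp_sigma_finite[OF prob_space_std_gauss]])
      show "(\<lambda>(z, x). h (z(i := x))) \<in> borel_measurable (gauss (insert j J) \<Otimes>\<^sub>M std_gauss)"
        using measurable_compose[OF measurable_add_dim[of i "insert j J" "\<lambda>_. std_gauss"] h']
        by (simp add: case_prod_unfold)
    qed
    have "(\<integral>\<^sup>+x. h x \<partial>gauss (insert i (insert j J))) =
      (\<integral>\<^sup>+z. \<integral>\<^sup>+x. h (z(i := x)) \<partial>std_gauss \<partial>gauss (insert j J))"
      by (rule std_gauss.product_nn_integral_insert) (use J h' in auto)
    also have "\<dots> = (\<integral>\<^sup>+z. \<integral>\<^sup>+y. \<integral>\<^sup>+x. h (z(j := y, i := x)) \<partial>std_gauss \<partial>std_gauss \<partial>gauss J)"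
      by (rule std_gauss.product_nn_integral_insert) (use J m in auto)
    finally show ?thesis using J(4) by simp
  qed
  have fT: "(\<lambda>x. f (T x)) \<in> borel_measurable (gauss I)" using T f by (rule measurable_compose)
  have "(\<integral>\<^sup>+x. f (T x) \<partial>gauss I) = (\<integral>\<^sup>+z. \<integral>\<^sup>+y. \<integral>\<^sup>+x. f (T (z(j := y, i := x))) \<partial>std_gauss \<partial>std_gauss \<partial>gauss J)"
    by (rule split) (rule fT)
  also have "\<dots> = (\<integral>\<^sup>+z. \<integral>\<^sup>+y. \<integral>\<^sup>+x. f (z(j := y, i := x)) \<partial>std_gauss \<partial>std_gauss \<partial>gauss J)"
  proof (rule nn_integral_cong)
    fix z assume z: "z \<in> space (gauss J)"
    define h where "h = (\<lambda>(y, x). f (z(j := y, i := x)))"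
    have h: "h \<in> borel_measurable (borel \<Otimes>\<^sub>M borel)"
    proof -
      have "(\<lambda>p. z(j := fst p, i := snd p)) \<in> measurable (borel \<Otimes>\<^sub>M borel) (gauss I)"
      proof (rule measurable_PiM_single')
        show "(\<lambda>p. (z(j := fst p, i := snd p)) k) \<in> measurable (borel \<Otimes>\<^sub>M borel) std_gauss" if "k \<in> I" for k
          by (cases "k = j"; cases "k = i") auto
        show "(\<lambda>p. z(j := fst p, i := snd p)) \<in> space (borel \<Otimes>\<^sub>M borel) \<rightarrow> (\<Pi>\<^sub>E i\<in>I. space std_gauss)"
          using z by (auto simp: J(4) space_PiM PiE_def extensional_def)
      qed
      then have "(\<lambda>p. f (z(j := fst p, i := snd p))) \<in> borel_measurable (borel \<Otimes>\<^sub>M borel)"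
        using f by (rule measurable_compose)
      then show ?thesis unfolding h_def by (simp add: case_prod_unfold)
    qed
    \<comment> \<open>The outer variable is coordinate \<open>j\<close>, so in this order the pair
      is reflected with \<open>- a\<close> in place of \<open>a\<close>.\<close>
    have "(\<integral>\<^sup>+y. \<integral>\<^sup>+x. f (T (z(j := y, i := x))) \<partial>std_gauss \<partial>std_gauss) =
      (\<integral>\<^sup>+y. \<integral>\<^sup>+x. h ((- a) * y + b * x, b * y - (- a) * x) \<partial>std_gauss \<partial>std_gauss)"
      unfolding h_def T_def using I(4)
      by (intro nn_integral_cong) (simp add: fun_upd_twist algebra_simps)
    also have "\<dots> = (\<integral>\<^sup>+y. \<integral>\<^sup>+x. h (y, x) \<partial>std_gauss \<partial>std_gauss)"
      by (rule std_gauss_reflection) (use h ab in auto)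
    finally show "(\<integral>\<^sup>+y. \<integral>\<^sup>+x. f (T (z(j := y, i := x))) \<partial>std_gauss \<partial>std_gauss) =
      (\<integral>\<^sup>+y. \<integral>\<^sup>+x. f (z(j := y, i := x)) \<partial>std_gauss \<partial>std_gauss)"
      unfolding h_def by simp
  qed
  also have "\<dots> = (\<integral>\<^sup>+x. f x \<partial>gauss I)" by (rule split[symmetric]) (rule f)
  finally show "(\<integral>\<^sup>+x. f (x(i := a * x i + b * x j, j := b * x i - a * x j)) \<partial>gauss I) = (\<integral>\<^sup>+x. f x \<partial>gauss I)"
    unfolding T_def .
qed

lemma std_gauss_uminus:
  assumes [measurable]: "f \<in> borel_measurable borel"
  shows "(\<integral>\<^sup>+x. f (- x) \<partial>std_gauss) = (\<integral>\<^sup>+x. f x \<partial>std_gauss)"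
proof -
  have "(\<integral>\<^sup>+x. ennreal (std_normal_density x) * f x \<partial>lborel) =
    ennreal \<bar>- 1\<bar> * (\<integral>\<^sup>+x. ennreal (std_normal_density (0 + (- 1) * x)) * f (0 + (- 1) * x) \<partial>lborel)"
    by (rule nn_integral_real_affine) auto
  moreover have "(\<integral>\<^sup>+x. f (- x) \<partial>std_gauss) =
    (\<integral>\<^sup>+x. ennreal (std_normal_density x) * f (- x) \<partial>lborel)"
    by (rule nn_integral_std_gauss) measurable
  moreover have "std_normal_density (- x) = std_normal_density x" for x
    by (simp add: std_normal_density_def)
  ultimately show ?thesis by (simp add: nn_integral_std_gauss[OF assms])
qed

lemma measurable_gauss_flip:
  fixes i :: 'i
  assumes I: "i \<in> I"
  shows "(\<lambda>x. x(i := - x i)) \<in> measurable (gauss I) (gauss I)"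
proof (rule measurable_PiM_single')
  show "(\<lambda>x. (x(i := - x i)) k) \<in> measurable (gauss I) std_gauss" if "k \<in> I" for k
    using I that by (cases "k = i") (auto intro!: borel_measurable_uminus)
  show "(\<lambda>x. x(i := - x i)) \<in> space (gauss I) \<rightarrow> (\<Pi>\<^sub>E i\<in>I. space std_gauss)"
    using I by (auto simp: space_PiM PiE_def extensional_def)
qed

lemma nn_integral_gauss_flip:
  fixes i :: 'i
  assumes I: "finite I" "i \<in> I" and f [measurable]: "f \<in> borel_measurable (gauss I)"
  shows "(\<integral>\<^sup>+x. f (x(i := - x i)) \<partial>gauss I) = (\<integral>\<^sup>+x. f x \<partial>gauss I)"
proof -
  define J where "J = I - {i}"
  have J: "finite J" "i \<notin> J" "I = insert i J" using I by (auto simp: J_def)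
  have fT: "(\<lambda>x. f (x(i := - x i))) \<in> borel_measurable (gauss I)"
    using measurable_gauss_flip[OF I(2)] f by (rule measurable_compose)
  have split: "(\<integral>\<^sup>+x. h x \<partial>gauss I) = (\<integral>\<^sup>+z. \<integral>\<^sup>+x. h (z(i := x)) \<partial>std_gauss \<partial>gauss J)"
    if "h \<in> borel_measurable (gauss I)" for h
    unfolding J(3) using J that by (intro std_gauss.product_nn_integral_insert) auto
  have "(\<integral>\<^sup>+x. f (z(i := - x)) \<partial>std_gauss) = (\<integral>\<^sup>+x. f (z(i := x)) \<partial>std_gauss)"
    if z: "z \<in> space (gauss J)" for z
  proof (rule std_gauss_uminus)
    have "(\<lambda>x. z(i := x)) \<in> measurable borel (gauss I)"
    proof (rule measurable_PiM_single')
      show "(\<lambda>x. (z(i := x)) k) \<in> measurable borel std_gauss" if "k \<in> I" for k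
        by (cases "k = i") auto
      show "(\<lambda>x. z(i := x)) \<in> space borel \<rightarrow> (\<Pi>\<^sub>E i\<in>I. space std_gauss)"
        using z by (auto simp: J(3) space_PiM PiE_def extensional_def)
    qed
    then show "(\<lambda>x. f (z(i := x))) \<in> borel_measurable borel" using f by (rule measurable_compose)
  qed
  then have "(\<integral>\<^sup>+z. \<integral>\<^sup>+x. f (z(i := - x)) \<partial>std_gauss \<partial>gauss J) =
    (\<integral>\<^sup>+z. \<integral>\<^sup>+x. f (z(i := x)) \<partial>std_gauss \<partial>gauss J)"
    by (rule nn_integral_cong)
  then show "(\<integral>\<^sup>+x. f (x(i := - x i)) \<partial>gauss I) = (\<integral>\<^sup>+x. f x \<partial>gauss I)"
    unfolding split[OF f] split[OF fT] by simp
qed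

text \<open>Induction on the number of nonzero coordinates of \<open>n\<close> other than
  \<open>i0\<close>: reflecting in the plane of \<open>i0\<close> and \<open>j\<close> moves the
  mass of coordinate \<open>j\<close> into \<open>i0\<close>. At the end \<open>n\<close> is plus or
  minus the axis, and a sign flip settles the second case. \<open>T\<close> is described by its
  effect on measure and inner products, which spares any matrix.\<close>

lemma gauss_rotate_to_axis:
  fixes n :: "'i \<Rightarrow> real"
  assumes I: "finite I" "i0 \<in> I" and n: "dot I n n = 1"
  shows "\<exists>T. T \<in> measurable (gauss I) (gauss I) \<and>
    (\<forall>f \<in> borel_measurable (gauss I). (\<integral>\<^sup>+x. f (T x) \<partial>gauss I) = (\<integral>\<^sup>+x. f x \<partial>gauss I)) \<and>
    (\<forall>x y. dot I (T x) (T y) = dot I x y) \<and>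
    (\<forall>i\<in>I. T n i = (if i = i0 then 1 else 0))"
  using n
proof (induction "card {j \<in> I - {i0}. n j \<noteq> 0}" arbitrary: n)
  case 0
  then have z: "n j = 0" if "j \<in> I" "j \<noteq> i0" for j using that I by auto
  have "dot I n n = (\<Sum>i\<in>I. if i = i0 then n i0 * n i0 else 0)"
    unfolding dot_def using z by (intro sum.cong) auto
  also have "\<dots> = n i0 * n i0" using I by simp
  finally have "(n i0)\<^sup>2 = 1" using 0 by (simp add: power2_eq_square)
  then consider "n i0 = 1" | "n i0 = - 1" by (auto simp: power2_eq_1_iff)
  then show ?case
  proof cases
    case 1
    then show ?thesis using z by (intro exI[of _ "\<lambda>x. x"]) auto
  next
    case 2
    define T where "T x = x(i0 := - x i0)" for x :: "'i \<Rightarrow> real"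
    have "dot I (T x) (T y) = dot I x y" for x y
      unfolding dot_def T_def by (intro sum.cong) auto
    moreover have "T n i = (if i = i0 then 1 else 0)" if "i \<in> I" for i
      using z 2 that unfolding T_def by auto
    ultimately show ?thesis
      using measurable_gauss_flip[OF I(2)] nn_integral_gauss_flip[OF I] unfolding T_def[symmetric]
      by (intro exI[of _ T]) auto
  qed
next
  case (Suc m)
  then have "{j \<in> I - {i0}. n j \<noteq> 0} \<noteq> {}" by (metis card.empty nat.distinct(1))
  then obtain j where j: "j \<in> I" "j \<noteq> i0" "n j \<noteq> 0" by auto
  define r where "r = sqrt ((n i0)\<^sup>2 + (n j)\<^sup>2)"
  have r: "r\<^sup>2 = (n i0)\<^sup>2 + (n j)\<^sup>2" "r \<noteq> 0"
    using j unfolding r_def by (auto simp: sum_power2_eq_zero_iff)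
  define a b where "a = n i0 / r" and "b = n j / r"
  have ab: "a\<^sup>2 + b\<^sup>2 = 1" "b \<noteq> 0"
    using r j unfolding a_def b_def by (auto simp: power_divide simp flip: add_divide_distrib)
  define Q where "Q x = x(i0 := a * x i0 + b * x j, j := b * x i0 - a * x j)" for x :: "'i \<Rightarrow> real"
  have I': "I = insert i0 (insert j (I - {i0, j}))" using I j by auto
  have Qdot: "dot I (Q x) (Q y) = dot I x y" for x y
  proof -
    have s: "dot I u v = u i0 * v i0 + (u j * v j + (\<Sum>i\<in>I - {i0, j}. u i * v i))" for u v
      unfolding dot_def by (subst I', subst sum.insert, use I j in auto)
    have "(a * x i0 + b * x j) * (a * y i0 + b * y j) + (b * x i0 - a * x j) * (b * y i0 - a * y j) =
      (a\<^sup>2 + b\<^sup>2) * (x i0 * y i0 + x j * y j)"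
      by (simp add: power2_eq_square algebra_simps)
    moreover have "(\<Sum>i\<in>I - {i0, j}. Q x i * Q y i) = (\<Sum>i\<in>I - {i0, j}. x i * y i)"
      by (intro sum.cong) (auto simp: Q_def)
    ultimately show ?thesis unfolding s using j ab by (simp add: Q_def)
  qed
  have Qj: "Q n j = 0" using r unfolding Q_def a_def b_def by (simp add: mult.commute)
  have "{k \<in> I - {i0}. n k \<noteq> 0} = insert j {k \<in> I - {i0}. Q n k \<noteq> 0}"
    using j Qj unfolding Q_def by auto
  then have "m = card {k \<in> I - {i0}. Q n k \<noteq> 0}"
    using Suc(2) I Qj by simp
  moreover have "dot I (Q n) (Q n) = 1" unfolding Qdot by (rule Suc.prems)
  ultimately have "\<exists>T. T \<in> measurable (gauss I) (gauss I) \<and>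
    (\<forall>f \<in> borel_measurable (gauss I). (\<integral>\<^sup>+x. f (T x) \<partial>gauss I) = (\<integral>\<^sup>+x. f x \<partial>gauss I)) \<and>
    (\<forall>x y. dot I (T x) (T y) = dot I x y) \<and>
    (\<forall>i\<in>I. T (Q n) i = (if i = i0 then 1 else 0))"
    by (rule Suc.hyps(1))
  then obtain T where T: "T \<in> measurable (gauss I) (gauss I)"
    "\<And>f. f \<in> borel_measurable (gauss I) \<Longrightarrow> (\<integral>\<^sup>+x. f (T x) \<partial>gauss I) = (\<integral>\<^sup>+x. f x \<partial>gauss I)"
    "\<And>x y. dot I (T x) (T y) = dot I x y"
    "\<And>i. i \<in> I \<Longrightarrow> T (Q n) i = (if i = i0 then 1 else 0)"
    by blast
  have QM: "Q \<in> measurable (gauss I) (gauss I)"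
    using measurable_gauss_givens[OF I(2) j(1)] unfolding Q_def .
  have Qint: "(\<integral>\<^sup>+x. f (Q x) \<partial>gauss I) = (\<integral>\<^sup>+x. f x \<partial>gauss I)"
    if "f \<in> borel_measurable (gauss I)" for f
    using nn_integral_gauss_givens[OF I j(1) j(2)[symmetric] ab that] unfolding Q_def .
  have "(\<lambda>x. T (Q x)) \<in> measurable (gauss I) (gauss I)"
    using QM T(1) by (rule measurable_compose)
  moreover have "(\<integral>\<^sup>+x. f (T (Q x)) \<partial>gauss I) = (\<integral>\<^sup>+x. f x \<partial>gauss I)"
    if f: "f \<in> borel_measurable (gauss I)" for f
    using Qint[OF measurable_compose[OF T(1) f]] T(2)[OF f] by simp
  ultimately show ?case
    by (intro exI[of _ "\<lambda>x. T (Q x)"] conjI allI ballI) (simp_all only: T(3,4) Qdot)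
qed

text \<open>Once \<open>n k0\<close> is rotated to a coordinate axis, orthogonality makes all other
  vectors vanish in that coordinate. It therefore splits off as an independent standard normal
  factor, and the induction continues in the remaining coordinates. All later uses of rotation
  invariance go through this lemma.\<close>

lemma nn_integral_gauss_orthonormal:
  fixes n :: "'k \<Rightarrow> 'i \<Rightarrow> real"
  assumes "finite K" "finite I"
    and "\<And>k k'. k \<in> K \<Longrightarrow> k' \<in> K \<Longrightarrow> dot I (n k) (n k') = (if k = k' then 1 else 0)"
    and "f \<in> borel_measurable (gauss K)"
  shows "(\<integral>\<^sup>+x. f (\<lambda>k\<in>K. dot I (n k) x) \<partial>gauss I) = (\<integral>\<^sup>+z. f z \<partial>gauss K)"
  using assms
proof (induction K arbitrary: I n f)
  case empty
  show ?case
    by (simp add: prob_space.emeasure_space_1[OF prob_space_gauss] PiM_empty nn_integral_count_space_finite)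
next
  case (insert k0 K)
  note fin = \<open>finite I\<close> \<open>finite K\<close> and k0 = \<open>k0 \<notin> K\<close> and orth = insert.prems(2) and f = insert.prems(3)
  have "dot I (n k0) (n k0) = 1" using orth[of k0 k0] by simp
  moreover from this obtain i0 where i0: "i0 \<in> I" unfolding dot_def by fastforce
  ultimately have "\<exists>T. T \<in> measurable (gauss I) (gauss I) \<and>
    (\<forall>f \<in> borel_measurable (gauss I). (\<integral>\<^sup>+x. f (T x) \<partial>gauss I) = (\<integral>\<^sup>+x. f x \<partial>gauss I)) \<and>
    (\<forall>x y. dot I (T x) (T y) = dot I x y) \<and>
    (\<forall>i\<in>I. T (n k0) i = (if i = i0 then 1 else 0))"
    by (intro gauss_rotate_to_axis fin(1))
  then obtain T where T: "T \<in> measurable (gauss I) (gauss I)"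
    "\<And>f. f \<in> borel_measurable (gauss I) \<Longrightarrow> (\<integral>\<^sup>+x. f (T x) \<partial>gauss I) = (\<integral>\<^sup>+x. f x \<partial>gauss I)"
    "\<And>x y. dot I (T x) (T y) = dot I x y"
    "\<And>i. i \<in> I \<Longrightarrow> T (n k0) i = (if i = i0 then 1 else 0)"
    by blast
  define J where "J = I - {i0}"
  have J: "finite J" "i0 \<notin> J" "I = insert i0 J" using fin i0 by (auto simp: J_def)
  define n' where "n' k = T (n k)" for k
  have n'k0: "dot I (n' k0) x = x i0" for x
  proof -
    have "dot I (n' k0) x = (\<Sum>i\<in>I. if i = i0 then x i0 else 0)"
      unfolding dot_def n'_def using T(4) by (intro sum.cong) auto
    then show ?thesis using fin i0 by simp
  qed
  have n'0: "n' k i0 = 0" if "k \<in> K" for k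
  proof -
    have "dot I (n' k0) (n' k) = 0"
      unfolding n'_def T(3) using orth[of k0 k] that k0 by auto
    then show ?thesis using n'k0 by simp
  qed
  have dotJ: "dot I (n' k) x = dot J (n' k) x" if "k \<in> K" for k x
    unfolding dot_def J(3) using J n'0[OF that] by simp
  have orth': "dot J (n' k) (n' k') = (if k = k' then 1 else 0)" if "k \<in> K" "k' \<in> K" for k k'
    unfolding dotJ[OF that(1), symmetric] unfolding n'_def T(3) using orth that by auto
  define F where "F z = (\<integral>\<^sup>+y. f (z(k0 := y)) \<partial>std_gauss)" for z
  have F: "F \<in> borel_measurable (gauss K)"
    unfolding F_def
  proof (rule sigma_finite_measure.borel_measurable_nn_integral[OF prob_space_imp_sigma_finite[OF prob_space_std_gauss]])
    show "(\<lambda>(z, y). f (z(k0 := y))) \<in> borel_measurable (gauss K \<Otimes>\<^sub>M std_gauss)"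
      using measurable_compose[OF measurable_add_dim[of k0 K "\<lambda>_. std_gauss"] f]
        by (simp add: case_prod_unfold del: fun_upd_apply)
  qed
  define g where "g x = (\<lambda>k\<in>insert k0 K. dot I (n' k) x)" for x
  have g: "g \<in> measurable (gauss I) (gauss (insert k0 K))"
    unfolding g_def using fin(1) by (intro measurable_restrict) simp
  have "(\<integral>\<^sup>+x. f (\<lambda>k\<in>insert k0 K. dot I (n k) x) \<partial>gauss I) = (\<integral>\<^sup>+x. f (g (T x)) \<partial>gauss I)"
    by (simp add: g_def n'_def T(3))
  also have "\<dots> = (\<integral>\<^sup>+x. f (g x) \<partial>gauss I)"
    by (rule T(2)) (rule measurable_compose[OF g f])
  also have "\<dots> = (\<integral>\<^sup>+z. \<integral>\<^sup>+y. f (g (z(i0 := y))) \<partial>std_gauss \<partial>gauss J)"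
    unfolding J(3) by (rule std_gauss.product_nn_integral_insert)
      (use J measurable_compose[OF g f] in auto)
  also have "\<dots> = (\<integral>\<^sup>+z. F (\<lambda>k\<in>K. dot J (n' k) z) \<partial>gauss J)"
  proof (intro nn_integral_cong)
    fix z
    have "g (z(i0 := y)) = (\<lambda>k\<in>K. dot J (n' k) z)(k0 := y)" for y
    proof -
      have "dot J (n' k) (z(i0 := y)) = dot J (n' k) z" for k
        unfolding dot_def using J by (intro sum.cong) auto
      then show ?thesis
        unfolding g_def using k0 by (intro ext) (auto simp: n'k0 dotJ)
    qed
    then show "(\<integral>\<^sup>+y. f (g (z(i0 := y))) \<partial>std_gauss) = F (\<lambda>k\<in>K. dot J (n' k) z)"
      unfolding F_def by simp
  qed
  also have "\<dots> = (\<integral>\<^sup>+z. F z \<partial>gauss K)"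
    by (rule insert.IH) (use J orth' F in auto)
  also have "\<dots> = (\<integral>\<^sup>+z. f z \<partial>gauss (insert k0 K))"
    unfolding F_def using fin k0 f by (intro std_gauss.product_nn_integral_insert[symmetric]) auto
  finally show ?case .
qed

section \<open>Gaussian tails and moments\<close>

text \<open>Tilting the standard density by \<open>exp (- t * x\<^sup>2)\<close> gives a multiple of
  the normal density with variance \<open>1 / (1 + 2 * t)\<close>. Positive \<open>t\<close> serves
  for small balls, negative \<open>t\<close> for moments.\<close>

lemma nn_integral_std_gauss_exp_square:
  assumes t: "t > - (1 / 2)"
  shows "(\<integral>\<^sup>+x. ennreal (exp (- t * x\<^sup>2)) \<partial>std_gauss) = ennreal (1 / sqrt (1 + 2 * t))"
proof -
  define s where "s = 1 / sqrt (1 + 2 * t)"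
  have s: "s > 0" "s\<^sup>2 = 1 / (1 + 2 * t)" using t by (auto simp: s_def power_divide)
  have "std_normal_density x * exp (- t * x\<^sup>2) = s * normal_density 0 s x" for x
  proof -
    have "exp (- (x\<^sup>2 / 2)) * exp (- t * x\<^sup>2) = exp (- (x\<^sup>2 / (2 * s\<^sup>2)))"
      unfolding s(2) by (simp add: exp_add[symmetric] field_simps)
    then show ?thesis
      using s(1) by (simp add: std_normal_density_def normal_density_def real_sqrt_mult field_simps)
  qed
  then have "(\<integral>\<^sup>+x. ennreal (exp (- t * x\<^sup>2)) \<partial>std_gauss) = (\<integral>\<^sup>+x. ennreal s * ennreal (normal_density 0 s x) \<partial>lborel)"
    using s(1) by (subst nn_integral_std_gauss) (simp_all flip: ennreal_mult)
  also have "\<dots> = ennreal s * emeasure (density lborel (\<lambda>x. ennreal (normal_density 0 s x))) UNIV"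
    by (simp add: nn_integral_cmult emeasure_density)
  also have "emeasure (density lborel (\<lambda>x. ennreal (normal_density 0 s x))) UNIV = 1"
    using prob_space.emeasure_space_1[OF prob_space_normal_density[OF s(1), of 0]] by simp
  finally show ?thesis by (simp add: s_def)
qed

lemma nn_integral_gauss_exp_square:
  assumes I: "finite I" and t: "t > - (1 / 2)"
  shows "(\<integral>\<^sup>+x. ennreal (exp (- t * dot I x x)) \<partial>gauss I) = ennreal ((1 / sqrt (1 + 2 * t)) ^ card I)"
proof -
  have "ennreal (exp (- t * dot I x x)) = (\<Prod>i\<in>I. ennreal (exp (- t * (x i)\<^sup>2)))" for x
    unfolding dot_def by (simp add: prod_ennreal exp_sum[OF I, symmetric] sum_distrib_left power2_eq_square)
  then have "(\<integral>\<^sup>+x. ennreal (exp (- t * dot I x x)) \<partial>gauss I) =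
    (\<Prod>i\<in>I. \<integral>\<^sup>+x. ennreal (exp (- t * x\<^sup>2)) \<partial>std_gauss)"
    by (simp only:) (rule std_gauss.product_nn_integral_prod, use I in auto)
  also have "\<dots> = ennreal ((1 / sqrt (1 + 2 * t)) ^ card I)"
    unfolding nn_integral_std_gauss_exp_square[OF t] using t by (simp add: ennreal_power)
  finally show ?thesis .
qed

lemma dot_self_nonneg: "0 \<le> dot I x x"
  unfolding dot_def by (simp add: sum_nonneg)

lemma dot_self_measurable:
  assumes "finite I" shows "(\<lambda>x. dot I x x) \<in> borel_measurable (gauss I)"
  unfolding measurable_gauss_iff dot_def by (intro borel_measurable_sum) simp

lemma exp_power_nat: "exp (real d * c) = exp c ^ d"
  by (simp add: exp_of_nat_mult)

lemma gauss_small_ball: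
  assumes I: "finite I" "card I = d" "d > 0" and r: "r > 0"
  shows "emeasure (gauss I) {x \<in> space (gauss I). dot I x x < r\<^sup>2} \<le> ennreal ((sqrt (exp 1 / d) * r) ^ d)"
proof -
  note [measurable] = dot_self_measurable[OF I(1)]
  \<comment> \<open>A Chernoff bound. The exact optimum is \<open>1 + 2 * t = d / r\<^sup>2\<close>;
    with this slightly larger \<open>t\<close> the bound holds for every \<open>r > 0\<close> and
    the estimate \<open>2 * t \<le> 1 + 2 * t\<close> leads to the same final form.\<close>
  define t where "t = d / (2 * r\<^sup>2)"
  have t: "t > 0" using I r by (simp add: t_def)
  have "emeasure (gauss I) {x \<in> space (gauss I). dot I x x < r\<^sup>2} =
    (\<integral>\<^sup>+x. indicator {x \<in> space (gauss I). dot I x x < r\<^sup>2} x \<partial>gauss I)"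
    by (rule nn_integral_indicator[symmetric]) measurable
  also have "\<dots> \<le> (\<integral>\<^sup>+x. ennreal (exp (t * r\<^sup>2)) * ennreal (exp (- t * dot I x x)) \<partial>gauss I)"
  proof (rule nn_integral_mono)
    fix x
    have "1 \<le> exp (t * r\<^sup>2) * exp (- t * dot I x x)" if "dot I x x < r\<^sup>2"
      using that t by (simp flip: exp_add)
    then show "indicator {x \<in> space (gauss I). dot I x x < r\<^sup>2} x \<le>
      ennreal (exp (t * r\<^sup>2)) * ennreal (exp (- t * dot I x x))"
      by (auto simp: indicator_def simp flip: ennreal_mult ennreal_1 intro!: ennreal_leI)
  qed
  also have "\<dots> = ennreal (exp (t * r\<^sup>2)) * ennreal ((1 / sqrt (1 + 2 * t)) ^ d)"
    using nn_integral_gauss_exp_square[OF I(1), of t] t I by (subst nn_integral_cmult) auto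
  also have "\<dots> = ennreal ((exp (1 / 2) * (1 / sqrt (1 + 2 * t))) ^ d)"
  proof -
    have "exp (t * r\<^sup>2) = exp (1 / 2) ^ d"
      using r by (simp add: t_def exp_power_nat[symmetric])
    moreover have "0 \<le> (1 / sqrt (1 + 2 * t)) ^ d" using t by simp
    ultimately show ?thesis by (simp only: power_mult_distrib) (simp flip: ennreal_mult)
  qed
  also have "\<dots> \<le> ennreal ((sqrt (exp 1 / d) * r) ^ d)"
  proof (intro ennreal_leI power_mono)
    have "sqrt (d / r\<^sup>2) \<le> sqrt (1 + 2 * t)" using r by (simp add: t_def)
    then have "1 / sqrt (1 + 2 * t) \<le> 1 / sqrt (d / r\<^sup>2)"
      using I r t by (intro divide_left_mono) auto
    also have "\<dots> = r / sqrt d" using r by (simp add: real_sqrt_divide)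
    finally have "1 / sqrt (1 + 2 * t) \<le> r / sqrt d" .
    then have "exp (1 / 2) * (1 / sqrt (1 + 2 * t)) \<le> exp (1 / 2) * (r / sqrt d)"
      by (intro mult_left_mono) auto
    moreover have "exp (1 / 2) = sqrt (exp (1::real))"
      by (rule real_sqrt_unique[symmetric]) (auto simp: power2_eq_square simp flip: exp_add)
    ultimately show "exp (1 / 2) * (1 / sqrt (1 + 2 * t)) \<le> sqrt (exp 1 / d) * r"
      by (simp add: real_sqrt_divide)
  qed (use t in auto)
  finally show ?thesis .
qed

text \<open>The tangent inequality \<open>u \<le> exp (u - 1)\<close>, applied to
  \<open>u = |x|\<^sup>2 / (a + d)\<close>, bounds the power by an exponential whose integral is
  known. The remaining factor \<open>(1 + d / a) ^ (a / 2)\<close> is at most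
  \<open>exp (d / 2)\<close>, which the exponential constant in \<open>c\<close> cancels.\<close>

lemma gauss_norm_moment_le:
  assumes I: "finite I" "card I = a" "a > 0" and d: "d > 0"
  shows "(\<integral>\<^sup>+x. ennreal (sqrt (dot I x x) ^ d) \<partial>gauss I) \<le> ennreal (sqrt (real a + real d) ^ d)"
proof -
  note [measurable] = dot_self_measurable[OF I(1)]
  define t where "t = d / (2 * (real a + real d))"
  have t: "t > 0" "1 - 2 * t = a / (real a + real d)" using I d by (simp_all add: t_def field_simps)
  have "0 < a / (real a + real d)" using I by simp
  then have t2: "- t > - (1 / 2)" using t(2) by linarith
  define c where "c = sqrt (real a + real d) ^ d * exp (- real d / 2)"
  have c: "c \<ge> 0" unfolding c_def by simp
  have "(\<integral>\<^sup>+x. ennreal (sqrt (dot I x x) ^ d) \<partial>gauss I) \<le>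
    (\<integral>\<^sup>+x. ennreal c * ennreal (exp (- (- t) * dot I x x)) \<partial>gauss I)"
  proof (rule nn_integral_mono)
    fix x
    define u where "u = dot I x x / (real a + real d)"
    have u: "u \<ge> 0" unfolding u_def using dot_self_nonneg[of I x] by simp
    have "u \<le> exp (u - 1)" using exp_ge_add_one_self[of "u - 1"] by simp
    then have "sqrt u \<le> sqrt (exp (u - 1))" by simp
    also have "\<dots> = exp ((u - 1) / 2)"
      by (rule real_sqrt_unique) (auto simp: power2_eq_square simp flip: exp_add)
    finally have "sqrt u ^ d \<le> exp ((u - 1) / 2) ^ d" using u by (intro power_mono) auto
    also have "\<dots> = exp (- real d / 2) * exp (t * dot I x x)"
      using I by (simp add: exp_power_nat[symmetric] t_def u_def algebra_simps diff_divide_distrib flip: exp_add)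
    finally have "sqrt (real a + real d) ^ d * sqrt u ^ d \<le> c * exp (t * dot I x x)"
      unfolding c_def mult.assoc by (intro mult_left_mono) auto
    also have "sqrt (real a + real d) ^ d * sqrt u ^ d = sqrt (dot I x x) ^ d"
      using I by (simp add: u_def real_sqrt_divide flip: power_mult_distrib)
    finally show "ennreal (sqrt (dot I x x) ^ d) \<le> ennreal c * ennreal (exp (- (- t) * dot I x x))"
      using c by (simp flip: ennreal_mult add: ennreal_leI)
  qed
  also have "\<dots> = ennreal (c * (1 / sqrt (a / (real a + real d))) ^ a)"
    using nn_integral_gauss_exp_square[OF I(1) t2] t c I
    by (subst nn_integral_cmult) (auto simp: ennreal_mult)
  also have "\<dots> \<le> ennreal (sqrt (real a + real d) ^ d)"
  proof (rule ennreal_leI)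
    have "1 / sqrt (a / (real a + real d)) = sqrt (1 + d / a)"
      using I by (simp add: real_sqrt_divide field_simps flip: real_sqrt_mult)
    also have "\<dots> \<le> sqrt (exp (d / a))" by (simp add: exp_ge_add_one_self)
    also have "\<dots> = exp (d / a / 2)"
      by (rule real_sqrt_unique) (auto simp: power2_eq_square simp flip: exp_add)
    finally have "(1 / sqrt (a / (real a + real d))) ^ a \<le> exp (d / a / 2) ^ a"
      by (intro power_mono) auto
    also have "\<dots> = exp (d / 2)" using I by (simp add: exp_power_nat[symmetric])
    finally have "c * (1 / sqrt (a / (real a + real d))) ^ a \<le> c * exp (d / 2)"
      using c by (intro mult_left_mono)
    also have "\<dots> = sqrt (real a + real d) ^ d" by (simp add: c_def exp_minus)
    finally show "c * (1 / sqrt (a / (real a + real d))) ^ a \<le> sqrt (real a + real d) ^ d" .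
  qed
  finally show ?thesis .
qed

lemma nn_integral_std_gauss_square: "(\<integral>\<^sup>+x. ennreal (x\<^sup>2) \<partial>std_gauss) = 1"
proof -
  have "(\<integral>\<^sup>+x. ennreal (x\<^sup>2) \<partial>std_gauss) = (\<integral>\<^sup>+x. ennreal (std_normal_density x * x ^ (2 * 1)) \<partial>lborel)"
    by (subst nn_integral_std_gauss) (auto simp: ennreal_mult)
  also have "\<dots> = ennreal (fact (2 * 1) / (2 ^ 1 * fact 1))"
    using std_normal_moment_even[of 1]
    by (subst nn_integral_eq_integral) (auto simp: has_bochner_integral_iff)
  finally show ?thesis by simp
qed

lemma gauss_norm_second_moment:
  assumes I: "finite I"
  shows "(\<integral>\<^sup>+x. ennreal (dot I x x) \<partial>gauss I) = ennreal (card I)"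
proof -
  have "(\<integral>\<^sup>+x. ennreal ((x i)\<^sup>2) \<partial>gauss I) = 1" if "i \<in> I" for i
  proof -
    have "distr (gauss I) std_gauss (\<lambda>x. x i) = std_gauss"
      by (rule distr_PiM_component) (use that prob_space_std_gauss in auto)
    then have "1 = (\<integral>\<^sup>+y. ennreal (y\<^sup>2) \<partial>distr (gauss I) std_gauss (\<lambda>x. x i))"
      using nn_integral_std_gauss_square by simp
    also have "\<dots> = (\<integral>\<^sup>+x. ennreal ((x i)\<^sup>2) \<partial>gauss I)"
      using that by (intro nn_integral_distr) auto
    finally show ?thesis by simp
  qed
  then have "(\<Sum>i\<in>I. \<integral>\<^sup>+x. ennreal ((x i)\<^sup>2) \<partial>gauss I) = (\<Sum>i\<in>I. 1)"
    by (rule sum.cong[OF refl])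
  moreover have "(\<integral>\<^sup>+x. ennreal (dot I x x) \<partial>gauss I) = (\<integral>\<^sup>+x. (\<Sum>i\<in>I. ennreal ((x i)\<^sup>2)) \<partial>gauss I)"
    unfolding dot_def by (intro nn_integral_cong) (simp add: sum_ennreal power2_eq_square)
  moreover have "\<dots> = (\<Sum>i\<in>I. \<integral>\<^sup>+x. ennreal ((x i)\<^sup>2) \<partial>gauss I)"
    by (rule nn_integral_sum) (simp add: measurable_gauss_iff)
  ultimately show ?thesis by (simp add: ennreal_of_nat_eq_real_of_nat)
qed

text \<open>The sharper moment bounds for the cases \<open>p \<le> 1\<close>. The first moment
  follows from the second by the inequality of arithmetic and geometric means.\<close>

lemma gauss_norm_low_moment_le:
  assumes I: "finite I" "card I = a" "a > 0" and d: "d = 1 \<or> d = 2"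
  shows "(\<integral>\<^sup>+x. ennreal (sqrt (dot I x x) ^ d) \<partial>gauss I) \<le> ennreal (sqrt (real a) ^ d)"
  using d
proof
  note [measurable] = dot_self_measurable[OF I(1)]
  assume d: "d = 1"
  define c where "c = 1 / (2 * sqrt a)"
  have c: "c > 0" using I by (simp add: c_def)
  have "(\<integral>\<^sup>+x. ennreal (sqrt (dot I x x) ^ d) \<partial>gauss I) \<le>
    (\<integral>\<^sup>+x. ennreal c * ennreal (dot I x x) + ennreal (sqrt a / 2) \<partial>gauss I)"
  proof (rule nn_integral_mono)
    fix x
    define u where "u = sqrt (dot I x x)"
    have u: "u \<ge> 0" "dot I x x = u\<^sup>2" using dot_self_nonneg[of I x] by (auto simp: u_def)
    have "0 \<le> (u - sqrt a)\<^sup>2" by simp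
    then have "2 * sqrt a * u \<le> u\<^sup>2 + a" by (simp add: power2_diff algebra_simps)
    then have "u \<le> (u\<^sup>2 + a) / (2 * sqrt a)" using I by (simp add: field_simps)
    also have "\<dots> = c * u\<^sup>2 + sqrt a / 2"
      using I by (simp add: c_def add_divide_distrib real_div_sqrt)
    finally show "ennreal (sqrt (dot I x x) ^ d) \<le> ennreal c * ennreal (dot I x x) + ennreal (sqrt a / 2)"
      unfolding d u(2) using u(1) c by (simp flip: ennreal_mult ennreal_plus add: ennreal_leI)
  qed
  also have "\<dots> = ennreal c * ennreal a + ennreal (sqrt a / 2)"
    using I c gauss_norm_second_moment[OF I(1)] prob_space.emeasure_space_1[OF prob_space_gauss[of I]]
    by (simp add: nn_integral_add nn_integral_cmult)
  also have "\<dots> = ennreal (sqrt a ^ d)"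
  proof -
    have "c * a + sqrt a / 2 = sqrt a" using I by (simp add: c_def field_simps)
    then show ?thesis using c d by (simp flip: ennreal_mult ennreal_plus)
  qed
  finally show ?thesis .
next
  assume d: "d = 2"
  then show ?thesis using gauss_norm_second_moment[OF I(1)] I by (simp add: dot_self_nonneg)
qed

text \<open>The two sides are about 0.303 and 0.317, so a moderately sharp estimate suffices: on
  \<open>[-1, 1]\<close> the density is replaced by its Taylor polynomial of degree 4, which is an
  upper bound and is integrated exactly.\<close>

lemma std_gauss_tail_one:
  "ennreal (1 / (2 * sqrt (exp 1))) \<le> emeasure std_gauss {x. 1 < \<bar>x\<bar>}"
proof -
  define g where "g x = (1 - x\<^sup>2 / 2 + x ^ 4 / 8) / sqrt (2 * pi)" for x :: real
  define G where "G x = (x - x ^ 3 / 6 + x ^ 5 / 40) / sqrt (2 * pi)" for x :: real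
  have g0: "g x \<ge> 0" for x
  proof -
    have "1 - x\<^sup>2 / 2 + x ^ 4 / 8 = (1 - x\<^sup>2 / 4)\<^sup>2 + x ^ 4 / 16"
      by (simp add: power2_eq_square eval_nat_numeral field_simps)
    then show ?thesis unfolding g_def by (simp del: minus_diff_eq)
  qed
  have dens: "std_normal_density x \<le> g x" for x
  proof -
    \<comment> \<open>The factors \<open>1 + u + u\<^sup>2 / 2\<close> and
      \<open>1 - u + u\<^sup>2 / 2\<close> have product at least 1, and the first is at most
      \<open>exp u\<close>; so the second is at least \<open>exp (- u)\<close>.\<close>
    have "exp (- (x\<^sup>2 / 2)) \<le> 1 - x\<^sup>2 / 2 + (x\<^sup>2 / 2)\<^sup>2 / 2"
    proof -
      define u where "u = x\<^sup>2 / 2"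
      have u: "1 + u + u\<^sup>2 / 2 \<le> exp u" "u \<ge> 0" unfolding u_def by (auto intro: exp_lower_Taylor_quadratic)
      have "(1 + u + u\<^sup>2 / 2) * (1 - u + u\<^sup>2 / 2) = 1 + (u\<^sup>2 / 2)\<^sup>2"
        by (simp add: power2_eq_square field_simps)
      then have "1 \<le> (1 + u + u\<^sup>2 / 2) * (1 - u + u\<^sup>2 / 2)" by simp
      moreover have p: "1 + u + u\<^sup>2 / 2 > 0" using u(2) by (simp add: add_pos_nonneg)
      ultimately have "1 / (1 + u + u\<^sup>2 / 2) \<le> 1 - u + u\<^sup>2 / 2"
        by (subst pos_divide_le_eq) (auto simp: mult.commute)
      moreover have "exp (- u) \<le> 1 / (1 + u + u\<^sup>2 / 2)"
        unfolding exp_minus inverse_eq_divide using u p by (intro divide_left_mono) auto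
      ultimately show ?thesis unfolding u_def by linarith
    qed
    then show ?thesis unfolding g_def std_normal_density_def
      by (simp add: divide_right_mono power_divide flip: power_mult)
  qed
  have "emeasure std_gauss {x. \<bar>x\<bar> \<le> 1} = (\<integral>\<^sup>+x. ennreal (std_normal_density x) * indicator {-1..1} x \<partial>lborel)"
  proof -
    have "{x. \<bar>x\<bar> \<le> 1} = {-1..1::real}" by auto
    then show ?thesis by (simp add: emeasure_density)
  qed
  also have "\<dots> \<le> (\<integral>\<^sup>+x. ennreal (g x) * indicator {-1..1} x \<partial>lborel)"
    using dens by (intro nn_integral_mono mult_right_mono) (auto intro: ennreal_leI)
  also have "\<dots> = ennreal (G 1 - G (- 1))"
  proof (rule nn_integral_FTC_Icc)
    show "DERIV G x :> g x" for x
    proof -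
      define c where "c = sqrt (2 * pi)"
      have c: "c > 0" unfolding c_def by simp
      show ?thesis
        unfolding G_def g_def c_def[symmetric]
        using c by (auto intro!: derivative_eq_intros simp: field_simps)
    qed
  qed (use g0 in \<open>auto simp: g_def\<close>)
  also have "\<dots> \<le> ennreal (1 - 1 / (2 * sqrt (exp 1)))"
  proof (rule ennreal_leI)
    have "(249 / 100)\<^sup>2 \<le> 2 * pi" using pi_approx by (simp add: power2_eq_square)
    then have "249 / 100 \<le> sqrt (2 * pi)" by (rule real_le_rsqrt)
    then have "(103 / 60) / sqrt (2 * pi) \<le> (103 / 60) / (249 / 100)" by (intro divide_left_mono) auto
    moreover have "G 1 - G (- 1) = (103 / 60) / sqrt (2 * pi)"
      unfolding G_def by (simp flip: diff_divide_distrib)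
    ultimately have "G 1 - G (- 1) \<le> (103 / 60) / (249 / 100)" by simp
    moreover have "(164 / 100)\<^sup>2 \<le> exp (1::real)" using e_approx_32 by (simp add: power2_eq_square abs_if split: if_splits)
    then have "164 / 100 \<le> sqrt (exp 1)" by (rule real_le_rsqrt)
    then have "1 / (2 * sqrt (exp 1)) \<le> 1 / (2 * (164 / 100))" by (intro divide_left_mono) auto
    ultimately show "G 1 - G (- 1) \<le> 1 - 1 / (2 * sqrt (exp 1))" by simp
  qed
  finally have le: "emeasure std_gauss {x. \<bar>x\<bar> \<le> 1} \<le> ennreal (1 - 1 / (2 * sqrt (exp 1)))" .
  note fin = finite_measure.emeasure_eq_measure[OF prob_space.finite_measure[OF prob_space_std_gauss]]
  have pos: "1 / (2 * sqrt (exp 1)) \<le> (1::real)"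
  proof -
    have "1 \<le> sqrt (exp 1)" by simp
    then show ?thesis by (simp add: divide_le_eq del: real_sqrt_ge_1_iff)
  qed
  have "measure std_gauss {x. \<bar>x\<bar> \<le> 1} \<le> 1 - 1 / (2 * sqrt (exp 1))"
    using le pos unfolding fin by (subst (asm) ennreal_le_iff) auto
  moreover have "{x. 1 < \<bar>x\<bar>} = space std_gauss - {x. \<bar>x\<bar> \<le> (1::real)}" by auto
  then have "measure std_gauss {x. 1 < \<bar>x\<bar>} = 1 - measure std_gauss {x. \<bar>x\<bar> \<le> 1}"
    by (simp only:) (rule prob_space.prob_compl[OF prob_space_std_gauss], simp)
  ultimately show ?thesis unfolding fin by (intro ennreal_leI) linarith
qed

text \<open>A tail bound of the form \<open>const ^ d\<close> is wanted, since it is later absorbed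
  into a \<open>d\<close>-th power. It is enough to integrate the density over one short interval
  beyond \<open>sqrt d\<close> on either side.\<close>

lemma std_gauss_tail_sqrt:
  assumes d: "d \<ge> 3"
  shows "ennreal ((1 / (2 * sqrt (exp 1))) ^ d) \<le> emeasure std_gauss {x. sqrt (real d) < \<bar>x\<bar>}"
proof -
  define s where "s = sqrt (real d)"
  have s: "s > 0" "s\<^sup>2 = d" using d by (auto simp: s_def)
  \<comment> \<open>From \<open>s\<close> to \<open>s + h\<close> the exponent
    \<open>x\<^sup>2 / 2\<close> grows by just \<open>1 + 1 / (2 * d)\<close>, so the density loses
    only a bounded factor on the interval.\<close>
  define h where "h = 1 / s"
  have h: "h > 0" "h * s = 1" "h\<^sup>2 = 1 / d" using s by (auto simp: h_def power_divide)
  define A where "A = {s<..s + h} \<union> {- (s + h)..<- s}"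
  define c where "c = std_normal_density (s + h)"
  have c: "c \<ge> 0" unfolding c_def by simp
  have num: "(1 / (2 * sqrt (exp 1))) ^ d \<le> c * (2 * h)"
  proof -
    \<comment> \<open>After squaring, the claim is
      \<open>2 * pi * exp (2 + 1 / d) * d \<le> 4 * 4 ^ d\<close>. For \<open>d \<ge> 3\<close> the
      constant 66 bounds \<open>2 * pi * exp (2 + 1 / d)\<close>; at \<open>d = 2\<close> the
      inequality with 66 would fail.\<close>
    have four: "66 * real d \<le> 4 * 4 ^ d"
      using d by (induction d rule: nat_induct_at_least) auto
    have "exp (1 / d) ^ 3 \<le> exp (1::real)"
      using d by (simp flip: exp_of_nat_mult)
    also have "\<dots> \<le> (141 / 100) ^ 3" using e_approx_32 by (simp add: eval_nat_numeral abs_if split: if_splits)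
    finally have "exp (1 / d) \<le> 141 / 100" by (rule power_le_imp_le_base[of _ 2, simplified]) auto
    moreover have "exp (2 :: real) \<le> 739 / 100"
    proof -
      have "exp (2 :: real) = exp 1 * exp 1" by (simp flip: exp_add)
      also have "\<dots> \<le> 27183 / 10000 * (27183 / 10000)"
        using e_approx_32 by (intro mult_mono) (auto simp: abs_if split: if_splits)
      finally show ?thesis by simp
    qed
    ultimately have "exp (2 + 1 / d) \<le> 739 / 100 * (141 / 100)"
      unfolding exp_add by (intro mult_mono) auto
    then have "2 * pi * exp (2 + 1 / d) \<le> 2 * 3.1416 * (739 / 100 * (141 / 100))"
      using pi_approx by (intro mult_mono) auto
    then have "2 * pi * exp (2 + 1 / d) \<le> 66" by simp
    then have "2 * pi * exp (2 + 1 / d) * d \<le> 4 * 4 ^ d"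
      using four mult_right_mono[of "2 * pi * exp (2 + 1 / d)" 66 "real d"] by linarith
    then have "sqrt (2 * pi * exp (2 + 1 / d) * d) \<le> sqrt (4 * 4 ^ d)" by simp
    moreover have "sqrt (4 * 4 ^ d) = 2 * 2 ^ d" by (simp add: real_sqrt_mult real_sqrt_power)
    moreover have "sqrt (2 * pi * exp (2 + 1 / d) * d) = sqrt (2 * pi) * exp (1 + 1 / (2 * d)) * s"
    proof -
      have "sqrt (exp (2 + 1 / d)) = exp (1 + 1 / (2 * d))"
        by (rule real_sqrt_unique) (auto simp: power2_eq_square simp flip: exp_add)
      then show ?thesis by (simp add: real_sqrt_mult s_def)
    qed
    ultimately have "sqrt (2 * pi) * exp (1 + 1 / (2 * d)) * s \<le> 2 * 2 ^ d" by simp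
    then have "1 / 2 ^ d \<le> 2 * h / (sqrt (2 * pi) * exp (1 + 1 / (2 * d)))"
      using s by (simp add: h_def field_simps)
    then have "exp (- real d / 2) * (1 / 2 ^ d) \<le> exp (- real d / 2) * (2 * h / (sqrt (2 * pi) * exp (1 + 1 / (2 * d))))"
      by (rule mult_left_mono) simp
    also have "\<dots> = c * (2 * h)"
    proof -
      have "(s + h)\<^sup>2 / 2 = real d / 2 + (1 + 1 / (2 * d))"
        using s h by (simp add: power2_sum mult.commute field_simps)
      then have "c = exp (- (real d / 2 + (1 + 1 / (2 * d)))) / sqrt (2 * pi)"
        unfolding c_def std_normal_density_def by simp
      also have "\<dots> = exp (- real d / 2) / exp (1 + 1 / (2 * d)) / sqrt (2 * pi)"
        by (simp only: minus_add_distrib exp_diff[symmetric]) simp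
      finally show ?thesis by simp
    qed
    also have "exp (- real d / 2) * (1 / 2 ^ d) = (1 / (2 * sqrt (exp 1))) ^ d"
    proof -
      have "exp (1 / 2) = sqrt (exp (1::real))"
        by (rule real_sqrt_unique[symmetric]) (auto simp: power2_eq_square simp flip: exp_add)
      then have "exp (- real d / 2) = (1 / sqrt (exp 1)) ^ d"
        using exp_power_nat[of d "- (1 / 2)"] by (simp add: exp_minus inverse_eq_divide)
      then show ?thesis by (simp add: power_divide power_mult_distrib)
    qed
    finally show ?thesis .
  qed
  have "emeasure lborel A = ennreal (2 * h)"
    unfolding A_def using h s by (subst plus_emeasure[symmetric]) (auto simp flip: ennreal_plus)
  then have "ennreal (c * (2 * h)) = (\<integral>\<^sup>+x. ennreal c * indicator A x \<partial>lborel)"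
    using c h by (simp add: nn_integral_cmult A_def ennreal_mult)
  also have "\<dots> \<le> (\<integral>\<^sup>+x. ennreal (std_normal_density x) * indicator {x. s < \<bar>x\<bar>} x \<partial>lborel)"
  proof (rule nn_integral_mono)
    fix x
    have "c \<le> std_normal_density x" if "x \<in> A"
    proof -
      have "\<bar>x\<bar> \<le> s + h" using that s h by (auto simp: A_def)
      then have "x\<^sup>2 \<le> (s + h)\<^sup>2" by (metis abs_ge_zero power2_abs power_mono)
      then show ?thesis unfolding c_def std_normal_density_def by (simp add: divide_right_mono)
    qed
    moreover have "s < \<bar>x\<bar>" if "x \<in> A" using that s by (auto simp: A_def)
    ultimately show "ennreal c * indicator A x \<le> ennreal (std_normal_density x) * indicator {x. s < \<bar>x\<bar>} x"
      by (auto simp: indicator_def intro: ennreal_leI)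
  qed
  also have "\<dots> = emeasure std_gauss {x. s < \<bar>x\<bar>}" by (simp add: emeasure_density)
  finally show ?thesis using num unfolding s_def
    by (meson ennreal_leI order_trans)
qed

section \<open>Orthonormal systems and the spectral theorem\<close>

definition orthonormal :: "nat \<Rightarrow> nat \<Rightarrow> (nat \<Rightarrow> nat \<Rightarrow> real) \<Rightarrow> bool" where
  "orthonormal m r w \<longleftrightarrow> (\<forall>i<r. \<forall>i'<r. dot {..<m} (w i) (w i') = (if i = i' then 1 else 0))"

lemma dot_commute: "dot I u v = dot I v u"
  unfolding dot_def by (simp add: mult.commute)

lemma dot_add_right: "dot I u (\<lambda>i. v i + w i) = dot I u v + dot I u w"
  unfolding dot_def by (simp add: distrib_left sum.distrib)

lemma dot_diff_right: "dot I u (\<lambda>i. v i - w i) = dot I u v - dot I u w"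
  unfolding dot_def by (simp add: right_diff_distrib sum_subtractf)

lemma dot_scale_right: "dot I u (\<lambda>i. c * v i) = c * dot I u v"
  unfolding dot_def by (simp add: sum_distrib_left mult_ac)

lemma dot_scale_left: "dot I (\<lambda>i. c * v i) u = c * dot I v u"
  unfolding dot_def by (simp add: sum_distrib_left mult_ac)

lemma dot_sum_right: "dot I u (\<lambda>i. \<Sum>k\<in>K. c k * v k i) = (\<Sum>k\<in>K. c k * dot I u (v k))"
  unfolding dot_def by (simp add: sum_distrib_left mult_ac) (rule sum.swap)

lemma dot_sum_left: "dot I (\<lambda>i. \<Sum>k\<in>K. c k * v k i) u = (\<Sum>k\<in>K. c k * dot I (v k) u)"
  by (simp add: dot_commute[of I _ u] dot_sum_right)

lemma dot_cong:
  "(\<And>i. i \<in> I \<Longrightarrow> u i = u' i) \<Longrightarrow> (\<And>i. i \<in> I \<Longrightarrow> v i = v' i) \<Longrightarrow> dot I u v = dot I u' v'"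
  unfolding dot_def by simp

lemma dot_self_eq_0_iff: "finite I \<Longrightarrow> dot I x x = 0 \<longleftrightarrow> (\<forall>i\<in>I. x i = 0)"
  unfolding dot_def by (subst sum_nonneg_eq_0_iff) auto

lemma dot_self_pos: "finite I \<Longrightarrow> i \<in> I \<Longrightarrow> x i \<noteq> 0 \<Longrightarrow> 0 < dot I x x"
  using dot_self_eq_0_iff[of I x] dot_self_nonneg[of I x] by (auto simp: less_le)

text \<open>Padding the \<open>r\<close> equations with zero rows gives a square matrix with a
  vanishing row, hence with determinant 0 and a nontrivial kernel.\<close>

lemma homogeneous_system_nontrivial:
  fixes M :: "nat \<Rightarrow> nat \<Rightarrow> real"
  assumes "r < m"
  shows "\<exists>u. (\<exists>j<m. u j \<noteq> 0) \<and> (\<forall>i<r. dot {..<m} (M i) u = 0)"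
proof -
  define N where "N = mat m m (\<lambda>(i, j). if i < r then M i j else 0)"
  have N: "N \<in> carrier_mat m m" unfolding N_def by simp
  have "N\<^sup>T *\<^sub>v unit_vec m r = 0\<^sub>v m"
    using assms by (intro eq_vecI) (auto simp: N_def scalar_prod_def unit_vec_def if_distrib cong: if_cong)
  moreover have "unit_vec m r \<noteq> (0\<^sub>v m :: real vec)" using assms by simp
  ultimately have "det (N\<^sup>T) = 0"
    using det_0_iff_vec_prod_zero_field[of "N\<^sup>T" m] N by (metis transpose_carrier_mat unit_vec_carrier)
  then have "det N = 0" using det_transpose[OF N] by simp
  then obtain v where v: "v \<in> carrier_vec m" "v \<noteq> 0\<^sub>v m" "N *\<^sub>v v = 0\<^sub>v m"
    using det_0_iff_vec_prod_zero_field[OF N] by auto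
  have "dot {..<m} (M i) (\<lambda>j. v $ j) = 0" if "i < r" for i
  proof -
    have "(N *\<^sub>v v) $ i = 0" using v(3) that assms by simp
    then show ?thesis using that assms v(1)
      by (simp add: N_def scalar_prod_def dot_def atLeast0LessThan)
  qed
  moreover have "\<exists>j<m. v $ j \<noteq> 0" using v(1,2) by (metis carrier_vecD eq_vecI index_zero_vec(1) zero_carrier_vec)
  ultimately show ?thesis by blast
qed

lemma unit_vector_orthogonal:
  fixes f :: "nat \<Rightarrow> nat \<Rightarrow> real"
  assumes "r < m"
  shows "\<exists>u. dot {..<m} u u = 1 \<and> (\<forall>i<r. dot {..<m} (f i) u = 0)"
proof -
  obtain u j where u: "j < m" "u j \<noteq> 0" "\<And>i. i < r \<Longrightarrow> dot {..<m} (f i) u = 0"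
    using homogeneous_system_nontrivial[OF assms, of f] by blast
  define c where "c = sqrt (dot {..<m} u u)"
  have c: "c > 0" "c\<^sup>2 = dot {..<m} u u" "dot {..<m} u u \<noteq> 0" using dot_self_pos[of "{..<m}" j u] u by (auto simp: c_def)
  show ?thesis
    using c u by (intro exI[of _ "\<lambda>i. 1 / c * u i"])
      (simp add: dot_scale_left dot_scale_right del: times_divide_eq_left, simp add: power2_eq_square field_simps)
qed

lemma orthonormal_complement:
  fixes f :: "nat \<Rightarrow> nat \<Rightarrow> real"
  assumes "r + d \<le> m"
  shows "\<exists>n. orthonormal m d n \<and> (\<forall>i<r. \<forall>k<d. dot {..<m} (f i) (n k) = 0)"
  using assms
proof (induction d)
  case (Suc d)
  then obtain n where n: "orthonormal m d n" "\<And>i k. i < r \<Longrightarrow> k < d \<Longrightarrow> dot {..<m} (f i) (n k) = 0"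
    by auto
  define g where "g i = (if i < r then f i else n (i - r))" for i
  obtain u where u: "dot {..<m} u u = 1" "\<And>i. i < r + d \<Longrightarrow> dot {..<m} (g i) u = 0"
    using unit_vector_orthogonal[of "r + d" m g] Suc.prems by auto
  have fu: "dot {..<m} (f i) u = 0" if "i < r" for i using u(2)[of i] that by (simp add: g_def)
  have nu: "dot {..<m} (n k) u = 0" if "k < d" for k using u(2)[of "r + k"] that by (simp add: g_def)
  define n' where "n' = n(d := u)"
  have "orthonormal m (Suc d) n'"
    using n(1) u(1) nu nu[unfolded dot_commute[of _ "n _" u]] unfolding orthonormal_def n'_def
    by (auto simp: less_Suc_eq)
  moreover have "dot {..<m} (f i) (n' k) = 0" if "i < r" "k < Suc d" for i k
    using that n(2) fu by (auto simp: n'_def less_Suc_eq)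
  ultimately show ?case by blast
qed (simp add: orthonormal_def)

lemma orthonormal_extend:
  assumes v: "orthonormal m r v" and "r \<le> m"
  shows "\<exists>w. orthonormal m m w \<and> (\<forall>i<r. w i = v i)"
proof -
  obtain n where n: "orthonormal m (m - r) n" "\<And>i k. i < r \<Longrightarrow> k < m - r \<Longrightarrow> dot {..<m} (v i) (n k) = 0"
    using orthonormal_complement[of r "m - r" m v] assms by auto
  define w where "w i = (if i < r then v i else n (i - r))" for i
  have "orthonormal m m w"
    unfolding orthonormal_def
  proof (intro allI impI)
    fix i i' assume i: "i < m" "i' < m"
    show "dot {..<m} (w i) (w i') = (if i = i' then 1 else 0)"
      using v n i unfolding orthonormal_def w_def
      by (cases "i < r"; cases "i' < r") (auto simp: dot_commute[of _ "n _" "v _"])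
  qed
  then show ?thesis by (intro exI[of _ w]) (simp add: w_def)
qed

lemma orthonormal_basis_expansion:
  assumes w: "orthonormal m m w" and j: "j < m"
  shows "x j = (\<Sum>i<m. dot {..<m} (w i) x * w i j)"
proof -
  define W where "W = mat m m (\<lambda>(i, j). w i j)"
  have W: "W \<in> carrier_mat m m" "W\<^sup>T \<in> carrier_mat m m" by (auto simp: W_def)
  have "W * W\<^sup>T = 1\<^sub>m m"
    using w unfolding orthonormal_def
    by (intro eq_matI) (auto simp: W_def scalar_prod_def dot_def atLeast0LessThan)
  \<comment> \<open>For square matrices a one-sided inverse is two-sided: orthonormal rows give
    orthonormal columns.\<close>
  then have "W\<^sup>T * W = 1\<^sub>m m" by (rule mat_mult_left_right_inverse[OF W])
  then have WW: "(\<Sum>i<m. w i j * w i j') = (if j = j' then 1 else 0)" if "j' < m" for j'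
  proof -
    have "(W\<^sup>T * W) $$ (j, j') = (if j = j' then 1 else 0)"
      unfolding \<open>W\<^sup>T * W = 1\<^sub>m m\<close> using j that by simp
    moreover have "(W\<^sup>T * W) $$ (j, j') = (\<Sum>i<m. w i j * w i j')"
      using j that by (simp add: W_def scalar_prod_def atLeast0LessThan)
    ultimately show ?thesis by simp
  qed
  have "(\<Sum>i<m. dot {..<m} (w i) x * w i j) = (\<Sum>j'<m. x j' * (\<Sum>i<m. w i j * w i j'))"
    unfolding dot_def sum_distrib_left sum_distrib_right by (subst sum.swap) (simp add: mult_ac)
  also have "\<dots> = (\<Sum>j'<m. if j' = j then x j' else 0)"
    by (intro sum.cong) (auto simp: WW)
  finally show ?thesis using j by simp
qed

lemma parseval:
  assumes w: "orthonormal m m w"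
  shows "dot {..<m} x y = (\<Sum>i<m. dot {..<m} (w i) x * dot {..<m} (w i) y)"
proof -
  have "dot {..<m} x y = dot {..<m} (\<lambda>j. \<Sum>i<m. dot {..<m} (w i) x * w i j) y"
    using orthonormal_basis_expansion[OF w] by (intro dot_cong) auto
  then show ?thesis by (simp add: dot_sum_left)
qed

lemma bessel:
  assumes n: "orthonormal m d n"
  shows "(\<Sum>k<d. (dot {..<m} (n k) x)\<^sup>2) \<le> dot {..<m} x x"
proof -
  define c where "c k = dot {..<m} (n k) x" for k
  define y where "y = (\<lambda>j. \<Sum>k<d. c k * n k j)"
  have "dot {..<m} x y = (\<Sum>k<d. (c k)\<^sup>2)"
    unfolding y_def dot_sum_right by (simp add: c_def dot_commute[of _ x] power2_eq_square)
  moreover have "dot {..<m} y y = (\<Sum>k<d. (c k)\<^sup>2)"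
  proof -
    have "dot {..<m} (n k) y = c k" if "k < d" for k
    proof -
      have "dot {..<m} (n k) y = (\<Sum>k'<d. if k' = k then c k' else 0)"
        unfolding y_def dot_sum_right using n that unfolding orthonormal_def
        by (intro sum.cong) auto
      then show ?thesis using that by simp
    qed
    then show ?thesis
      unfolding y_def dot_sum_left by (simp add: y_def[symmetric] power2_eq_square)
  qed
  moreover have "0 \<le> dot {..<m} (\<lambda>j. x j - y j) (\<lambda>j. x j - y j)"
    unfolding dot_def by (simp add: sum_nonneg)
  moreover have "dot {..<m} (\<lambda>j. x j - y j) (\<lambda>j. x j - y j) = dot {..<m} x x - 2 * dot {..<m} x y + dot {..<m} y y"
    unfolding dot_diff_right dot_commute[of _ "\<lambda>j. x j - y j"]
    by (simp add: dot_commute[of _ y x])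
  ultimately show ?thesis unfolding c_def by linarith
qed

section \<open>Eigenvectors of real symmetric matrices\<close>

abbreviation mv :: "nat \<Rightarrow> (nat \<Rightarrow> nat \<Rightarrow> real) \<Rightarrow> (nat \<Rightarrow> real) \<Rightarrow> nat \<Rightarrow> real" where
  "mv n M x i \<equiv> dot {..<n} (M i) x"

text \<open>The characteristic polynomial has a complex root \<open>a\<close>. Writing an
  eigenvector as \<open>x + i y\<close> with real \<open>x\<close> and \<open>y\<close>, symmetry
  gives \<open>Im a * (|x|\<^sup>2 + |y|\<^sup>2) = 0\<close>. So \<open>a\<close> is real, and
  whichever of \<open>x\<close> and \<open>y\<close> is nonzero is a real eigenvector.\<close>

lemma symmetric_has_eigenvector:
  fixes M :: "nat \<Rightarrow> nat \<Rightarrow> real"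
  assumes r: "r > 0" and sym: "\<And>i j. i < r \<Longrightarrow> j < r \<Longrightarrow> M i j = M j i"
  shows "\<exists>l y. (\<exists>i<r. y i \<noteq> 0) \<and> (\<forall>i<r. mv r M y i = l * y i)"
proof -
  define N where "N = mat r r (\<lambda>(i, j). complex_of_real (M i j))"
  have N: "N \<in> carrier_mat r r" by (simp add: N_def)
  obtain as where as: "char_poly N = (\<Prod>a\<leftarrow>as. [:- a, 1:])" "length as = r"
    using char_poly_factorized[OF N] by auto
  then obtain a as' where "as = a # as'" using r by (cases as) auto
  then have "poly (char_poly N) a = 0" using as by simp
  then have "eigenvalue N a" using eigenvalue_root_char_poly[OF N] by simp
  then obtain v where v: "v \<in> carrier_vec r" "v \<noteq> 0\<^sub>v r" "N *\<^sub>v v = a \<cdot>\<^sub>v v"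
    using N unfolding eigenvalue_def eigenvector_def by auto
  define x y where "x i = Re (v $ i)" and "y i = Im (v $ i)" for i
  have ev: "(\<Sum>j<r. complex_of_real (M i j) * v $ j) = a * v $ i" if "i < r" for i
    using arg_cong[OF v(3), of "\<lambda>u. u $ i"] that v(1) by (simp add: N_def scalar_prod_def atLeast0LessThan)
  have X: "mv r M x i = Re a * x i - Im a * y i" and Y: "mv r M y i = Re a * y i + Im a * x i" if "i < r" for i
    using arg_cong[OF ev[OF that], of Re] arg_cong[OF ev[OF that], of Im]
    by (simp_all add: dot_def x_def y_def)
  have "dot {..<r} y (mv r M x) = dot {..<r} x (mv r M y)"
    unfolding dot_def sum_distrib_left
    by (subst sum.swap) (auto intro!: sum.cong simp: sym mult_ac)
  moreover have "dot {..<r} y (mv r M x) = Re a * dot {..<r} x y - Im a * dot {..<r} y y"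
    by (subst dot_cong[OF refl X]) (auto simp: dot_diff_right dot_scale_right dot_commute[of _ y x])
  moreover have "dot {..<r} x (mv r M y) = Re a * dot {..<r} x y + Im a * dot {..<r} x x"
    by (subst dot_cong[OF refl Y]) (auto simp: dot_add_right dot_scale_right)
  ultimately have 0: "Im a * (dot {..<r} x x + dot {..<r} y y) = 0" by (simp add: algebra_simps)
  obtain i where i: "i < r" "v $ i \<noteq> 0" using v(1,2) by (metis carrier_vecD eq_vecI index_zero_vec(1) zero_carrier_vec)
  then have xy: "x i \<noteq> 0 \<or> y i \<noteq> 0" by (auto simp: x_def y_def complex_eq_iff)
  have nn: "0 \<le> dot {..<r} x x" "0 \<le> dot {..<r} y y" unfolding dot_def by (simp_all add: sum_nonneg)
  have "0 < dot {..<r} x x + dot {..<r} y y"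
    using xy nn i dot_self_pos[of "{..<r}" i x] dot_self_pos[of "{..<r}" i y] by fastforce
  with 0 have "Im a = 0" by simp
  then show ?thesis using X Y xy i by (metis diff_zero add.right_neutral mult_zero_left)
qed

lemma mv_symmetric:
  assumes "\<And>i j. i < n \<Longrightarrow> j < n \<Longrightarrow> M i j = M j i"
  shows "dot {..<n} x (mv n M y) = dot {..<n} (mv n M x) y"
  unfolding dot_def sum_distrib_left sum_distrib_right
  by (subst sum.swap) (auto intro!: sum.cong simp: assms mult_ac)

text \<open>Deflation: the orthogonal complement of the eigenvectors found so far is invariant under
  \<open>M\<close>, so an eigenvector of the compression \<open>M'\<close> of \<open>M\<close> to
  that complement lifts to an eigenvector of \<open>M\<close>.\<close>

lemma symmetric_eigensystem:
  fixes M :: "nat \<Rightarrow> nat \<Rightarrow> real"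
  assumes sym: "\<And>i j. i < n \<Longrightarrow> j < n \<Longrightarrow> M i j = M j i"
    and "k \<le> n"
  shows "\<exists>w l. orthonormal n k w \<and> (\<forall>i<k. \<forall>j<n. mv n M (w i) j = l i * w i j)"
  using \<open>k \<le> n\<close>
proof (induction k)
  case (Suc k)
  then obtain w l where w: "orthonormal n k w" and l: "\<And>i j. i < k \<Longrightarrow> j < n \<Longrightarrow> mv n M (w i) j = l i * w i j"
    by auto
  define d where "d = n - k"
  have d: "d > 0" "k + d = n" using Suc.prems by (auto simp: d_def)
  obtain b where b: "orthonormal n d b" "\<And>i k'. i < k \<Longrightarrow> k' < d \<Longrightarrow> dot {..<n} (w i) (b k') = 0"
    using orthonormal_complement[of k d n w] d by auto
  define M' where "M' r s = dot {..<n} (b r) (mv n M (b s))" for r s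
  obtain e y where y: "\<exists>i<d. y i \<noteq> 0" "\<And>i. i < d \<Longrightarrow> mv d M' y i = e * y i"
  proof -
    have "M' r s = M' s r" for r s
    proof -
      have "M' r s = dot {..<n} (mv n M (b r)) (b s)"
        unfolding M'_def by (rule mv_symmetric) (rule sym)
      then show ?thesis unfolding M'_def by (simp only: dot_commute)
    qed
    then show ?thesis using symmetric_has_eigenvector[OF d(1), of M'] that by blast
  qed
  define v where "v = (\<lambda>j. \<Sum>r<d. y r * b r j)"
  have bv: "dot {..<n} (b r) v = y r" if "r < d" for r
  proof -
    have "dot {..<n} (b r) v = (\<Sum>r'<d. if r' = r then y r' else 0)"
      unfolding v_def dot_sum_right using b(1) that unfolding orthonormal_def by (intro sum.cong) auto
    then show ?thesis using that by simp
  qed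
  have wv: "dot {..<n} (w i) v = 0" if "i < k" for i
    unfolding v_def dot_sum_right using b(2) that by simp
  have Mv: "mv n M v j = e * v j" if "j < n" for j
  proof -
    \<comment> \<open>The residual \<open>z\<close> is shown to vanish by testing it against the
      whole basis \<open>f\<close>: on the old eigenvectors by symmetry, on the complement by the
      eigenvalue equation of \<open>M'\<close>.\<close>
    define z where "z = (\<lambda>j. mv n M v j - e * v j)"
    define f where "f i = (if i < k then w i else b (i - k))" for i
    have f: "orthonormal n n f"
      unfolding orthonormal_def
    proof (intro allI impI)
      fix i i' assume i: "i < n" "i' < n"
      show "dot {..<n} (f i) (f i') = (if i = i' then 1 else 0)"
        using w b i d unfolding orthonormal_def f_def
        by (cases "i < k"; cases "i' < k") (auto simp: dot_commute[of _ "b _" "w _"])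
    qed
    have "dot {..<n} (f i) z = 0" if "i < n" for i
    proof (cases "i < k")
      case True
      have "dot {..<n} (w i) (mv n M v) = dot {..<n} (mv n M (w i)) v"
        by (rule mv_symmetric) (rule sym)
      also have "\<dots> = dot {..<n} (\<lambda>j. l i * w i j) v"
        by (intro dot_cong) (auto simp: l True)
      finally have "dot {..<n} (w i) (mv n M v) = dot {..<n} (\<lambda>j. l i * w i j) v" .
      then show ?thesis
        using True wv by (simp add: f_def z_def dot_diff_right dot_scale_right dot_scale_left)
    next
      case False
      define r where "r = i - k"
      have r: "r < d" using False that d by (auto simp: r_def)
      have "mv n M v j = (\<Sum>s<d. y s * mv n M (b s) j)" for j
        unfolding v_def dot_sum_right ..
      then have "dot {..<n} (b r) (mv n M v) = (\<Sum>s<d. y s * M' r s)"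
        unfolding M'_def by (simp only: dot_sum_right)
      also have "\<dots> = e * y r" using y(2)[OF r] by (simp add: dot_def mult.commute)
      finally show ?thesis
        using False bv[OF r] by (simp add: f_def z_def dot_diff_right dot_scale_right r_def)
    qed
    then have "z j = 0" using orthonormal_basis_expansion[OF f that, of z] by simp
    then show ?thesis by (simp add: z_def)
  qed
  define c where "c = sqrt (dot {..<n} v v)"
  have "dot {..<n} v v = dot {..<d} y y"
    unfolding v_def dot_sum_left unfolding v_def[symmetric] using bv by (simp add: dot_def)
  then have c: "c > 0" "c\<^sup>2 = dot {..<n} v v"
    using y(1) dot_self_pos[of "{..<d}" _ y] dot_self_nonneg[of "{..<d}" y] by (auto simp: c_def)
  define w' where "w' = w(k := (\<lambda>j. 1 / c * v j))"
  have cc: "1 / c * (1 / c * dot {..<n} v v) = 1"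
    using c(1) by (simp add: c(2)[symmetric] power2_eq_square)
  have "orthonormal n (Suc k) w'"
    using w wv cc unfolding orthonormal_def w'_def
    using wv[unfolded dot_commute[of _ "w _" v]]
    by (auto simp: less_Suc_eq dot_scale_left dot_scale_right power2_eq_square simp del: times_divide_eq_left times_divide_eq_right mult_1_left)
  moreover have "mv n M (w' i) j = (if i < k then l i else e) * w' i j" if "i < Suc k" "j < n" for i j
  proof (cases "i < k")
    case True
    then show ?thesis using l that by (simp add: w'_def)
  next
    case False
    then have "w' i = (\<lambda>j. 1 / c * v j)" using that by (simp add: w'_def less_Suc_eq)
    then show ?thesis using Mv[OF that(2)] False by (simp only: dot_scale_right) simp
  qed
  ultimately show ?case by (intro exI[of _ w'] exI[of _ "\<lambda>i. if i < k then l i else e"]) blast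
qed (simp add: orthonormal_def)

lemma symmetric_spectral:
  fixes M :: "nat \<Rightarrow> nat \<Rightarrow> real"
  assumes sym: "\<And>i j. i < n \<Longrightarrow> j < n \<Longrightarrow> M i j = M j i"
  shows "\<exists>w l. orthonormal n n w \<and> (\<forall>i<n. \<forall>j<n. mv n M (w i) j = l i * w i j) \<and>
    (\<forall>i j. i \<le> j \<longrightarrow> j < n \<longrightarrow> l j \<le> l i)"
proof -
  obtain w l where w: "orthonormal n n w" and l: "\<And>i j. i < n \<Longrightarrow> j < n \<Longrightarrow> mv n M (w i) j = l i * w i j"
  proof -
    have "\<exists>w l. orthonormal n n w \<and> (\<forall>i<n. \<forall>j<n. mv n M (w i) j = l i * w i j)"
      by (rule symmetric_eigensystem) (use sym in auto)
    then show ?thesis using that by blast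
  qed
  define xs where "xs = rev (sort_key l [0..<n])"
  have len: "length xs = n" and set: "set xs = {..<n}" and dist: "distinct xs"
    by (auto simp: xs_def)
  have p: "xs ! i < n" if "i < n" for i using nth_mem[of i xs] that len set by auto
  have "sorted (map l (sort_key l [0..<n]))" by simp
  then have "sorted (rev (map l xs))" by (simp add: xs_def rev_map)
  then have dec: "l (xs ! j) \<le> l (xs ! i)" if "i \<le> j" "j < n" for i j
    using that len by (auto simp: sorted_rev_iff_nth_mono)
  show ?thesis
  proof (intro exI conjI allI impI)
    show "orthonormal n n (\<lambda>i. w (xs ! i))"
      using w p dist len unfolding orthonormal_def by (auto simp: nth_eq_iff_index_eq)
    show "mv n M (w (xs ! i)) j = l (xs ! i) * w (xs ! i) j" if "i < n" "j < n" for i j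
      using l p that by simp
    show "l (xs ! j) \<le> l (xs ! i)" if "i \<le> j" "j < n" for i j using dec that .
  qed
qed

section \<open>The pseudoinverse of a matrix of full row rank\<close>

text \<open>A matrix is a function of index pairs. Its first \<open>a\<close> rows form \<open>G\<close> and the rows \<open>a, \<dots>, n - 1\<close>
  form \<open>H\<close>; \<open>pinv a l g i\<close> is column \<open>i\<close> of \<open>G\<^sup>T (G G\<^sup>T)\<^sup>-\<^sup>1\<close>, and \<open>0\<close> if \<open>G G\<^sup>T\<close> is singular. The
  adjugate makes measurability in the entries evident.\<close>

definition gram :: "nat \<Rightarrow> nat \<Rightarrow> (nat \<times> nat \<Rightarrow> real) \<Rightarrow> real mat" where
  "gram a l g = mat a a (\<lambda>(i, k). dot {..<l} (\<lambda>c. g (i, c)) (\<lambda>c. g (k, c)))"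

definition pinv :: "nat \<Rightarrow> nat \<Rightarrow> (nat \<times> nat \<Rightarrow> real) \<Rightarrow> nat \<Rightarrow> nat \<Rightarrow> real" where
  "pinv a l g i c = (\<Sum>k<a. adj_mat (gram a l g) $$ (k, i) / det (gram a l g) * g (k, c))"

definition pinv_vec :: "nat \<Rightarrow> nat \<Rightarrow> (nat \<times> nat \<Rightarrow> real) \<Rightarrow> (nat \<Rightarrow> real) \<Rightarrow> nat \<Rightarrow> real" where
  "pinv_vec a l g x c = (\<Sum>i<a. x i * pinv a l g i c)"

lemma gram_carrier [simp]: "gram a l g \<in> carrier_mat a a" "dim_row (gram a l g) = a" "dim_col (gram a l g) = a"
  by (simp_all add: gram_def)

lemma gram_cong:
  "(\<And>i c. i < a \<Longrightarrow> c < l \<Longrightarrow> g (i, c) = g' (i, c)) \<Longrightarrow> gram a l g = gram a l g'"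
  unfolding gram_def by (intro eq_matI) (auto intro!: dot_cong)

lemma pinv_cong:
  "(\<And>i c. i < a \<Longrightarrow> c < l \<Longrightarrow> g (i, c) = g' (i, c)) \<Longrightarrow> c < l \<Longrightarrow> pinv a l g i c = pinv a l g' i c"
  unfolding pinv_def using gram_cong[of a l g g'] by (intro sum.cong) auto

lemma gram_mult_vec:
  assumes "i < a"
  shows "(\<Sum>k<a. gram a l g $$ (i, k) * e k) = dot {..<l} (\<lambda>c. g (i, c)) (\<lambda>c. \<Sum>k<a. e k * g (k, c))"
  unfolding dot_sum_right using assms by (simp add: gram_def mult.commute)

lemma pinv_right_inverse:
  assumes "det (gram a l g) \<noteq> 0" "r < a" "i < a"
  shows "dot {..<l} (\<lambda>c. g (r, c)) (pinv a l g i) = (if r = i then 1 else 0)"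
proof -
  let ?G = "gram a l g"
  have "dot {..<l} (\<lambda>c. g (r, c)) (pinv a l g i) = (\<Sum>k<a. ?G $$ (r, k) * (adj_mat ?G $$ (k, i) / det ?G))"
    unfolding gram_mult_vec[OF assms(2)] pinv_def ..
  also have "\<dots> = (?G * adj_mat ?G) $$ (r, i) / det ?G"
    using assms adj_mat(1)[of ?G a] by (simp add: scalar_prod_def sum_divide_distrib atLeast0LessThan)
  also have "?G * adj_mat ?G = det ?G \<cdot>\<^sub>m 1\<^sub>m a" by (rule adj_mat) simp
  finally show ?thesis using assms by simp
qed

lemma pinv_vec_right_inverse:
  assumes "det (gram a l g) \<noteq> 0" "r < a"
  shows "dot {..<l} (\<lambda>c. g (r, c)) (pinv_vec a l g x) = x r"
proof -
  have "dot {..<l} (\<lambda>c. g (r, c)) (pinv_vec a l g x) = (\<Sum>i<a. if i = r then x i else 0)"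
    unfolding pinv_vec_def dot_sum_right using assms pinv_right_inverse by (intro sum.cong) auto
  then show ?thesis using assms by simp
qed

lemma pinv_vec_in_row_span:
  "\<exists>e. \<forall>c. pinv_vec a l g x c = (\<Sum>k<a. e k * g (k, c))"
proof (intro exI allI)
  fix c
  show "pinv_vec a l g x c = (\<Sum>k<a. (\<Sum>i<a. x i * (adj_mat (gram a l g) $$ (k, i) / det (gram a l g))) * g (k, c))"
    unfolding pinv_vec_def pinv_def sum_distrib_left sum_distrib_right
    by (subst sum.swap) (simp add: mult_ac)
qed

text \<open>The difference of two such vectors lies in the row span and is orthogonal to every row,
  hence to itself. This identifies the pseudoinverse of a rotated matrix without computing
  it.\<close>

lemma pinv_vec_unique:
  assumes "det (gram a l g) \<noteq> 0"
    and w: "\<And>c. c < l \<Longrightarrow> w c = (\<Sum>k<a. e k * g (k, c))"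
      "\<And>r. r < a \<Longrightarrow> dot {..<l} (\<lambda>c. g (r, c)) w = x r"
    and c: "c < l"
  shows "w c = pinv_vec a l g x c"
proof -
  obtain e' where e': "\<And>c. pinv_vec a l g x c = (\<Sum>k<a. e' k * g (k, c))"
    using pinv_vec_in_row_span by metis
  define u where "u c = w c - pinv_vec a l g x c" for c
  have "dot {..<l} (\<lambda>c. g (r, c)) u = 0" if "r < a" for r
    unfolding u_def dot_diff_right w(2)[OF that] pinv_vec_right_inverse[OF assms(1) that] by simp
  moreover have "dot {..<l} u u = dot {..<l} (\<lambda>c. \<Sum>k<a. (e k - e' k) * g (k, c)) u"
    by (intro dot_cong) (auto simp: u_def w(1) e' left_diff_distrib sum_subtractf)
  ultimately have "dot {..<l} u u = 0" by (simp add: dot_sum_left)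
  then show ?thesis using c by (subst (asm) dot_self_eq_0_iff) (auto simp: u_def)
qed

text \<open>If \<open>G * G\<^sup>T\<close> kills \<open>v\<close>, then
  \<open>|G\<^sup>T v|\<^sup>2 = 0\<close>, so \<open>v\<close> is a linear relation between the
  rows.\<close>

lemma det_gram_eq_0_iff:
  "det (gram a l g) = 0 \<longleftrightarrow> (\<exists>e. (\<exists>k<a. e k \<noteq> 0) \<and> (\<forall>c<l. (\<Sum>k<a. e k * g (k, c)) = 0))"
proof
  assume "det (gram a l g) = 0"
  then obtain v where v: "v \<in> carrier_vec a" "v \<noteq> 0\<^sub>v a" "gram a l g *\<^sub>v v = 0\<^sub>v a"
    using det_0_iff_vec_prod_zero_field[of "gram a l g" a] by auto
  define u where "u c = (\<Sum>k<a. v $ k * g (k, c))" for c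
  have gu: "dot {..<l} (\<lambda>c. g (i, c)) u = 0" if "i < a" for i
  proof -
    have "0 = (gram a l g *\<^sub>v v) $ i" using v(3) that by simp
    also have "\<dots> = (\<Sum>k<a. gram a l g $$ (i, k) * v $ k)"
      using that v(1) by (simp add: scalar_prod_def atLeast0LessThan)
    finally show ?thesis unfolding gram_mult_vec[OF that] u_def by simp
  qed
  have "dot {..<l} u u = dot {..<l} (\<lambda>c. \<Sum>k<a. v $ k * g (k, c)) u" by (simp add: u_def[abs_def])
  then have "dot {..<l} u u = 0" by (simp add: dot_sum_left gu)
  then have "\<forall>c<l. u c = 0" by (subst (asm) dot_self_eq_0_iff) auto
  moreover have "\<exists>k<a. v $ k \<noteq> 0" using v(1,2) by (metis carrier_vecD eq_vecI index_zero_vec(1) zero_carrier_vec)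
  ultimately show "\<exists>e. (\<exists>k<a. e k \<noteq> 0) \<and> (\<forall>c<l. (\<Sum>k<a. e k * g (k, c)) = 0)"
    unfolding u_def by blast
next
  assume "\<exists>e. (\<exists>k<a. e k \<noteq> 0) \<and> (\<forall>c<l. (\<Sum>k<a. e k * g (k, c)) = 0)"
  then obtain e k where e: "k < a" "e k \<noteq> 0" "\<And>c. c < l \<Longrightarrow> (\<Sum>k<a. e k * g (k, c)) = 0" by auto
  have "gram a l g *\<^sub>v vec a e = 0\<^sub>v a"
  proof (intro eq_vecI)
    fix i assume "i < dim_vec (0\<^sub>v a :: real vec)"
    then have i: "i < a" by simp
    have "(gram a l g *\<^sub>v vec a e) $ i = (\<Sum>k<a. gram a l g $$ (i, k) * e k)"
      using i by (simp add: scalar_prod_def atLeast0LessThan)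
    also have "\<dots> = dot {..<l} (\<lambda>c. g (i, c)) (\<lambda>c. 0)"
      unfolding gram_mult_vec[OF i] by (intro dot_cong) (auto simp: e)
    finally show "(gram a l g *\<^sub>v vec a e) $ i = 0\<^sub>v a $ i" using i by (simp add: dot_def)
  qed simp
  moreover have "vec a e \<noteq> 0\<^sub>v a"
  proof
    assume "vec a e = 0\<^sub>v a"
    then have "vec a e $ k = 0\<^sub>v a $ k" by simp
    then show False using e by simp
  qed
  ultimately show "det (gram a l g) = 0"
    using det_0_iff_vec_prod_zero_field[of "gram a l g" a] vec_carrier[of a e] gram_carrier(1) by blast
qed

section \<open>Measurability of the pseudoinverse and of the tail energy\<close>

lemma borel_measurable_det:
  fixes A :: "'w \<Rightarrow> real mat"
  assumes A: "\<And>\<omega>. A \<omega> \<in> carrier_mat n n"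
    and m: "\<And>i j. i < n \<Longrightarrow> j < n \<Longrightarrow> (\<lambda>\<omega>. A \<omega> $$ (i, j)) \<in> borel_measurable N"
  shows "(\<lambda>\<omega>. det (A \<omega>)) \<in> borel_measurable N"
  unfolding det_def'[OF A]
  by (intro borel_measurable_sum borel_measurable_times borel_measurable_prod borel_measurable_const m)
    (auto dest: permutes_in_image)

lemma borel_measurable_adj_mat:
  fixes A :: "'w \<Rightarrow> real mat"
  assumes A: "\<And>\<omega>. A \<omega> \<in> carrier_mat n n"
    and m: "\<And>i j. i < n \<Longrightarrow> j < n \<Longrightarrow> (\<lambda>\<omega>. A \<omega> $$ (i, j)) \<in> borel_measurable N"
    and ij: "i < n" "j < n"
  shows "(\<lambda>\<omega>. adj_mat (A \<omega>) $$ (i, j)) \<in> borel_measurable N"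
proof -
  have d: "dim_row (A \<omega>) = n" "dim_col (A \<omega>) = n" for \<omega> using A[of \<omega>] by auto
  have "(\<lambda>\<omega>. det (mat_delete (A \<omega>) j i)) \<in> borel_measurable N"
  proof (rule borel_measurable_det)
    show "mat_delete (A \<omega>) j i \<in> carrier_mat (n - 1) (n - 1)" for \<omega>
      using A by (rule mat_delete_carrier)
    show "(\<lambda>\<omega>. mat_delete (A \<omega>) j i $$ (i', j')) \<in> borel_measurable N" if "i' < n - 1" "j' < n - 1" for i' j'
      using that by (simp add: mat_delete_def d m)
  qed
  then show ?thesis using ij by (simp add: adj_mat_def d cofactor_def)
qed

context
  fixes N :: "'w measure" and g :: "'w \<Rightarrow> nat \<times> nat \<Rightarrow> real" and a l :: nat
  assumes g: "\<And>i c. i < a \<Longrightarrow> c < l \<Longrightarrow> (\<lambda>\<omega>. g \<omega> (i, c)) \<in> borel_measurable N"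
begin

lemma borel_measurable_gram_entry:
  "i < a \<Longrightarrow> k < a \<Longrightarrow> (\<lambda>\<omega>. gram a l (g \<omega>) $$ (i, k)) \<in> borel_measurable N"
  by (auto simp: gram_def dot_def intro!: borel_measurable_sum borel_measurable_times g)

lemma borel_measurable_det_gram: "(\<lambda>\<omega>. det (gram a l (g \<omega>))) \<in> borel_measurable N"
  by (rule borel_measurable_det) (auto intro: borel_measurable_gram_entry)

lemma borel_measurable_pinv:
  "i < a \<Longrightarrow> c < l \<Longrightarrow> (\<lambda>\<omega>. pinv a l (g \<omega>) i c) \<in> borel_measurable N"
  unfolding pinv_def
  by (intro borel_measurable_sum borel_measurable_times borel_measurable_divide borel_measurable_det_gram
      borel_measurable_adj_mat[where n = a] borel_measurable_gram_entry g) auto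

lemma borel_measurable_pinv_vec:
  assumes "\<And>i. i < a \<Longrightarrow> (\<lambda>\<omega>. x \<omega> i) \<in> borel_measurable N" and "c < l"
  shows "(\<lambda>\<omega>. pinv_vec a l (g \<omega>) (x \<omega>) c) \<in> borel_measurable N"
  unfolding pinv_vec_def using assms
  by (intro borel_measurable_sum borel_measurable_times borel_measurable_pinv) auto

end

text \<open>This is \<open>|H G\<^sup>\<dagger> x|\<^sup>2\<close> in the notation of the
  overview.\<close>

definition tail_energy :: "nat \<Rightarrow> nat \<Rightarrow> nat \<Rightarrow> (nat \<times> nat \<Rightarrow> real) \<Rightarrow> (nat \<Rightarrow> real) \<Rightarrow> real" where
  "tail_energy a n l g x = (\<Sum>r\<in>{a..<n}. (dot {..<l} (\<lambda>c. g (r, c)) (pinv_vec a l g x))\<^sup>2)"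

lemma borel_measurable_tail_energy:
  assumes g: "\<And>i c. i < n \<Longrightarrow> c < l \<Longrightarrow> (\<lambda>\<omega>. g \<omega> (i, c)) \<in> borel_measurable N"
    and x: "\<And>i. i < a \<Longrightarrow> (\<lambda>\<omega>. x \<omega> i) \<in> borel_measurable N" and a: "a \<le> n"
  shows "(\<lambda>\<omega>. tail_energy a n l (g \<omega>) (x \<omega>)) \<in> borel_measurable N"
  unfolding tail_energy_def dot_def using a
  by (intro borel_measurable_sum borel_measurable_power borel_measurable_times borel_measurable_pinv_vec g x) simp_all

definition large_tail :: "nat \<Rightarrow> nat \<Rightarrow> nat \<Rightarrow> real \<Rightarrow> (nat \<times> nat \<Rightarrow> real) \<Rightarrow> (nat \<Rightarrow> real) \<Rightarrow> bool" where
  "large_tail a n l y g x \<longleftrightarrow> det (gram a l g) \<noteq> 0 \<and> y\<^sup>2 < tail_energy a n l g x"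

lemma measurable_large_tail:
  assumes g: "\<And>i c. i < n \<Longrightarrow> c < l \<Longrightarrow> (\<lambda>\<omega>. g \<omega> (i, c)) \<in> borel_measurable N"
    and x: "\<And>i. i < a \<Longrightarrow> (\<lambda>\<omega>. x \<omega> i) \<in> borel_measurable N" and a: "a \<le> n"
  shows "Measurable.pred N (\<lambda>\<omega>. large_tail a n l y (g \<omega>) (x \<omega>))"
proof -
  have [measurable]: "(\<lambda>\<omega>. det (gram a l (g \<omega>))) \<in> borel_measurable N"
    by (rule borel_measurable_det_gram) (use g a in simp)
  have [measurable]: "(\<lambda>\<omega>. tail_energy a n l (g \<omega>) (x \<omega>)) \<in> borel_measurable N"
    using assms by (rule borel_measurable_tail_energy)
  show ?thesis unfolding large_tail_def by measurable
qed

lemma gauss_component_measurable: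
  "i \<in> I \<Longrightarrow> (\<lambda>x. x i) \<in> borel_measurable (gauss I)"
  unfolding measurable_gauss_iff by simp

text \<open>For orthogonal \<open>R\<close> one has
  \<open>(R G)\<^sup>\<dagger> (R x) = G\<^sup>\<dagger> x\<close>: the rows of \<open>R G\<close>
  and of \<open>G\<close> span the same space, and both sides solve the same equations in it. Since
  \<open>H\<close> is left alone, a fixed \<open>x\<close> may be replaced by a multiple of the
  first axis.\<close>

lemma large_tail_rotate:
  assumes R: "orthonormal a a R" and a: "a \<le> n"
    and h: "\<And>r c. r < n \<Longrightarrow> c < l \<Longrightarrow> h (r, c) = (if r < a then \<Sum>i<a. R r i * g (i, c) else g (r, c))"
    and z: "\<And>r. r < a \<Longrightarrow> z r = dot {..<a} (R r) x"
  shows "large_tail a n l y h z \<longleftrightarrow> large_tail a n l y g x"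
proof -
  have RR: "(\<Sum>r<a. R r i * R r i') = (if i = i' then 1 else 0)" if "i < a" "i' < a" for i i'
  proof -
    have "(if i' = i then 1 else 0) = (\<Sum>r<a. dot {..<a} (R r) (\<lambda>k. if k = i then 1 else 0) * R r i')"
      by (rule orthonormal_basis_expansion[OF R that(2)])
    also have "\<dots> = (\<Sum>r<a. R r i * R r i')"
      using that by (intro sum.cong) (auto simp: dot_def if_distrib cong: if_cong)
    finally show ?thesis by (cases "i = i'") auto
  qed
  have inv_rot: "g (i, c) = (\<Sum>r<a. R r i * h (r, c))" if "i < a" "c < l" for i c
  proof -
    have "(\<Sum>r<a. R r i * h (r, c)) = (\<Sum>r<a. R r i * (\<Sum>k<a. R r k * g (k, c)))"
      using h that a by (intro sum.cong) auto
    also have "\<dots> = (\<Sum>k<a. (\<Sum>r<a. R r i * R r k) * g (k, c))"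
      unfolding sum_distrib_left sum_distrib_right by (subst sum.swap) (simp add: mult_ac)
    also have "\<dots> = (\<Sum>k<a. if k = i then g (k, c) else 0)"
      using RR that by (intro sum.cong) auto
    finally show ?thesis using that by simp
  qed
  have xz: "x i = (\<Sum>r<a. R r i * z r)" if "i < a" for i
    using orthonormal_basis_expansion[OF R that, of x] by (simp add: z mult.commute)
  have comb: "(\<Sum>r<a. e r * h (r, c)) = (\<Sum>i<a. (\<Sum>r<a. e r * R r i) * g (i, c))" if "c < l" for e c
  proof -
    have "(\<Sum>r<a. e r * h (r, c)) = (\<Sum>r<a. e r * (\<Sum>i<a. R r i * g (i, c)))"
      using h that a by (intro sum.cong) auto
    then show ?thesis
      unfolding sum_distrib_left sum_distrib_right by (subst sum.swap) (simp add: mult_ac)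
  qed
  have comb': "(\<Sum>i<a. e i * g (i, c)) = (\<Sum>r<a. (\<Sum>i<a. e i * R r i) * h (r, c))" if "c < l" for e c
  proof -
    have "(\<Sum>i<a. e i * g (i, c)) = (\<Sum>i<a. e i * (\<Sum>r<a. R r i * h (r, c)))"
      using inv_rot that by (intro sum.cong) auto
    then show ?thesis
      unfolding sum_distrib_left sum_distrib_right by (subst sum.swap) (simp add: mult_ac)
  qed
  have "det (gram a l h) = 0 \<longleftrightarrow> det (gram a l g) = 0"
  proof
    assume "det (gram a l h) = 0"
    then obtain e k where e: "k < a" "e k \<noteq> 0" "\<And>c. c < l \<Longrightarrow> (\<Sum>k<a. e k * h (k, c)) = 0"
      unfolding det_gram_eq_0_iff by auto
    define e' where "e' i = (\<Sum>r<a. e r * R r i)" for i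
    have "\<exists>i<a. e' i \<noteq> 0"
    proof (rule ccontr)
      assume n: "\<not> ?thesis"
      have "e k = dot {..<a} (R k) e'"
      proof -
        have "dot {..<a} (R k) e' = (\<Sum>r<a. e r * dot {..<a} (R k) (R r))"
          unfolding e'_def by (rule dot_sum_right)
        also have "\<dots> = (\<Sum>r<a. if r = k then e r else 0)"
          using R e(1) unfolding orthonormal_def by (intro sum.cong) auto
        finally show ?thesis using e(1) by simp
      qed
      also have "\<dots> = 0" using n by (simp add: dot_def)
      finally show False using e(2) by simp
    qed
    moreover have "(\<Sum>i<a. e' i * g (i, c)) = 0" if "c < l" for c
      using comb[OF that, of e] e(3)[OF that] unfolding e'_def by simp
    ultimately show "det (gram a l g) = 0" unfolding det_gram_eq_0_iff by blast
  next
    assume "det (gram a l g) = 0"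
    then obtain e k where e: "k < a" "e k \<noteq> 0" "\<And>c. c < l \<Longrightarrow> (\<Sum>k<a. e k * g (k, c)) = 0"
      unfolding det_gram_eq_0_iff by auto
    define e' where "e' r = (\<Sum>i<a. e i * R r i)" for r
    have "\<exists>r<a. e' r \<noteq> 0"
    proof (rule ccontr)
      assume n: "\<not> ?thesis"
      have "e k = (\<Sum>r<a. dot {..<a} (R r) e * R r k)"
        by (rule orthonormal_basis_expansion[OF R e(1)])
      also have "\<dots> = 0" using n by (simp add: dot_def e'_def mult.commute)
      finally show False using e(2) by simp
    qed
    moreover have "(\<Sum>r<a. e' r * h (r, c)) = 0" if "c < l" for c
      using comb'[OF that, of e] e(3)[OF that] unfolding e'_def by simp
    ultimately show "det (gram a l h) = 0" unfolding det_gram_eq_0_iff by blast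
  qed
  moreover have "tail_energy a n l h z = tail_energy a n l g x" if d: "det (gram a l h) \<noteq> 0" "det (gram a l g) \<noteq> 0"
  proof -
    obtain e where e: "\<And>c. pinv_vec a l h z c = (\<Sum>k<a. e k * h (k, c))"
      using pinv_vec_in_row_span by metis
    have "pinv_vec a l h z c = pinv_vec a l g x c" if c: "c < l" for c
    proof (rule pinv_vec_unique[OF d(2) _ _ c])
      show "pinv_vec a l h z c = (\<Sum>i<a. (\<Sum>r<a. e r * R r i) * g (i, c))" if "c < l" for c
        unfolding e comb[OF that] ..
      show "dot {..<l} (\<lambda>c. g (i, c)) (pinv_vec a l h z) = x i" if "i < a" for i
      proof -
        have "dot {..<l} (\<lambda>c. g (i, c)) (pinv_vec a l h z) =
          dot {..<l} (\<lambda>c. \<Sum>r<a. R r i * h (r, c)) (pinv_vec a l h z)"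
          using inv_rot that by (intro dot_cong) auto
        also have "\<dots> = (\<Sum>r<a. R r i * z r)"
          unfolding dot_sum_left using pinv_vec_right_inverse[OF d(1)] by simp
        finally show ?thesis using xz[OF that] by simp
      qed
    qed
    then show ?thesis
      unfolding tail_energy_def using h a
      by (intro sum.cong arg_cong[of _ _ "\<lambda>t. t\<^sup>2"] dot_cong) auto
  qed
  ultimately show ?thesis unfolding large_tail_def by auto
qed

section \<open>The tail energy for a fixed vector\<close>

abbreviation first_axis :: "real \<Rightarrow> nat \<Rightarrow> real" where
  "first_axis \<xi> \<equiv> (\<lambda>i. if i = 0 then \<xi> else 0)"

lemma nn_integral_gauss_union:
  assumes "finite I" "finite J" "I \<inter> J = {}" "f \<in> borel_measurable (gauss (I \<union> J))"
  shows "(\<integral>\<^sup>+x. f x \<partial>gauss (I \<union> J)) = (\<integral>\<^sup>+x. \<integral>\<^sup>+y. f (merge I J (x, y)) \<partial>gauss J \<partial>gauss I)"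
  using assms by (intro std_gauss.product_nn_integral_fold) auto

text \<open>The vector \<open>w = G\<^sup>\<dagger> (\<xi>, 0, ..., 0)\<close> is orthogonal to all
  rows but row 0 and has inner product \<open>\<xi>\<close> with it, so \<open>|w|\<close> is
  \<open>\<xi>\<close> divided by the distance of row 0 to the span of the others. If
  \<open>w\<close> is long, the component of row 0 along directions \<open>N k\<close> orthogonal to
  the other rows is short. Bessel's inequality for \<open>w\<close> gives the half of this that is
  used.\<close>

lemma row_distance_bound:
  assumes g: "det (gram a l g) \<noteq> 0" and a: "0 < a" and \<xi>: "\<xi> > 0" and t: "t > 0"
    and N: "orthonormal l d N" "\<And>i k. 0 < i \<Longrightarrow> i < a \<Longrightarrow> k < d \<Longrightarrow> dot {..<l} (\<lambda>c. g (i, c)) (N k) = 0"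
    and large: "t\<^sup>2 < dot {..<l} (pinv_vec a l g (first_axis \<xi>)) (pinv_vec a l g (first_axis \<xi>))"
  shows "(\<Sum>k<d. (dot {..<l} (N k) (\<lambda>c. g (0, c)))\<^sup>2) < (\<xi> / t)\<^sup>2"
proof -
  define w where "w = pinv_vec a l g (first_axis \<xi>)"
  define W where "W = dot {..<l} w w"
  obtain e where e: "\<And>c. w c = (\<Sum>k<a. e k * g (k, c))"
    using pinv_vec_in_row_span unfolding w_def by metis
  have gw: "dot {..<l} (\<lambda>c. g (r, c)) w = first_axis \<xi> r" if "r < a" for r
    using pinv_vec_right_inverse[OF g that] unfolding w_def .
  have W: "W > 0" using large t unfolding W_def w_def by (smt (verit) zero_less_power)
  have "W = dot {..<l} (\<lambda>c. \<Sum>k<a. e k * g (k, c)) w"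
    unfolding W_def by (intro dot_cong) (auto simp: e)
  also have "\<dots> = (\<Sum>k<a. if k = 0 then e k * \<xi> else 0)"
    unfolding dot_sum_left by (intro sum.cong) (auto simp: gw)
  finally have We: "W = e 0 * \<xi>" using a by simp
  have Nw: "dot {..<l} (N k) w = e 0 * dot {..<l} (N k) (\<lambda>c. g (0, c))" if "k < d" for k
  proof -
    have "dot {..<l} (N k) w = dot {..<l} (N k) (\<lambda>c. \<Sum>i<a. e i * g (i, c))"
      by (intro dot_cong) (auto simp: e)
    also have "\<dots> = (\<Sum>i<a. if i = 0 then e 0 * dot {..<l} (N k) (\<lambda>c. g (0, c)) else 0)"
      unfolding dot_sum_right using N(2) that
      by (intro sum.cong) (auto simp: dot_commute[of _ "N k"])
    finally show ?thesis using a by simp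
  qed
  define S where "S = (\<Sum>k<d. (dot {..<l} (N k) (\<lambda>c. g (0, c)))\<^sup>2)"
  have "(e 0)\<^sup>2 * S = (\<Sum>k<d. (dot {..<l} (N k) w)\<^sup>2)"
    unfolding S_def sum_distrib_left by (intro sum.cong) (auto simp: Nw power_mult_distrib)
  also have "\<dots> \<le> W" unfolding W_def by (rule bessel[OF N(1)])
  finally have "(W / \<xi>)\<^sup>2 * S \<le> W" using We \<xi> by simp
  then have "W * (W * S) \<le> W * \<xi>\<^sup>2"
    using \<xi> by (simp add: power_divide field_simps power2_eq_square)
  then have "W * S \<le> \<xi>\<^sup>2" using W by simp
  moreover have "0 \<le> S" unfolding S_def by (simp add: sum_nonneg)
  ultimately have "S * t\<^sup>2 < \<xi>\<^sup>2"
  proof (cases "S = 0")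
    case False
    then have "S * t\<^sup>2 < S * W" using large \<open>0 \<le> S\<close> unfolding W_def w_def by (intro mult_strict_left_mono) auto
    then show ?thesis using \<open>W * S \<le> \<xi>\<^sup>2\<close> by (simp add: mult.commute)
  qed (use \<xi> in simp)
  then show ?thesis using t unfolding S_def by (simp add: power_divide field_simps)
qed

text \<open>Given the other \<open>a - 1\<close> rows, there are \<open>d = l - (a - 1)\<close>
  orthonormal directions orthogonal to them. The components of row 0 along these form a standard
  Gaussian vector of dimension \<open>d\<close>, to which the small ball estimate applies.\<close>

lemma gauss_row_distance:
  assumes a: "0 < a" "a \<le> l" and d: "d = l + 1 - a" and \<xi>: "\<xi> > 0" and t: "t > 0"
  shows "(\<integral>\<^sup>+g. indicator {g. det (gram a l g) \<noteq> 0 \<and>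
      t\<^sup>2 < dot {..<l} (pinv_vec a l g (first_axis \<xi>)) (pinv_vec a l g (first_axis \<xi>))} g \<partial>gauss ({..<a} \<times> {..<l}))
    \<le> ennreal ((sqrt (exp 1 / d) * (\<xi> / t)) ^ d)"
proof -
  define P where "P g \<longleftrightarrow> det (gram a l g) \<noteq> 0 \<and>
      t\<^sup>2 < dot {..<l} (pinv_vec a l g (first_axis \<xi>)) (pinv_vec a l g (first_axis \<xi>))" for g :: "nat \<times> nat \<Rightarrow> real"
  define I0 where "I0 = {0::nat} \<times> {..<l}"
  define I1 where "I1 = {1..<a} \<times> {..<l}"
  have I: "{..<a} \<times> {..<l} = I1 \<union> I0" "I1 \<inter> I0 = {}" "finite I1" "finite I0"
    using a by (auto simp: I0_def I1_def)
  have g: "(\<lambda>g. g (i, c)) \<in> borel_measurable (gauss (I1 \<union> I0))" if "i < a" "c < l" for i c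
    using that by (intro gauss_component_measurable) (auto simp flip: I(1))
  have [measurable]: "(\<lambda>g. det (gram a l g)) \<in> borel_measurable (gauss (I1 \<union> I0))"
    by (rule borel_measurable_det_gram) (rule g)
  have [measurable]: "(\<lambda>g. dot {..<l} (pinv_vec a l g (first_axis \<xi>)) (pinv_vec a l g (first_axis \<xi>))) \<in> borel_measurable (gauss (I1 \<union> I0))"
    unfolding dot_def
    by (intro borel_measurable_sum borel_measurable_times borel_measurable_pinv_vec g) auto
  have P: "(\<lambda>g. indicator {g. P g} g :: ennreal) \<in> borel_measurable (gauss (I1 \<union> I0))"
    unfolding P_def indicator_def by measurable
  have d': "d > 0" "a - 1 + d = l" using a d by auto
  define \<rho> where "\<rho> = \<xi> / t"
  have \<rho>: "\<rho> > 0" using \<xi> t by (simp add: \<rho>_def)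
  \<comment> \<open>The system \<open>N\<close> is chosen anew for each value \<open>x\<close> of
    the other rows. As the bound is uniform in \<open>x\<close>, no measurable choice is
    involved.\<close>
  have inner: "(\<integral>\<^sup>+y. indicator {g. P g} (merge I1 I0 (x, y)) \<partial>gauss I0) \<le> ennreal ((sqrt (exp 1 / d) * \<rho>) ^ d)" for x
  proof -
    obtain N where N: "orthonormal l d N"
      "\<And>i k. i < a - 1 \<Longrightarrow> k < d \<Longrightarrow> dot {..<l} (\<lambda>c. x (Suc i, c)) (N k) = 0"
      using orthonormal_complement[of "a - 1" d l "\<lambda>i c. x (Suc i, c)"] d' by auto
    define E where "E = {z \<in> space (gauss {..<d}). dot {..<d} z z < \<rho>\<^sup>2}"
    define NN where "NN k = (\<lambda>ic :: nat \<times> nat. N k (snd ic))" for k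
    have I0dot: "dot I0 u v = dot {..<l} (\<lambda>c. u (0, c)) (\<lambda>c. v (0, c))" for u v :: "nat \<times> nat \<Rightarrow> real"
      unfolding dot_def I0_def sum.cartesian_product' by simp
    have E: "E \<in> sets (gauss {..<d})"
      unfolding E_def using dot_self_measurable[of "{..<d}"] by simp
    have "(\<integral>\<^sup>+y. indicator {g. P g} (merge I1 I0 (x, y)) \<partial>gauss I0) \<le>
      (\<integral>\<^sup>+y. indicator E (\<lambda>k\<in>{..<d}. dot I0 (NN k) y) \<partial>gauss I0)"
    proof (rule nn_integral_mono)
      fix y
      have "(\<lambda>k\<in>{..<d}. dot I0 (NN k) y) \<in> E" if "P (merge I1 I0 (x, y))"
      proof -
        define g where "g = merge I1 I0 (x, y)"
        have g1: "g (i, c) = x (i, c)" if "0 < i" "i < a" "c < l" for i c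
          using that by (simp add: g_def merge_def I1_def)
        have g0: "g (0, c) = y (0, c)" if "c < l" for c
          using that by (simp add: g_def merge_def I1_def I0_def)
        have "(\<Sum>k<d. (dot {..<l} (N k) (\<lambda>c. g (0, c)))\<^sup>2) < (\<xi> / t)\<^sup>2"
        proof (rule row_distance_bound[OF _ a(1) \<xi> t N(1)])
          show "det (gram a l g) \<noteq> 0" "t\<^sup>2 < dot {..<l} (pinv_vec a l g (first_axis \<xi>)) (pinv_vec a l g (first_axis \<xi>))"
            using that unfolding g_def[symmetric] P_def by auto
          show "dot {..<l} (\<lambda>c. g (i, c)) (N k) = 0" if "0 < i" "i < a" "k < d" for i k
          proof -
            have "dot {..<l} (\<lambda>c. g (i, c)) (N k) = dot {..<l} (\<lambda>c. x (Suc (i - 1), c)) (N k)"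
              using that g1 by (intro dot_cong) auto
            then show ?thesis using N(2)[of "i - 1" k] that by simp
          qed
        qed
        moreover have "dot I0 (NN k) y = dot {..<l} (N k) (\<lambda>c. g (0, c))" for k
          unfolding I0dot NN_def by (intro dot_cong) (auto simp: g0)
        ultimately show ?thesis
          unfolding E_def \<rho>_def by (auto simp: space_PiM dot_def[of "{..<d}"] power2_eq_square)
      qed
      then show "indicator {g. P g} (merge I1 I0 (x, y)) \<le> (indicator E (\<lambda>k\<in>{..<d}. dot I0 (NN k) y) :: ennreal)"
        by (auto simp: indicator_def)
    qed
    also have "\<dots> = (\<integral>\<^sup>+z. indicator E z \<partial>gauss {..<d})"
    proof (rule nn_integral_gauss_orthonormal)
      show "dot I0 (NN k) (NN k') = (if k = k' then 1 else 0)" if "k \<in> {..<d}" "k' \<in> {..<d}" for k k'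
        using N(1) that unfolding I0dot orthonormal_def by (simp add: NN_def)
    qed (use E I in auto)
    also have "\<dots> = emeasure (gauss {..<d}) E" using E by simp
    also have "\<dots> \<le> ennreal ((sqrt (exp 1 / d) * \<rho>) ^ d)"
      unfolding E_def by (rule gauss_small_ball) (use d' \<rho> in auto)
    finally show ?thesis .
  qed
  have "(\<integral>\<^sup>+g. indicator {g. P g} g \<partial>gauss (I1 \<union> I0)) =
    (\<integral>\<^sup>+x. \<integral>\<^sup>+y. indicator {g. P g} (merge I1 I0 (x, y)) \<partial>gauss I0 \<partial>gauss I1)"
    by (rule nn_integral_gauss_union) (use I P in auto)
  also have "\<dots> \<le> (\<integral>\<^sup>+x. ennreal ((sqrt (exp 1 / d) * \<rho>) ^ d) \<partial>gauss I1)"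
    by (intro nn_integral_mono inner)
  also have "\<dots> = ennreal ((sqrt (exp 1 / d) * \<rho>) ^ d)"
    by (simp add: prob_space.emeasure_space_1[OF prob_space_gauss])
  finally show ?thesis unfolding P_def \<rho>_def I(1) .
qed

text \<open>For fixed \<open>G\<close>, the vector \<open>H w\<close> with
  \<open>w = G\<^sup>\<dagger> (\<xi>, 0, ..., 0)\<close> is distributed as \<open>|w| z\<close>
  with \<open>z\<close> standard Gaussian. Exchanging the integrals fixes \<open>z\<close> instead,
  and \<open>gauss_row_distance\<close> at the level \<open>y / |z|\<close> produces the factor
  \<open>|z| ^ d\<close>.\<close>

lemma gauss_large_tail_axis:
  assumes a: "0 < a" "a \<le> l" "a \<le> n" and d: "d = l + 1 - a" and \<xi>: "\<xi> > 0" and y: "y > 0"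
  shows "(\<integral>\<^sup>+g. indicator {g. large_tail a n l y g (first_axis \<xi>)} g \<partial>gauss ({..<n} \<times> {..<l}))
    \<le> ennreal ((sqrt (exp 1 / d) * (\<xi> / y)) ^ d) *
      (\<integral>\<^sup>+z. ennreal (sqrt (dot {a..<n} z z) ^ d) \<partial>gauss {a..<n})"
proof -
  define Ig where "Ig = {..<a} \<times> {..<l}"
  define Ih where "Ih = {a..<n} \<times> {..<l}"
  define W where "W g = dot {..<l} (pinv_vec a l g (first_axis \<xi>)) (pinv_vec a l g (first_axis \<xi>))" for g :: "nat \<times> nat \<Rightarrow> real"
  define Q where "Q g z \<longleftrightarrow> det (gram a l g) \<noteq> 0 \<and> y\<^sup>2 < W g * dot {a..<n} z z"
    for g :: "nat \<times> nat \<Rightarrow> real" and z :: "nat \<Rightarrow> real"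
  have I: "{..<n} \<times> {..<l} = Ig \<union> Ih" "Ig \<inter> Ih = {}" "finite Ig" "finite Ih"
    using a by (auto simp: Ig_def Ih_def)
  have L: "(\<lambda>g. indicator {g. large_tail a n l y g (first_axis \<xi>)} g :: ennreal) \<in> borel_measurable (gauss (Ig \<union> Ih))"
  proof -
    have [measurable]: "Measurable.pred (gauss (Ig \<union> Ih)) (\<lambda>g. large_tail a n l y g (first_axis \<xi>))"
      by (rule measurable_large_tail) (use a in \<open>auto intro!: gauss_component_measurable simp flip: I(1)\<close>)
    show ?thesis unfolding indicator_def by measurable
  qed
  have gI: "(\<lambda>g. g (i, c)) \<in> borel_measurable (gauss Ig)" if "i < a" "c < l" for i c
    using that by (intro gauss_component_measurable) (auto simp: Ig_def)
  have mdet [measurable]: "(\<lambda>g. det (gram a l g)) \<in> borel_measurable (gauss Ig)"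
    by (rule borel_measurable_det_gram) (rule gI)
  have mW [measurable]: "W \<in> borel_measurable (gauss Ig)"
    unfolding W_def dot_def
    by (intro borel_measurable_sum borel_measurable_times borel_measurable_pinv_vec gI) auto
  note mz [measurable] = dot_self_measurable[of "{a..<n}", simplified]
  have mQ: "(\<lambda>(g, z). indicator {z. Q g z} z :: ennreal) \<in> borel_measurable (gauss Ig \<Otimes>\<^sub>M gauss {a..<n})"
    unfolding Q_def indicator_def by measurable
  have inner: "(\<integral>\<^sup>+h. indicator {g. large_tail a n l y g (first_axis \<xi>)} (merge Ig Ih (g, h)) \<partial>gauss Ih) \<le>
    (\<integral>\<^sup>+z. indicator {z. Q g z} z \<partial>gauss {a..<n})" for g
  proof -
    define w where "w = pinv_vec a l g (first_axis \<xi>)"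
    have tail: "large_tail a n l y (merge Ig Ih (g, h)) (first_axis \<xi>) \<longleftrightarrow>
      det (gram a l g) \<noteq> 0 \<and> y\<^sup>2 < (\<Sum>r\<in>{a..<n}. (dot {..<l} (\<lambda>c. h (r, c)) w)\<^sup>2)" for h
    proof -
      define m where "m = merge Ig Ih (g, h)"
      have mg: "m (i, c) = g (i, c)" if "i < a" "c < l" for i c
        using that by (simp add: m_def merge_def Ig_def)
      have mh: "m (i, c) = h (i, c)" if "a \<le> i" "i < n" "c < l" for i c
        using that by (simp add: m_def merge_def Ig_def Ih_def)
      have "gram a l m = gram a l g" using mg by (rule gram_cong)
      moreover have "pinv_vec a l m (first_axis \<xi>) c = w c" if "c < l" for c
        unfolding w_def pinv_vec_def using that by (intro sum.cong arg_cong[of _ _ "(*) _"] pinv_cong mg) auto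
      then have "tail_energy a n l m (first_axis \<xi>) = (\<Sum>r\<in>{a..<n}. (dot {..<l} (\<lambda>c. h (r, c)) w)\<^sup>2)"
        unfolding tail_energy_def using mh by (intro sum.cong arg_cong[of _ _ "\<lambda>t. t\<^sup>2"] dot_cong) auto
      ultimately show ?thesis unfolding large_tail_def m_def by simp
    qed
    have Wnn: "W g \<ge> 0" unfolding W_def by (rule dot_self_nonneg)
    show ?thesis
    proof (cases "W g = 0")
      case True
      then have "\<forall>c\<in>{..<l}. w c = 0"
        unfolding W_def w_def by (subst (asm) dot_self_eq_0_iff) auto
      then have "dot {..<l} (\<lambda>c. h (r, c)) w = 0" for h :: "nat \<times> nat \<Rightarrow> real" and r
        by (simp add: dot_def)
      then have "\<not> large_tail a n l y (merge Ig Ih (g, h)) (first_axis \<xi>)" for h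
        unfolding tail using y by simp
      then show ?thesis by (simp add: indicator_def)
    next
      case False
      define s where "s = sqrt (W g)"
      have s: "s > 0" "s\<^sup>2 = W g" using False Wnn by (auto simp: s_def)
      \<comment> \<open>\<open>NN r\<close> is the unit vector \<open>w / |w|\<close> placed in row
        \<open>r\<close>; its inner product with \<open>h\<close> is entry \<open>r\<close> of
        \<open>H w / |w|\<close>.\<close>
      define NN where "NN r = (\<lambda>(i, c). if i = r then 1 / s * w c else 0)" for r :: nat
      have Ihdot: "dot Ih u v = (\<Sum>r\<in>{a..<n}. dot {..<l} (\<lambda>c. u (r, c)) (\<lambda>c. v (r, c)))" for u v :: "nat \<times> nat \<Rightarrow> real"
        unfolding dot_def Ih_def by (simp add: sum.cartesian_product)
      have NNdot: "dot Ih (NN r) v = 1 / s * dot {..<l} (\<lambda>c. v (r, c)) w" if "r \<in> {a..<n}" for r v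
      proof -
        have "dot Ih (NN r) v = (\<Sum>r'\<in>{a..<n}. if r' = r then 1 / s * dot {..<l} w (\<lambda>c. v (r, c)) else 0)"
          unfolding Ihdot by (intro sum.cong) (auto simp: NN_def dot_scale_left[of _ "1 / s", simplified], simp add: dot_def)
        then show ?thesis using that by (simp add: dot_commute[of _ w])
      qed
      have "(\<integral>\<^sup>+h. indicator {g. large_tail a n l y g (first_axis \<xi>)} (merge Ig Ih (g, h)) \<partial>gauss Ih) =
        (\<integral>\<^sup>+h. indicator {z. Q g z} (\<lambda>r\<in>{a..<n}. dot Ih (NN r) h) \<partial>gauss Ih)"
      proof (rule nn_integral_cong)
        fix h
        define z where "z = (\<lambda>r\<in>{a..<n}. dot Ih (NN r) h)"
        have "W g * dot {a..<n} z z = (\<Sum>r\<in>{a..<n}. (dot {..<l} (\<lambda>c. h (r, c)) w)\<^sup>2)"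
          unfolding dot_def[of "{a..<n}"] sum_distrib_left s(2)[symmetric] using s(1)
          by (intro sum.cong) (auto simp: z_def NNdot power2_eq_square)
        then show "indicator {g. large_tail a n l y g (first_axis \<xi>)} (merge Ig Ih (g, h)) =
          (indicator {z. Q g z} (\<lambda>r\<in>{a..<n}. dot Ih (NN r) h) :: ennreal)"
          unfolding z_def[symmetric] indicator_def by (simp add: tail Q_def)
      qed
      also have "\<dots> = (\<integral>\<^sup>+z. indicator {z. Q g z} z \<partial>gauss {a..<n})"
      proof (rule nn_integral_gauss_orthonormal)
        show "dot Ih (NN k) (NN k') = (if k = k' then 1 else 0)" if k: "k \<in> {a..<n}" "k' \<in> {a..<n}" for k k'
        proof -
          have "dot Ih (NN k) (NN k') = 1 / s * dot {..<l} (\<lambda>c. if k = k' then 1 / s * w c else 0) w"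
            unfolding NNdot[OF k(1)] by (simp add: NN_def)
          also have "\<dots> = (if k = k' then 1 / s * (1 / s * W g) else 0)"
          proof (cases "k = k'")
            case True
            then show ?thesis unfolding W_def w_def[symmetric] by (simp only: simp_thms dot_scale_left if_True)
          qed (simp add: dot_def)
          finally show ?thesis using s by (simp add: power2_eq_square flip: s(2))
        qed
        show "indicator {z. Q g z} \<in> borel_measurable (gauss {a..<n})"
          unfolding Q_def indicator_def by measurable
      qed (use I in auto)
      finally show ?thesis by simp
    qed
  qed
  have "(\<integral>\<^sup>+g. indicator {g. large_tail a n l y g (first_axis \<xi>)} g \<partial>gauss (Ig \<union> Ih)) =
    (\<integral>\<^sup>+g. \<integral>\<^sup>+h. indicator {g. large_tail a n l y g (first_axis \<xi>)} (merge Ig Ih (g, h)) \<partial>gauss Ih \<partial>gauss Ig)"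
    by (rule nn_integral_gauss_union) (use I L in auto)
  also have "\<dots> \<le> (\<integral>\<^sup>+g. \<integral>\<^sup>+z. indicator {z. Q g z} z \<partial>gauss {a..<n} \<partial>gauss Ig)"
    by (intro nn_integral_mono inner)
  also have "\<dots> = (\<integral>\<^sup>+z. \<integral>\<^sup>+g. indicator {z. Q g z} z \<partial>gauss Ig \<partial>gauss {a..<n})"
  proof -
    interpret pair_sigma_finite "gauss Ig" "gauss {a..<n}"
      by (intro pair_sigma_finite.intro prob_space_imp_sigma_finite prob_space_gauss)
    show ?thesis by (rule Fubini'[symmetric]) (rule mQ)
  qed
  also have "\<dots> \<le> (\<integral>\<^sup>+z. ennreal ((sqrt (exp 1 / d) * (\<xi> / y)) ^ d) * ennreal (sqrt (dot {a..<n} z z) ^ d) \<partial>gauss {a..<n})"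
  proof (rule nn_integral_mono)
    fix z
    define \<zeta> where "\<zeta> = sqrt (dot {a..<n} z z)"
    have \<zeta>: "\<zeta> \<ge> 0" "\<zeta>\<^sup>2 = dot {a..<n} z z" using dot_self_nonneg[of "{a..<n}" z] by (auto simp: \<zeta>_def)
    show "(\<integral>\<^sup>+g. indicator {z. Q g z} z \<partial>gauss Ig) \<le>
      ennreal ((sqrt (exp 1 / d) * (\<xi> / y)) ^ d) * ennreal (sqrt (dot {a..<n} z z) ^ d)"
    proof (cases "\<zeta> = 0")
      case True
      then have "\<not> Q g z" for g using \<zeta> y by (simp add: Q_def)
      then show ?thesis by simp
    next
      case False
      then have "\<zeta> > 0" using \<zeta> by simp
      have "(\<integral>\<^sup>+g. indicator {z. Q g z} z \<partial>gauss Ig) =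
        (\<integral>\<^sup>+g. indicator {g. det (gram a l g) \<noteq> 0 \<and>
          (y / \<zeta>)\<^sup>2 < dot {..<l} (pinv_vec a l g (first_axis \<xi>)) (pinv_vec a l g (first_axis \<xi>))} g \<partial>gauss Ig)"
      proof (rule nn_integral_cong)
        fix g
        have "0 < dot {a..<n} z z" using \<open>\<zeta> > 0\<close> \<zeta>(2) by (metis zero_less_power)
        then have "Q g z \<longleftrightarrow> det (gram a l g) \<noteq> 0 \<and> (y / \<zeta>)\<^sup>2 < W g"
          unfolding Q_def power_divide \<zeta>(2) by (simp add: divide_less_eq)
        then show "indicator {z. Q g z} z = (indicator {g. det (gram a l g) \<noteq> 0 \<and>
          (y / \<zeta>)\<^sup>2 < dot {..<l} (pinv_vec a l g (first_axis \<xi>)) (pinv_vec a l g (first_axis \<xi>))} g :: ennreal)"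
          by (simp add: indicator_def W_def)
      qed
      also have "\<dots> \<le> ennreal ((sqrt (exp 1 / d) * (\<xi> / (y / \<zeta>))) ^ d)"
        unfolding Ig_def by (rule gauss_row_distance) (use a d \<xi> y \<open>\<zeta> > 0\<close> in auto)
      also have "\<dots> = ennreal ((sqrt (exp 1 / d) * (\<xi> / y)) ^ d * \<zeta> ^ d)"
        by (simp add: power_mult_distrib power_divide mult_ac)
      also have "\<dots> = ennreal ((sqrt (exp 1 / d) * (\<xi> / y)) ^ d) * ennreal (\<zeta> ^ d)"
        using \<zeta> \<xi> y by (intro ennreal_mult) auto
      finally show ?thesis unfolding \<zeta>_def .
    qed
  qed
  also have "\<dots> = ennreal ((sqrt (exp 1 / d) * (\<xi> / y)) ^ d) *
      (\<integral>\<^sup>+z. ennreal (sqrt (dot {a..<n} z z) ^ d) \<partial>gauss {a..<n})"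
    by (rule nn_integral_cmult) measurable
  finally show ?thesis unfolding I(1) .
qed

text \<open>An orthogonal matrix whose first row is \<open>x / |x|\<close> carries \<open>x\<close>
  to \<open>|x|\<close> times the first axis; applied to the rows of \<open>G\<close> it leaves the
  law of the matrix unchanged.\<close>

lemma gauss_large_tail_fixed:
  assumes a: "0 < a" "a \<le> l" "a \<le> n" and d: "d = l + 1 - a" and y: "y > 0"
  shows "(\<integral>\<^sup>+g. indicator {g. large_tail a n l y g x} g \<partial>gauss ({..<n} \<times> {..<l}))
    \<le> ennreal ((sqrt (exp 1 / d) / y) ^ d) * ennreal (sqrt (dot {..<a} x x) ^ d) *
      (\<integral>\<^sup>+z. ennreal (sqrt (dot {a..<n} z z) ^ d) \<partial>gauss {a..<n})"
proof -
  define \<xi> where "\<xi> = sqrt (dot {..<a} x x)"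
  have \<xi>: "\<xi> \<ge> 0" "\<xi>\<^sup>2 = dot {..<a} x x" using dot_self_nonneg[of "{..<a}" x] by (auto simp: \<xi>_def)
  show ?thesis
  proof (cases "\<xi> = 0")
    case True
    then have "\<forall>i\<in>{..<a}. x i = 0"
      using \<xi>(2) by (subst dot_self_eq_0_iff[symmetric]) auto
    then have "pinv_vec a l g x c = 0" for g c by (simp add: pinv_vec_def)
    then have "\<not> large_tail a n l y g x" for g
      unfolding large_tail_def tail_energy_def using y by (simp add: dot_def)
    then show ?thesis by simp
  next
    case False
    then have \<xi>pos: "\<xi> > 0" using \<xi> by simp
    define I where "I = {..<n} \<times> {..<l}"
    have "dot {..<a} (\<lambda>i. 1 / \<xi> * x i) (\<lambda>i. 1 / \<xi> * x i) = 1"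
      unfolding dot_scale_left dot_scale_right \<xi>(2)[symmetric] using \<xi>pos by (simp add: power2_eq_square)
    then have "orthonormal a 1 (\<lambda>_ i. 1 / \<xi> * x i)" unfolding orthonormal_def by auto
    then obtain R where R: "orthonormal a a R" "R 0 = (\<lambda>i. 1 / \<xi> * x i)"
      using orthonormal_extend[of a 1] a(1) by force
    \<comment> \<open>\<open>K\<close> is block diagonal, with \<open>R\<close> acting on the rows
      of \<open>G\<close> and the identity on the rows of \<open>H\<close>; \<open>NN\<close> is the
      same map on matrices, acting column by column.\<close>
    define K where "K r i = (if r < a then if i < a then R r i else 0 else if i = r then 1 else 0)" for r i
    define NN where "NN = (\<lambda>(r, c :: nat) (i, c'). if c' = c then K r i else 0)"
    have Idot: "dot I u v = (\<Sum>i<n. \<Sum>c<l. u (i, c) * v (i, c))" for u v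
      unfolding dot_def I_def sum.cartesian_product' ..
    have NNdot: "dot I (NN (r, c)) g = (if r < a then \<Sum>i<a. R r i * g (i, c) else g (r, c))"
      if "r < n" "c < l" for r c g
    proof -
      have "dot I (NN (r, c)) g = (\<Sum>i<n. \<Sum>c'<l. if c' = c then K r i * g (i, c) else 0)"
        unfolding Idot NN_def by (intro sum.cong) auto
      also have "\<dots> = (\<Sum>i<n. K r i * g (i, c))" using that by simp
      also have "\<dots> = (if r < a then \<Sum>i<a. R r i * g (i, c) else g (r, c))"
      proof (cases "r < a")
        case True
        then have "(\<Sum>i<n. K r i * g (i, c)) = (\<Sum>i<a. K r i * g (i, c))"
          using a by (intro sum.mono_neutral_right) (auto simp: K_def)
        then show ?thesis using True by (simp add: K_def)
      next
        case False
        then have "(\<Sum>i<n. K r i * g (i, c)) = (\<Sum>i<n. if i = r then g (i, c) else 0)"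
          by (intro sum.cong) (auto simp: K_def)
        then show ?thesis using False that by simp
      qed
      finally show ?thesis .
    qed
    have orth: "dot I (NN k) (NN k') = (if k = k' then 1 else 0)" if "k \<in> I" "k' \<in> I" for k k'
    proof -
      obtain r c r' c' where k: "k = (r, c)" "k' = (r', c')" by fastforce
      then have b: "r < n" "c < l" "r' < n" "c' < l" using that by (auto simp: I_def)
      show ?thesis
      proof (cases "c = c'")
        case True
        have RR: "(\<Sum>i<a. R r i * R r' i) = (if r = r' then 1 else 0)" if "r < a" "r' < a"
          using R(1) that unfolding orthonormal_def dot_def by simp
        show ?thesis
          using True RR unfolding k NNdot[OF b(1,2)] by (auto simp: NN_def K_def intro!: sum.neutral)
      next
        case False
        then show ?thesis unfolding k NNdot[OF b(1,2)] by (auto simp: NN_def)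
      qed
    qed
    have L: "(\<lambda>g. indicator {g. large_tail a n l y g (first_axis \<xi>)} g :: ennreal) \<in> borel_measurable (gauss I)"
    proof -
      have [measurable]: "Measurable.pred (gauss I) (\<lambda>g. large_tail a n l y g (first_axis \<xi>))"
        by (rule measurable_large_tail) (use a in \<open>auto intro!: gauss_component_measurable simp: I_def\<close>)
      show ?thesis unfolding indicator_def by measurable
    qed
    have "(\<integral>\<^sup>+g. indicator {g. large_tail a n l y g x} g \<partial>gauss I) =
      (\<integral>\<^sup>+g. indicator {g. large_tail a n l y g (first_axis \<xi>)} (\<lambda>k\<in>I. dot I (NN k) g) \<partial>gauss I)"
    proof (rule nn_integral_cong)
      fix g
      have "large_tail a n l y (\<lambda>k\<in>I. dot I (NN k) g) (first_axis \<xi>) \<longleftrightarrow> large_tail a n l y g x"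
      proof (rule large_tail_rotate[OF R(1) a(3)])
        show "(\<lambda>k\<in>I. dot I (NN k) g) (r, c) = (if r < a then \<Sum>i<a. R r i * g (i, c) else g (r, c))"
          if "r < n" "c < l" for r c
          using that NNdot[OF that, of g] by (simp add: I_def)
        show "first_axis \<xi> r = dot {..<a} (R r) x" if "r < a" for r
        proof -
          have "dot {..<a} (R r) x = dot {..<a} (R r) (\<lambda>i. \<xi> * R 0 i)"
            using \<xi>pos by (intro dot_cong) (auto simp: R(2))
          also have "\<dots> = \<xi> * (if r = 0 then 1 else 0)"
            unfolding dot_scale_right using R(1) that a unfolding orthonormal_def by auto
          finally show ?thesis by simp
        qed
      qed
      then show "indicator {g. large_tail a n l y g x} g =
        (indicator {g. large_tail a n l y g (first_axis \<xi>)} (\<lambda>k\<in>I. dot I (NN k) g) :: ennreal)"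
        by (simp add: indicator_def)
    qed
    also have "\<dots> = (\<integral>\<^sup>+g. indicator {g. large_tail a n l y g (first_axis \<xi>)} g \<partial>gauss I)"
      by (rule nn_integral_gauss_orthonormal) (use orth L in \<open>auto simp: I_def\<close>)
    also have "\<dots> \<le> ennreal ((sqrt (exp 1 / d) * (\<xi> / y)) ^ d) *
      (\<integral>\<^sup>+z. ennreal (sqrt (dot {a..<n} z z) ^ d) \<partial>gauss {a..<n})"
      unfolding I_def by (rule gauss_large_tail_axis[OF a d \<xi>pos y])
    also have "ennreal ((sqrt (exp 1 / d) * (\<xi> / y)) ^ d) = ennreal ((sqrt (exp 1 / d) / y) ^ d) * ennreal (\<xi> ^ d)"
      using \<xi> y by (subst ennreal_mult[symmetric]) (auto simp: power_mult_distrib power_divide)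
    finally show ?thesis unfolding I_def \<xi>_def .
  qed
qed

lemma gauss_large_tail:
  assumes a: "0 < a" "a \<le> l" "a \<le> n" and d: "d = l + 1 - a" and y: "y > 0"
  shows "(\<integral>\<^sup>+x. \<integral>\<^sup>+g. indicator {g. large_tail a n l y g x} g \<partial>gauss ({..<n} \<times> {..<l}) \<partial>gauss {..<a})
    \<le> ennreal ((sqrt (exp 1 / d) / y) ^ d) *
      (\<integral>\<^sup>+x. ennreal (sqrt (dot {..<a} x x) ^ d) \<partial>gauss {..<a}) *
      (\<integral>\<^sup>+z. ennreal (sqrt (dot {a..<n} z z) ^ d) \<partial>gauss {a..<n})"
proof -
  note [measurable] = dot_self_measurable[of "{..<a}", simplified]
  have "(\<integral>\<^sup>+x. \<integral>\<^sup>+g. indicator {g. large_tail a n l y g x} g \<partial>gauss ({..<n} \<times> {..<l}) \<partial>gauss {..<a}) \<le>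
    (\<integral>\<^sup>+x. ennreal ((sqrt (exp 1 / d) / y) ^ d) * ennreal (sqrt (dot {..<a} x x) ^ d) *
      (\<integral>\<^sup>+z. ennreal (sqrt (dot {a..<n} z z) ^ d) \<partial>gauss {a..<n}) \<partial>gauss {..<a})"
    by (intro nn_integral_mono gauss_large_tail_fixed assms)
  also have "\<dots> = ennreal ((sqrt (exp 1 / d) / y) ^ d) *
      (\<integral>\<^sup>+x. ennreal (sqrt (dot {..<a} x x) ^ d) \<partial>gauss {..<a}) *
      (\<integral>\<^sup>+z. ennreal (sqrt (dot {a..<n} z z) ^ d) \<partial>gauss {a..<n})"
    by (subst nn_integral_multc, measurable, subst nn_integral_cmult, measurable)
  finally show ?thesis .
qed

section \<open>Almost sure independence of the Gaussian rows\<close>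

lemma std_gauss_singleton: "emeasure std_gauss {c} = 0"
proof -
  have "emeasure std_gauss {c} = (\<integral>\<^sup>+x. ennreal (std_normal_density x) * indicator {c} x \<partial>lborel)"
    by (simp add: emeasure_density)
  moreover have "AE x in lborel. ennreal (std_normal_density x) * indicator {c} x = 0"
    using AE_lborel_singleton[of c] by eventually_elim simp
  ultimately show ?thesis by (simp add: nn_integral_0_iff_AE)
qed

text \<open>Induction on the number of rows. If the first \<open>i\<close> rows are independent but
  row \<open>i\<close> lies in their span, then row \<open>i\<close> is orthogonal to any unit
  vector \<open>u\<close> that is orthogonal to them. Given the other rows, its product with
  \<open>u\<close> is standard normal and vanishes with probability 0.\<close>

lemma gauss_gram_nonsingular:
  assumes "a \<le> l" "a \<le> n"
  shows "AE g in gauss ({..<n} \<times> {..<l}). det (gram a l g) \<noteq> 0"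
  using assms
proof (induction a)
  case 0
  show ?case by (simp add: gram_def)
next
  case (Suc i)
  define I0 where "I0 = {i} \<times> {..<l}"
  define I1 where "I1 = ({..<n} - {i}) \<times> {..<l}"
  have I: "{..<n} \<times> {..<l} = I1 \<union> I0" "I1 \<inter> I0 = {}" "finite I1" "finite I0"
    using Suc.prems by (auto simp: I0_def I1_def)
  define P where "P g \<longleftrightarrow> det (gram i l g) \<noteq> 0 \<and> det (gram (Suc i) l g) = 0" for g :: "nat \<times> nat \<Rightarrow> real"
  have [measurable]: "(\<lambda>g. det (gram i' l g)) \<in> borel_measurable (gauss (I1 \<union> I0))" if "i' \<le> n" for i'
    by (rule borel_measurable_det_gram, rule gauss_component_measurable)
      (use that in \<open>auto simp flip: I(1)\<close>)
  have i: "i \<le> n" "Suc i \<le> n" using Suc.prems by auto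
  have mP: "Measurable.pred (gauss (I1 \<union> I0)) P"
    unfolding P_def using i by measurable
  have mP': "(\<lambda>g. indicator {g. P g} g :: ennreal) \<in> borel_measurable (gauss (I1 \<union> I0))"
    unfolding indicator_def using mP by measurable
  have inner: "(\<integral>\<^sup>+y. indicator {g. P g} (merge I1 I0 (x, y)) \<partial>gauss I0) \<le> 0" for x
  proof -
    obtain u where u: "dot {..<l} u u = 1" "\<And>k. k < i \<Longrightarrow> dot {..<l} (\<lambda>c. x (k, c)) u = 0"
      using unit_vector_orthogonal[of i l "\<lambda>k c. x (k, c)"] Suc.prems by auto
    define NN where "NN k = (\<lambda>ic :: nat \<times> nat. u (snd ic))" for k :: nat
    define E where "E = {z \<in> space (gauss {0::nat}). z 0 = 0}"
    have E: "E \<in> sets (gauss {0::nat})"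
      unfolding E_def using gauss_component_measurable[of "0::nat" "{0}"] by simp
    have I0dot: "dot I0 u v = dot {..<l} (\<lambda>c. u (i, c)) (\<lambda>c. v (i, c))" for u v :: "nat \<times> nat \<Rightarrow> real"
      unfolding dot_def I0_def sum.cartesian_product' by simp
    have "(\<integral>\<^sup>+y. indicator {g. P g} (merge I1 I0 (x, y)) \<partial>gauss I0) \<le>
      (\<integral>\<^sup>+y. indicator E (\<lambda>k\<in>{0}. dot I0 (NN k) y) \<partial>gauss I0)"
    proof (rule nn_integral_mono)
      fix y
      have "(\<lambda>k\<in>{0}. dot I0 (NN k) y) \<in> E" if "P (merge I1 I0 (x, y))"
      proof -
        define g where "g = merge I1 I0 (x, y)"
        have g1: "g (k, c) = x (k, c)" if "k < i" "c < l" for k c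
          using that i by (simp add: g_def merge_def I1_def)
        have g0: "g (i, c) = y (i, c)" if "c < l" for c
          using that by (simp add: g_def merge_def I1_def I0_def)
        have Pg: "det (gram i l g) \<noteq> 0" "det (gram (Suc i) l g) = 0"
          using that unfolding g_def[symmetric] P_def by auto
        then obtain e k where e: "k < Suc i" "e k \<noteq> 0" "\<And>c. c < l \<Longrightarrow> (\<Sum>k<Suc i. e k * g (k, c)) = 0"
          unfolding det_gram_eq_0_iff[of "Suc i"] by blast
        have "e i \<noteq> 0"
        proof
          assume "e i = 0"
          then have "k < i" "\<And>c. c < l \<Longrightarrow> (\<Sum>k<i. e k * g (k, c)) = 0"
            using e by (auto simp: less_Suc_eq)
          then have "det (gram i l g) = 0" unfolding det_gram_eq_0_iff using e(2) by blast
          then show False using Pg by simp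
        qed
        have "0 = dot {..<l} (\<lambda>c. \<Sum>k<Suc i. e k * g (k, c)) u"
          using e(3) by (simp add: dot_def)
        also have "\<dots> = (\<Sum>k<i. e k * dot {..<l} (\<lambda>c. g (k, c)) u) + e i * dot {..<l} (\<lambda>c. g (i, c)) u"
          unfolding dot_sum_left by simp
        also have "(\<Sum>k<i. e k * dot {..<l} (\<lambda>c. g (k, c)) u) = 0"
        proof (rule sum.neutral, rule ballI)
          fix k assume k: "k \<in> {..<i}"
          have "dot {..<l} (\<lambda>c. g (k, c)) u = dot {..<l} (\<lambda>c. x (k, c)) u"
            using k g1 by (intro dot_cong) auto
          then show "e k * dot {..<l} (\<lambda>c. g (k, c)) u = 0" using u(2) k by simp
        qed
        finally have "dot {..<l} (\<lambda>c. g (i, c)) u = 0" using \<open>e i \<noteq> 0\<close> by simp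
        moreover have "dot I0 (NN 0) y = dot {..<l} (\<lambda>c. g (i, c)) u"
          unfolding I0dot NN_def by (subst dot_commute, intro dot_cong) (auto simp: g0)
        ultimately show ?thesis by (simp add: E_def space_PiM)
      qed
      then show "indicator {g. P g} (merge I1 I0 (x, y)) \<le> (indicator E (\<lambda>k\<in>{0}. dot I0 (NN k) y) :: ennreal)"
        by (auto simp: indicator_def)
    qed
    also have "\<dots> = (\<integral>\<^sup>+z. indicator E z \<partial>gauss {0::nat})"
    proof (rule nn_integral_gauss_orthonormal)
      show "dot I0 (NN k) (NN k') = (if k = k' then 1 else 0)" if "k \<in> {0}" "k' \<in> {0}" for k k'
        using u that unfolding I0dot by (simp add: NN_def)
    qed (use E I in auto)
    also have "\<dots> = emeasure (gauss {0::nat}) E" using E by simp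
    also have "\<dots> = emeasure (distr (gauss {0::nat}) std_gauss (\<lambda>z. z (0::nat))) {0}"
      using gauss_component_measurable[of "0::nat" "{0}"]
      by (subst emeasure_distr) (auto simp: E_def vimage_def Int_def conj_commute intro!: arg_cong2[where f = emeasure])
    also have "distr (gauss {0::nat}) std_gauss (\<lambda>z. z (0::nat)) = std_gauss"
      by (rule distr_PiM_component) (auto simp: prob_space_std_gauss)
    finally show ?thesis by (simp add: std_gauss_singleton)
  qed
  have "(\<integral>\<^sup>+g. indicator {g. P g} g \<partial>gauss (I1 \<union> I0)) =
    (\<integral>\<^sup>+x. \<integral>\<^sup>+y. indicator {g. P g} (merge I1 I0 (x, y)) \<partial>gauss I0 \<partial>gauss I1)"
    by (rule nn_integral_gauss_union) (use I mP' in auto)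
  also have "\<dots> = 0" using inner by simp
  finally have "AE g in gauss (I1 \<union> I0). indicator {g. P g} g = (0 :: ennreal)"
    by (rule nn_integral_0_iff_AE[OF mP', THEN iffD1])
  then have "AE g in gauss (I1 \<union> I0). \<not> P g"
    by (auto elim!: eventually_mono simp: indicator_def split: if_splits)
  moreover have "AE g in gauss (I1 \<union> I0). det (gram i l g) \<noteq> 0"
    using Suc unfolding I(1) by simp
  ultimately show ?case unfolding I(1) P_def by eventually_elim auto
qed

section \<open>Tail of the operator norm\<close>

text \<open>Because \<open>dot I \<zeta> x\<close> is \<open>|\<zeta>|\<close> times a standard
  normal variable.\<close>

lemma gauss_halfspace:
  assumes I: "finite I" and z: "dot I \<zeta> \<zeta> > 0" and s: "s \<ge> 0"
  shows "(\<integral>\<^sup>+x. indicator {x. s\<^sup>2 * dot I \<zeta> \<zeta> < (dot I \<zeta> x)\<^sup>2} x \<partial>gauss I) = emeasure std_gauss {x. s < \<bar>x\<bar>}"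
proof -
  define c where "c = sqrt (dot I \<zeta> \<zeta>)"
  have c: "c > 0" "c\<^sup>2 = dot I \<zeta> \<zeta>" using z by (auto simp: c_def)
  define NN where "NN k = (\<lambda>i. 1 / c * \<zeta> i)" for k :: nat
  define E where "E = {z \<in> space (gauss {0::nat}). s < \<bar>z 0\<bar>}"
  have m0: "(\<lambda>z. z 0) \<in> borel_measurable (gauss {0::nat})"
    by (rule gauss_component_measurable) simp
  have E: "E \<in> sets (gauss {0})"
    unfolding E_def using m0 by measurable
  have "(\<integral>\<^sup>+x. indicator {x. s\<^sup>2 * dot I \<zeta> \<zeta> < (dot I \<zeta> x)\<^sup>2} x \<partial>gauss I) =
    (\<integral>\<^sup>+x. indicator E (\<lambda>k\<in>{0}. dot I (NN k) x) \<partial>gauss I)"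
  proof (rule nn_integral_cong)
    fix x
    have "s\<^sup>2 * dot I \<zeta> \<zeta> < (dot I \<zeta> x)\<^sup>2 \<longleftrightarrow> \<bar>s * c\<bar> < \<bar>dot I \<zeta> x\<bar>"
      using abs_le_square_iff[of "dot I \<zeta> x" "s * c"] by (simp add: power_mult_distrib c(2) not_le[symmetric])
    also have "\<dots> \<longleftrightarrow> s < \<bar>dot I (NN 0) x\<bar>"
      unfolding NN_def dot_scale_left using c s by (simp add: abs_mult field_simps)
    finally show "indicator {x. s\<^sup>2 * dot I \<zeta> \<zeta> < (dot I \<zeta> x)\<^sup>2} x = (indicator E (\<lambda>k\<in>{0}. dot I (NN k) x) :: ennreal)"
      by (auto simp: E_def space_PiM indicator_def)
  qed
  also have "\<dots> = (\<integral>\<^sup>+z. indicator E z \<partial>gauss {0})"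
  proof (rule nn_integral_gauss_orthonormal)
    show "dot I (NN k) (NN k') = (if k = k' then 1 else 0)" if "k \<in> {0}" "k' \<in> {0}" for k k'
      using c that unfolding NN_def dot_scale_left dot_scale_right c(2)[symmetric]
      by (simp add: power2_eq_square)
  qed (use E I in auto)
  also have "\<dots> = emeasure (gauss {0}) E" using E by simp
  also have "\<dots> = emeasure (distr (gauss {0}) std_gauss (\<lambda>z. z (0::nat))) {x. s < \<bar>x\<bar>}"
    using m0 by (subst emeasure_distr) (auto simp: E_def vimage_def Int_def conj_commute)
  also have "distr (gauss {0}) std_gauss (\<lambda>z. z (0::nat)) = std_gauss"
    by (rule distr_PiM_component) (auto simp: prob_space_std_gauss)
  finally show ?thesis .
qed

text \<open>Write \<open>T\<close> for the map \<open>x \<mapsto> H G\<^sup>\<dagger> x\<close>, and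
  let \<open>\<zeta> = T\<^sup>T T x0\<close> and \<open>E = |T x0|\<^sup>2\<close>. Then
  \<open>E = dot {..<a} \<zeta> x0\<close> forces \<open>|\<zeta>|\<^sup>2 > t\<^sup>2 * E\<close>,
  while the inner product of \<open>\<zeta>\<close> with any \<open>x\<close> is at most
  \<open>sqrt E * |T x|\<close>. So \<open>|T x| > t * s\<close> whenever \<open>x\<close> has a
  component larger than \<open>s\<close> along \<open>\<zeta>\<close>. No maximizing singular vector
  is required: any \<open>x0\<close> that witnesses a norm above \<open>t\<close> will do.\<close>

lemma large_tail_random_direction:
  assumes g: "det (gram a l g) \<noteq> 0" and x0: "t\<^sup>2 * dot {..<a} x0 x0 < tail_energy a n l g x0"
    and t: "t > 0" and s: "s > 0"
  shows "emeasure std_gauss {x. s < \<bar>x\<bar>} \<le> (\<integral>\<^sup>+x. indicator {x. large_tail a n l (t * s) g x} x \<partial>gauss {..<a})"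
proof -
  define u where "u r = dot {..<l} (\<lambda>c. g (r, c)) (pinv_vec a l g x0)" for r
  define E where "E = tail_energy a n l g x0"
  define \<zeta> where "\<zeta> i = (\<Sum>r\<in>{a..<n}. u r * dot {..<l} (\<lambda>c. g (r, c)) (pinv a l g i))" for i
  have Edef: "E = (\<Sum>r\<in>{a..<n}. (u r)\<^sup>2)" unfolding E_def tail_energy_def u_def ..
  have \<zeta>x: "dot {..<a} \<zeta> x = (\<Sum>r\<in>{a..<n}. u r * dot {..<l} (\<lambda>c. g (r, c)) (pinv_vec a l g x))" for x
  proof -
    have "dot {..<l} (\<lambda>c. g (r, c)) (pinv_vec a l g x) =
      (\<Sum>i<a. x i * dot {..<l} (\<lambda>c. g (r, c)) (pinv a l g i))" for r
      unfolding pinv_vec_def dot_sum_right ..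
    then show ?thesis
      unfolding dot_def[of "{..<a}" \<zeta>] \<zeta>_def sum_distrib_left sum_distrib_right
      by (subst sum.swap) (simp add: sum_distrib_left mult_ac)
  qed
  have cs: "(dot {..<a} \<zeta> x)\<^sup>2 \<le> E * tail_energy a n l g x" for x
    unfolding \<zeta>x Edef tail_energy_def by (rule Cauchy_Schwarz_ineq_sum)
  have "dot {..<a} \<zeta> x0 = E" unfolding \<zeta>x Edef u_def[symmetric] by (simp add: power2_eq_square)
  moreover have "(dot {..<a} \<zeta> x0)\<^sup>2 \<le> dot {..<a} \<zeta> \<zeta> * dot {..<a} x0 x0"
    using Cauchy_Schwarz_ineq_sum[of \<zeta> x0 "{..<a}"] by (simp add: dot_def power2_eq_square)
  ultimately have E2: "E\<^sup>2 \<le> dot {..<a} \<zeta> \<zeta> * dot {..<a} x0 x0" by simp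
  have E: "t\<^sup>2 * dot {..<a} x0 x0 < E" using x0 unfolding E_def .
  then have Epos: "E > 0" using dot_self_nonneg[of "{..<a}" x0] t by (smt (verit) mult_nonneg_nonneg zero_le_power2)
  have zpos: "dot {..<a} \<zeta> \<zeta> > 0"
  proof (rule ccontr)
    assume "\<not> ?thesis"
    then have "dot {..<a} \<zeta> \<zeta> = 0" using dot_self_nonneg[of "{..<a}" \<zeta>] by simp
    then show False using E2 Epos by simp
  qed
  have "t\<^sup>2 * E\<^sup>2 \<le> dot {..<a} \<zeta> \<zeta> * (t\<^sup>2 * dot {..<a} x0 x0)"
    using mult_left_mono[OF E2, of "t\<^sup>2"] by (simp add: mult_ac)
  also have "\<dots> < dot {..<a} \<zeta> \<zeta> * E" using E zpos by (rule mult_strict_left_mono)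
  finally have tE: "t\<^sup>2 * E < dot {..<a} \<zeta> \<zeta>" using Epos by (simp add: power2_eq_square)
  have "emeasure std_gauss {x. s < \<bar>x\<bar>} =
    (\<integral>\<^sup>+x. indicator {x. s\<^sup>2 * dot {..<a} \<zeta> \<zeta> < (dot {..<a} \<zeta> x)\<^sup>2} x \<partial>gauss {..<a})"
    using zpos s by (intro gauss_halfspace[symmetric]) auto
  also have "\<dots> \<le> (\<integral>\<^sup>+x. indicator {x. large_tail a n l (t * s) g x} x \<partial>gauss {..<a})"
  proof (rule nn_integral_mono)
    fix x
    have "large_tail a n l (t * s) g x" if "s\<^sup>2 * dot {..<a} \<zeta> \<zeta> < (dot {..<a} \<zeta> x)\<^sup>2"
    proof -
      have "E * (t * s)\<^sup>2 = s\<^sup>2 * (t\<^sup>2 * E)" by (simp add: power_mult_distrib mult_ac)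
      also have "\<dots> \<le> s\<^sup>2 * dot {..<a} \<zeta> \<zeta>" using tE by (intro mult_left_mono) auto
      also have "\<dots> < E * tail_energy a n l g x" using that cs[of x] by simp
      finally show ?thesis using g Epos unfolding large_tail_def by simp
    qed
    then show "indicator {x. s\<^sup>2 * dot {..<a} \<zeta> \<zeta> < (dot {..<a} \<zeta> x)\<^sup>2} x \<le>
      (indicator {x. large_tail a n l (t * s) g x} x :: ennreal)"
      by (auto simp: indicator_def)
  qed
  finally show ?thesis .
qed

text \<open>The map \<open>x \<mapsto> H G\<^sup>T (G G\<^sup>T)\<^sup>-\<^sup>1 x\<close> is tested on a single Gaussian \<open>x\<close> independent of \<open>G, H\<close>: with
  probability at least \<open>P(|N| > s)\<close> its value is at least \<open>s\<close> times the operator norm.\<close>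

lemma operator_norm_tail:
  assumes M: "prob_space M"
    and law: "X \<in> measurable M (gauss ({..<n} \<times> {..<l}))" "distr M (gauss ({..<n} \<times> {..<l})) X = gauss ({..<n} \<times> {..<l})"
    and a: "0 < a" "a \<le> l" "a \<le> n" and d: "d = l + 1 - a" and t: "t > 0" and s: "s > 0"
    and E: "E \<in> sets M"
      "\<And>\<omega>. \<omega> \<in> E \<Longrightarrow> det (gram a l (X \<omega>)) \<noteq> 0 \<Longrightarrow> \<exists>x. t\<^sup>2 * dot {..<a} x x < tail_energy a n l (X \<omega>) x"
  shows "emeasure M E * emeasure std_gauss {x. s < \<bar>x\<bar>} \<le> ennreal ((sqrt (exp 1 / d) / (t * s)) ^ d) *
      (\<integral>\<^sup>+x. ennreal (sqrt (dot {..<a} x x) ^ d) \<partial>gauss {..<a}) *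
      (\<integral>\<^sup>+z. ennreal (sqrt (dot {a..<n} z z) ^ d) \<partial>gauss {a..<n})"
proof -
  define I where "I = {..<n} \<times> {..<l}"
  note law = law[folded I_def]
  define p where "p = emeasure std_gauss {x. s < \<bar>x\<bar>}"
  define F where "F g = (\<integral>\<^sup>+x. indicator {x. large_tail a n l (t * s) g x} x \<partial>gauss {..<a})" for g
  interpret pair_sigma_finite "gauss I" "gauss {..<a}"
    by (intro pair_sigma_finite.intro prob_space_imp_sigma_finite prob_space_gauss)
  have mL: "(\<lambda>(g, x). indicator {x. large_tail a n l (t * s) g x} x :: ennreal) \<in> borel_measurable (gauss I \<Otimes>\<^sub>M gauss {..<a})"
  proof -
    have "Measurable.pred (gauss I \<Otimes>\<^sub>M gauss {..<a}) (\<lambda>p. large_tail a n l (t * s) (fst p) (snd p))"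
    proof (rule measurable_large_tail[OF _ _ a(3)])
      show "(\<lambda>p. fst p (i, c)) \<in> borel_measurable (gauss I \<Otimes>\<^sub>M gauss {..<a})" if "i < n" "c < l" for i c
        by (rule measurable_compose[OF measurable_fst gauss_component_measurable]) (use that in \<open>auto simp: I_def\<close>)
      show "(\<lambda>p. snd p i) \<in> borel_measurable (gauss I \<Otimes>\<^sub>M gauss {..<a})" if "i < a" for i
        by (rule measurable_compose[OF measurable_snd gauss_component_measurable]) (use that in auto)
    qed
    then have [measurable]: "Measurable.pred (gauss I \<Otimes>\<^sub>M gauss {..<a}) (\<lambda>(g, x). large_tail a n l (t * s) g x)"
      by (simp add: case_prod_unfold)
    show ?thesis unfolding indicator_def by measurable
  qed
  have mF: "F \<in> borel_measurable (gauss I)"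
    unfolding F_def using mL
    by (rule sigma_finite_measure.borel_measurable_nn_integral[OF prob_space_imp_sigma_finite[OF prob_space_gauss]])
  have "AE g in distr M (gauss I) X. det (gram a l g) \<noteq> 0"
    unfolding law(2) unfolding I_def using a by (intro gauss_gram_nonsingular) auto
  then have ae: "AE \<omega> in M. det (gram a l (X \<omega>)) \<noteq> 0"
  proof (subst (asm) AE_distr_iff[OF law(1)])
    have "(\<lambda>g. det (gram a l g)) \<in> borel_measurable (gauss I)"
      by (rule borel_measurable_det_gram) (use a in \<open>auto intro!: gauss_component_measurable simp: I_def\<close>)
    then show "{x \<in> space (gauss I). det (gram a l x) \<noteq> 0} \<in> sets (gauss I)" by measurable
  qed
  have "emeasure M E * p = (\<integral>\<^sup>+\<omega>. indicator E \<omega> * p \<partial>M)"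
    using E(1) by (simp add: nn_integral_multc)
  also have "\<dots> \<le> (\<integral>\<^sup>+\<omega>. F (X \<omega>) \<partial>M)"
  proof (rule nn_integral_mono_AE)
    show "AE \<omega> in M. indicator E \<omega> * p \<le> F (X \<omega>)"
      using ae
    proof eventually_elim
      case (elim \<omega>)
      show ?case
      proof (cases "\<omega> \<in> E")
        case True
        then obtain x where "t\<^sup>2 * dot {..<a} x x < tail_energy a n l (X \<omega>) x" using E(2) elim by blast
        then show ?thesis
          using large_tail_random_direction[OF elim _ t s] True unfolding F_def p_def by simp
      qed simp
    qed
  qed
  also have "\<dots> = (\<integral>\<^sup>+g. F g \<partial>distr M (gauss I) X)"
    by (rule nn_integral_distr[symmetric]) (use law mF in auto)
  also have "\<dots> = (\<integral>\<^sup>+g. F g \<partial>gauss I)" unfolding law(2) ..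
  \<comment> \<open>From here on \<open>x\<close> is fixed and the matrix random, the order in which
    rotation invariance applies.\<close>
  also have "\<dots> = (\<integral>\<^sup>+x. \<integral>\<^sup>+g. indicator {x. large_tail a n l (t * s) g x} x \<partial>gauss I \<partial>gauss {..<a})"
    unfolding F_def by (rule Fubini'[symmetric]) (rule mL)
  also have "\<dots> = (\<integral>\<^sup>+x. \<integral>\<^sup>+g. indicator {g. large_tail a n l (t * s) g x} g \<partial>gauss I \<partial>gauss {..<a})"
    by (simp add: indicator_def)
  also have "\<dots> \<le> ennreal ((sqrt (exp 1 / d) / (t * s)) ^ d) *
      (\<integral>\<^sup>+x. ennreal (sqrt (dot {..<a} x x) ^ d) \<partial>gauss {..<a}) *
      (\<integral>\<^sup>+z. ennreal (sqrt (dot {a..<n} z z) ^ d) \<partial>gauss {a..<n})"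
    unfolding I_def by (rule gauss_large_tail) (use a d t s in auto)
  finally show ?thesis unfolding p_def .
qed

text \<open>The previous lemma is used with \<open>s = 1\<close> for \<open>p \<le> 1\<close> and \<open>s = sqrt (p + 1)\<close> otherwise. For
  \<open>p \<ge> 2\<close> the scale is the one for which a Pareto variable with this tail has second moment \<open>C\<^sup>2\<close>.\<close>

lemma operator_norm_tail_constant:
  fixes n l p :: nat
  defines "C \<equiv> (sqrt (real n - real l + real p) + sqrt (real l) + 7) * (4 * exp 1 * sqrt (real l) / (real p + 1))"
  assumes M: "prob_space M"
    and law: "X \<in> measurable M (gauss ({..<n} \<times> {..<l}))" "distr M (gauss ({..<n} \<times> {..<l})) X = gauss ({..<n} \<times> {..<l})"
    and pl: "p < l" "l < n" and t: "t > 0"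
    and E: "E \<in> sets M"
      "\<And>\<omega>. \<omega> \<in> E \<Longrightarrow> det (gram (l - p) l (X \<omega>)) \<noteq> 0 \<Longrightarrow>
        \<exists>x. t\<^sup>2 * dot {..<l - p} x x < tail_energy (l - p) n l (X \<omega>) x"
  shows "emeasure M E \<le> ennreal (((if p \<le> 1 then C / 2 else C * sqrt ((real p - 1) / (real p + 1))) / t) ^ (p + 1))"
proof -
  define a b d where "a = l - p" and "b = n - a" and "d = p + 1"
  have a: "0 < a" "a \<le> l" "a \<le> n" and d: "d = l + 1 - a" "d > 0" and b: "b > 0"
    using pl by (auto simp: a_def d_def b_def)
  have ra: "real a = real l - real p" and rb: "real b = real n - real l + real p" and rd: "real d = real p + 1"
    using pl by (auto simp: a_def b_def d_def)
  define C1 where "C1 = sqrt (real b) + sqrt (real l) + 7"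
  have C: "C = C1 * (4 * exp 1 * sqrt (real l) / real d)"
    unfolding C_def C1_def rb rd ..
  have C1: "C1 > 0" "sqrt (real b + real l) \<le> C1" "sqrt (real b) \<le> C1"
    using sqrt_add_le_add_sqrt[of "real b" "real l"] by (auto simp: C1_def add_nonneg_pos intro: order_trans)
  \<comment> \<open>\<open>q\<close> is a lower bound for the tail probability at \<open>s\<close>,
    and \<open>ma\<close>, \<open>mb\<close> bound the norms of the two Gaussian vectors in the mean
    of order \<open>d\<close>. Everything is collected into one \<open>d\<close>-th power.\<close>
  have main: "emeasure M E * ennreal q \<le> ennreal ((sqrt (exp 1 / d) / (t * s) * ma * mb) ^ d)"
    if "s > 0" "ennreal q \<le> emeasure std_gauss {x. s < \<bar>x\<bar>}" "ma \<ge> 0" "mb \<ge> 0"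
      "(\<integral>\<^sup>+x. ennreal (sqrt (dot {..<a} x x) ^ d) \<partial>gauss {..<a}) \<le> ennreal (ma ^ d)"
      "(\<integral>\<^sup>+x. ennreal (sqrt (dot {a..<n} x x) ^ d) \<partial>gauss {a..<n}) \<le> ennreal (mb ^ d)"
    for s q ma mb
  proof -
    have "emeasure M E * ennreal q \<le> emeasure M E * emeasure std_gauss {x. s < \<bar>x\<bar>}"
      by (intro mult_left_mono that) simp
    also have "\<dots> \<le> ennreal ((sqrt (exp 1 / d) / (t * s)) ^ d) *
      (\<integral>\<^sup>+x. ennreal (sqrt (dot {..<a} x x) ^ d) \<partial>gauss {..<a}) *
      (\<integral>\<^sup>+z. ennreal (sqrt (dot {a..<n} z z) ^ d) \<partial>gauss {a..<n})"
      by (rule operator_norm_tail[OF M law a d(1) t that(1) E(1)]) (use E(2) in \<open>auto simp: a_def\<close>)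
    also have "\<dots> \<le> ennreal ((sqrt (exp 1 / d) / (t * s)) ^ d) * ennreal (ma ^ d) * ennreal (mb ^ d)"
      by (intro mult_mono that) auto
    also have "\<dots> = ennreal ((sqrt (exp 1 / d) / (t * s) * ma * mb) ^ d)"
      using that t by (simp add: power_mult_distrib power_divide flip: ennreal_mult)
    finally show ?thesis .
  qed
  have div: "emeasure M E \<le> ennreal (B ^ d)"
    if q: "emeasure M E * ennreal q \<le> ennreal r" "q > 0" "r \<le> q * B ^ d" "B \<ge> 0" for q r B
  proof -
    have "emeasure M E = emeasure M E * ennreal q * ennreal (1 / q)"
      using q(2) by (simp add: mult.assoc flip: ennreal_mult)
    also have "\<dots> \<le> ennreal (q * B ^ d) * ennreal (1 / q)"
      using q by (intro mult_right_mono) (auto intro: order_trans ennreal_leI)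
    also have "\<dots> = ennreal (B ^ d)"
      using q by (simp flip: ennreal_mult)
    finally show ?thesis .
  qed
  define D where "D = (if p \<le> 1 then C / 2 else C * sqrt ((real p - 1) / (real p + 1)))"
  have Cpos: "C \<ge> 0" unfolding C using C1 by simp
  have Dpos: "D \<ge> 0" unfolding D_def using Cpos by simp
  have se: "sqrt (exp 1) \<ge> (1::real)" by simp
  define r where "r = sqrt (exp (1::real))"
  have r: "r > 0" and er: "exp 1 = r * r" by (auto simp: r_def)
  have "emeasure M E \<le> ennreal ((D / t) ^ d)"
  proof (cases "p \<le> 1")
    case True
    then have d12: "d = 1 \<or> d = 2" by (auto simp: d_def)
    have "emeasure M E * ennreal (1 / (2 * sqrt (exp 1))) \<le> ennreal ((sqrt (exp 1 / d) / (t * 1) * sqrt a * sqrt b) ^ d)"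
    proof (rule main)
      show "ennreal (1 / (2 * sqrt (exp 1))) \<le> emeasure std_gauss {x. 1 < \<bar>x\<bar>}" by (rule std_gauss_tail_one)
      show "(\<integral>\<^sup>+x. ennreal (sqrt (dot {..<a} x x) ^ d) \<partial>gauss {..<a}) \<le> ennreal (sqrt (real a) ^ d)"
        by (rule gauss_norm_low_moment_le) (use a d12 in auto)
      show "(\<integral>\<^sup>+x. ennreal (sqrt (dot {a..<n} x x) ^ d) \<partial>gauss {a..<n}) \<le> ennreal (sqrt (real b) ^ d)"
        by (rule gauss_norm_low_moment_le) (use b d12 in \<open>auto simp: b_def\<close>)
    qed auto
    then show ?thesis
    proof (rule div)
      have ab: "sqrt a * sqrt b \<le> sqrt l * C1"
        using a C1 by (intro mult_mono) auto
      have D: "D = C1 * (2 * exp 1 * sqrt l / d)" unfolding D_def C using True by simp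
      show "(sqrt (exp 1 / d) / (t * 1) * sqrt a * sqrt b) ^ d \<le> 1 / (2 * sqrt (exp 1)) * (D / t) ^ d"
        using d12
      proof
        assume d1: "d = 1"
        \<comment> \<open>For \<open>d = 1\<close> nothing is lost: \<open>sqrt e\<close> from the
          small ball and \<open>2 * sqrt e\<close> from the tail at 1 multiply to the
          \<open>2 * e\<close> in \<open>D\<close>.\<close>
        have "sqrt (exp 1) * (sqrt a * sqrt b) \<le> sqrt (exp 1) * (sqrt l * C1)"
          using ab by (intro mult_left_mono) auto
        also have "\<dots> = 1 / (2 * sqrt (exp 1)) * D"
          unfolding D d1 r_def[symmetric] unfolding er using r by (simp add: field_simps)
        finally have "sqrt (exp 1) * (sqrt a * sqrt b) / t \<le> 1 / (2 * sqrt (exp 1)) * D / t"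
          using t by (intro divide_right_mono) auto
        then show ?thesis using d1 by simp
      next
        assume d2: "d = 2"
        have "(sqrt (exp 1 / 2) * (sqrt a * sqrt b))\<^sup>2 \<le> (sqrt (exp 1 / 2) * (sqrt l * C1))\<^sup>2"
          using ab by (intro power_mono mult_left_mono) auto
        also have "\<dots> = exp 1 / 2 * (sqrt l * C1)\<^sup>2" by (simp add: power_mult_distrib)
        \<comment> \<open>For \<open>d = 2\<close> the tail at 1 is paid only once against a square,
          which leaves a factor \<open>sqrt e\<close> to spare.\<close>
        also have "\<dots> \<le> exp 1 * sqrt (exp 1) / 2 * (sqrt l * C1)\<^sup>2"
          using se by (intro mult_right_mono divide_right_mono) (auto simp: mult_le_cancel_left1)
        also have "\<dots> = 1 / (2 * sqrt (exp 1)) * D\<^sup>2"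
          unfolding D d2 r_def[symmetric] unfolding er using r by (simp add: power2_eq_square field_simps)
        finally have "(sqrt (exp 1 / 2) * (sqrt a * sqrt b))\<^sup>2 / t\<^sup>2 \<le> 1 / (2 * sqrt (exp 1)) * D\<^sup>2 / t\<^sup>2"
          by (intro divide_right_mono) auto
        then show ?thesis using d2 by (simp add: power_mult_distrib power_divide)
      qed
    qed (use Dpos t in auto)
  next
    case False
    then have d3: "d \<ge> 3" by (simp add: d_def)
    have l3: "l \<ge> 3" "d \<le> l" using d3 pl by (auto simp: d_def)
    have "emeasure M E * ennreal ((1 / (2 * sqrt (exp 1))) ^ d) \<le>
      ennreal ((sqrt (exp 1 / d) / (t * sqrt d) * sqrt (real a + real d) * sqrt (real b + real d)) ^ d)"
    proof (rule main)
      show "ennreal ((1 / (2 * sqrt (exp 1))) ^ d) \<le> emeasure std_gauss {x. sqrt d < \<bar>x\<bar>}"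
        using d3 by (rule std_gauss_tail_sqrt)
      show "(\<integral>\<^sup>+x. ennreal (sqrt (dot {..<a} x x) ^ d) \<partial>gauss {..<a}) \<le> ennreal (sqrt (real a + real d) ^ d)"
        by (rule gauss_norm_moment_le) (use a d in auto)
      show "(\<integral>\<^sup>+x. ennreal (sqrt (dot {a..<n} x x) ^ d) \<partial>gauss {a..<n}) \<le> ennreal (sqrt (real b + real d) ^ d)"
        by (rule gauss_norm_moment_le) (use b d in \<open>auto simp: b_def\<close>)
    qed (use d in auto)
    then show ?thesis
    proof (rule div)
      have rad: "real a + real d = real l + 1" using ra rd by simp
      have key: "2 * exp 1 * sqrt ((real l + 1) * (real b + real d)) / d \<le> D"
      proof (rule power2_le_imp_le[OF _ Dpos])
        have f: "(real p - 1) / (real p + 1) \<ge> 1 / 3"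
          using False by (subst pos_le_divide_eq) auto
        \<comment> \<open>The excess over \<open>l * b\<close> is absorbed in two places:
          \<open>d \<le> l\<close> and the summand \<open>sqrt l\<close> of \<open>C1\<close> take
          care of \<open>b + d\<close>, and \<open>l + 1 \<le> 4 / 3 * l\<close> is paid by
          \<open>(p - 1) / (p + 1) \<ge> 1 / 3\<close>.\<close>
        have "(real l + 1) * (real b + real d) \<le> (4 / 3 * real l) * C1\<^sup>2"
        proof (rule mult_mono)
          have "real b + real d \<le> real b + real l" using l3 by simp
          also have "\<dots> = (sqrt (real b + real l))\<^sup>2" by simp
          also have "\<dots> \<le> C1\<^sup>2" using C1(2) by (intro power_mono) auto
          finally show "real b + real d \<le> C1\<^sup>2" .
        qed (use l3 in auto)
        also have "\<dots> \<le> (4 * ((real p - 1) / (real p + 1)) * real l) * C1\<^sup>2"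
        proof (intro mult_right_mono)
          show "4 / 3 \<le> 4 * ((real p - 1) / (real p + 1))" using f by linarith
        qed auto
        finally have "(2 * exp 1 / d)\<^sup>2 * ((real l + 1) * (real b + real d)) \<le>
          (2 * exp 1 / d)\<^sup>2 * ((4 * ((real p - 1) / (real p + 1)) * real l) * C1\<^sup>2)"
          by (rule mult_left_mono) simp
        also have "\<dots> = D\<^sup>2"
        proof -
          define q where "q = (real p - 1) / (real p + 1)"
          have "D\<^sup>2 = C\<^sup>2 * q"
            using False f unfolding D_def q_def[symmetric] by (simp add: power_mult_distrib)
          then show ?thesis
            unfolding C q_def[symmetric] by (simp add: power_mult_distrib power_divide)
        qed
        finally show "(2 * exp 1 * sqrt ((real l + 1) * (real b + real d)) / d)\<^sup>2 \<le> D\<^sup>2"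
          by (simp add: power_mult_distrib power_divide)
      qed
      have "sqrt (exp 1 / d) / (t * sqrt d) * sqrt (real a + real d) * sqrt (real b + real d) =
        1 / (2 * sqrt (exp 1)) * ((2 * exp 1 * sqrt ((real l + 1) * (real b + real d)) / d) / t)"
      proof -
        have alg: "r / sd / (t * sd) * x * y = 1 / (2 * r) * ((2 * (r * r) * (x * y) / (sd * sd)) / t)"
          if "sd > 0" for sd x y
          using that r t by (simp add: field_simps)
        have "sqrt (real d) > 0" using d by simp
        from alg[OF this] show ?thesis
          unfolding rad real_sqrt_divide real_sqrt_mult r_def[symmetric] unfolding er by simp
      qed
      also have "\<dots> \<le> 1 / (2 * sqrt (exp 1)) * (D / t)"
        using key t by (intro mult_left_mono divide_right_mono) auto
      finally have "(sqrt (exp 1 / d) / (t * sqrt d) * sqrt (real a + real d) * sqrt (real b + real d)) ^ d \<le>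
        (1 / (2 * sqrt (exp 1)) * (D / t)) ^ d"
        using t by (intro power_mono) auto
      then show "(sqrt (exp 1 / d) / (t * sqrt d) * sqrt (real a + real d) * sqrt (real b + real d)) ^ d \<le>
        (1 / (2 * sqrt (exp 1))) ^ d * (D / t) ^ d" by (simp only: power_mult_distrib)
    qed (use Dpos t in auto)
  qed
  then show ?thesis unfolding D_def d_def .
qed

section \<open>Comparison with a Pareto variable\<close>

text \<open>Layer cake formula: either side is the integral of its tail over \<open>y > 0\<close>,
  negative values counting as 0.\<close>

lemma nn_integral_le_of_tails_le:
  fixes X :: "'a \<Rightarrow> real" and Y :: "'b \<Rightarrow> real"
  assumes MN: "sigma_finite_measure M" "sigma_finite_measure N"
    and X [measurable]: "X \<in> borel_measurable M" and Y [measurable]: "Y \<in> borel_measurable N"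
    and le: "\<And>y. y > 0 \<Longrightarrow> emeasure N {\<omega> \<in> space N. y \<le> Y \<omega>} \<le> emeasure M {\<omega> \<in> space M. y \<le> X \<omega>}"
  shows "(\<integral>\<^sup>+\<omega>. ennreal (Y \<omega>) \<partial>N) \<le> (\<integral>\<^sup>+\<omega>. ennreal (X \<omega>) \<partial>M)"
proof -
  have layer: "(\<integral>\<^sup>+\<omega>. ennreal (Z \<omega>) \<partial>L) =
    (\<integral>\<^sup>+y. indicator {0<..} y * emeasure L {\<omega> \<in> space L. y \<le> Z \<omega>} \<partial>lborel)"
    if L: "sigma_finite_measure L" and Z [measurable]: "Z \<in> borel_measurable L"
    for L :: "'c measure" and Z :: "'c \<Rightarrow> real"
  proof -
    interpret pair_sigma_finite L lborel
      using L sigma_finite_lborel by (rule pair_sigma_finite.intro)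
    have "(\<integral>\<^sup>+\<omega>. ennreal (Z \<omega>) \<partial>L) = (\<integral>\<^sup>+\<omega>. \<integral>\<^sup>+y. indicator {(\<omega>, y). 0 < y \<and> y \<le> Z \<omega>} (\<omega>, y) \<partial>lborel \<partial>L)"
    proof (rule nn_integral_cong)
      fix \<omega>
      have "(\<integral>\<^sup>+y. indicator {(\<omega>, y). 0 < y \<and> y \<le> Z \<omega>} (\<omega>, y) \<partial>lborel) =
        (\<integral>\<^sup>+y. indicator {0<..Z \<omega>} y \<partial>lborel)"
        by (rule nn_integral_cong) (simp add: indicator_def)
      also have "\<dots> = ennreal (Z \<omega>)"
        by (cases "0 \<le> Z \<omega>") (auto simp: ennreal_neg)
      finally show "ennreal (Z \<omega>) = (\<integral>\<^sup>+y. indicator {(\<omega>, y). 0 < y \<and> y \<le> Z \<omega>} (\<omega>, y) \<partial>lborel)" by simp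
    qed
    also have "\<dots> = (\<integral>\<^sup>+y. \<integral>\<^sup>+\<omega>. indicator {(\<omega>, y). 0 < y \<and> y \<le> Z \<omega>} (\<omega>, y) \<partial>L \<partial>lborel)"
      by (rule Fubini'[symmetric]) (simp add: case_prod_unfold indicator_def)
    also have "\<dots> = (\<integral>\<^sup>+y. indicator {0<..} y * emeasure L {\<omega> \<in> space L. y \<le> Z \<omega>} \<partial>lborel)"
    proof (rule nn_integral_cong)
      fix y :: real
      have "(\<integral>\<^sup>+\<omega>. indicator {(\<omega>, y). 0 < y \<and> y \<le> Z \<omega>} (\<omega>, y) \<partial>L) =
        (\<integral>\<^sup>+\<omega>. indicator {0<..} y * indicator {\<omega> \<in> space L. y \<le> Z \<omega>} \<omega> \<partial>L)"
        by (rule nn_integral_cong) (simp add: indicator_def)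
      then show "(\<integral>\<^sup>+\<omega>. indicator {(\<omega>, y). 0 < y \<and> y \<le> Z \<omega>} (\<omega>, y) \<partial>L) =
        indicator {0<..} y * emeasure L {\<omega> \<in> space L. y \<le> Z \<omega>}"
        by (simp add: nn_integral_cmult)
    qed
    finally show ?thesis .
  qed
  show ?thesis
    unfolding layer[OF MN(1) X] layer[OF MN(2) Y]
    by (intro nn_integral_mono) (auto simp: indicator_def le)
qed

definition pareto :: "real \<Rightarrow> nat \<Rightarrow> real measure" where
  "pareto D d = density lborel (\<lambda>s. ennreal (real d * D ^ d / s ^ (d + 1)) * indicator {D..} s)"

lemma pareto_tail:
  assumes D: "D > 0" and d: "d > 0" and t: "t \<ge> D"
  shows "(\<integral>\<^sup>+s. ennreal (real d * D ^ d / s ^ (d + 1)) * indicator {t..} s \<partial>lborel) = ennreal ((D / t) ^ d)"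
proof -
  have "(\<integral>\<^sup>+s. ennreal (real d * D ^ d / s ^ (d + 1)) * indicator {t..} s \<partial>lborel) = 0 - (- ((D / t) ^ d))"
  proof (rule nn_integral_FTC_atLeast)
    fix x assume "t \<le> x"
    then have x: "x > 0" using D t by simp
    have "((\<lambda>x. - (D ^ d * inverse (x ^ d))) has_real_derivative
      - (D ^ d * - (inverse (x ^ d) * (real d * x ^ (d - 1)) * inverse (x ^ d)))) (at x)"
      using x by (auto intro!: derivative_eq_intros)
    moreover have "- (D ^ d * - (inverse (x ^ d) * (real d * x ^ (d - 1)) * inverse (x ^ d))) = real d * D ^ d / x ^ (d + 1)"
    proof -
      have "x ^ d = x * x ^ (d - 1)" using d by (cases d) auto
      then show ?thesis using x by (simp add: field_simps)
    qed
    moreover have "(\<lambda>x. - (D ^ d * inverse (x ^ d))) = (\<lambda>x. - ((D / x) ^ d))"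
      by (simp add: power_divide flip: divide_inverse)
    ultimately show "((\<lambda>x. - ((D / x) ^ d)) has_real_derivative real d * D ^ d / x ^ (d + 1)) (at x)"
      by (simp only:)
    show "0 \<le> real d * D ^ d / x ^ (d + 1)" using x D by simp
  next
    have "((\<lambda>x. D / x) \<longlongrightarrow> 0) at_top" by real_asymp
    then have "((\<lambda>x. - ((D / x) ^ d)) \<longlongrightarrow> - (0 ^ d)) at_top" by (intro tendsto_intros)
    moreover have "- ((0 :: real) ^ d) = 0" using d by simp
    ultimately show "((\<lambda>x. - ((D / x) ^ d)) \<longlongrightarrow> 0) at_top" by (simp only:)
  qed auto
  then show ?thesis by simp
qed

lemma nn_integral_pareto:
  assumes "f \<in> borel_measurable borel"
  shows "(\<integral>\<^sup>+s. f s \<partial>pareto D d) = (\<integral>\<^sup>+s. ennreal (real d * D ^ d / s ^ (d + 1)) * indicator {D..} s * f s \<partial>lborel)"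
  unfolding pareto_def using assms by (subst nn_integral_density) auto

lemma sets_pareto [measurable_cong]: "sets (pareto D d) = sets borel"
  by (simp add: pareto_def)

lemma space_pareto [simp]: "space (pareto D d) = UNIV"
  by (simp add: pareto_def)

lemma emeasure_pareto_atLeast:
  assumes "D > 0" "d > 0" "t \<ge> D"
  shows "emeasure (pareto D d) {t..} = ennreal ((D / t) ^ d)"
proof -
  have "emeasure (pareto D d) {t..} = (\<integral>\<^sup>+s. ennreal (real d * D ^ d / s ^ (d + 1)) * indicator {D..} s * indicator {t..} s \<partial>lborel)"
    unfolding pareto_def by (subst emeasure_density) auto
  also have "\<dots> = (\<integral>\<^sup>+s. ennreal (real d * D ^ d / s ^ (d + 1)) * indicator {t..} s \<partial>lborel)"
    using assms(3) by (intro nn_integral_cong) (auto simp: indicator_def)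
  finally show ?thesis using pareto_tail[OF assms] by simp
qed

lemma prob_space_pareto:
  assumes "D > 0" "d > 0" shows "prob_space (pareto D d)"
proof
  have "emeasure (pareto D d) UNIV = emeasure (pareto D d) {D..}"
    unfolding pareto_def
    by (subst (1 2) emeasure_density) (auto intro!: nn_integral_cong simp: indicator_def)
  then show "emeasure (pareto D d) (space (pareto D d)) = 1"
    using emeasure_pareto_atLeast[OF assms order_refl] assms by simp
qed

text \<open>The factor by which singular value \<open>j\<close> can drop when the tail map has norm
  at most \<open>t\<close>, with \<open>\<alpha> = \<tau> j ^ (2 * q + 1)\<close>.\<close>

definition damp :: "real \<Rightarrow> real \<Rightarrow> real" where
  "damp \<alpha> t = 1 / sqrt (1 + \<alpha>\<^sup>2 * t\<^sup>2)"

lemma damp_measurable [measurable]: "damp \<alpha> \<in> borel_measurable borel"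
  unfolding damp_def by measurable

lemma damp_pos: "damp \<alpha> t > 0"
  unfolding damp_def by (simp add: add_pos_nonneg)

lemma damp_strict_antimono:
  assumes "\<alpha> > 0" "0 \<le> s" "s < t" shows "damp \<alpha> t < damp \<alpha> s"
proof -
  have "\<alpha>\<^sup>2 * s\<^sup>2 < \<alpha>\<^sup>2 * t\<^sup>2" using assms by (intro mult_strict_left_mono power_strict_mono) auto
  then have "sqrt (1 + \<alpha>\<^sup>2 * s\<^sup>2) < sqrt (1 + \<alpha>\<^sup>2 * t\<^sup>2)" by simp
  moreover have "0 < sqrt (1 + \<alpha>\<^sup>2 * s\<^sup>2)" by (simp add: add_pos_nonneg)
  ultimately show ?thesis unfolding damp_def by (intro divide_strict_left_mono) auto
qed

lemma damp_surj:
  assumes "\<alpha> > 0" "0 < y" "y \<le> 1" shows "\<exists>t\<ge>0. damp \<alpha> t = y"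
proof -
  define t where "t = sqrt (1 / y\<^sup>2 - 1) / \<alpha>"
  have "y\<^sup>2 \<le> 1" using assms by (simp add: power_le_one)
  then have "1 / y\<^sup>2 \<ge> 1" using assms by simp
  then have "\<alpha>\<^sup>2 * t\<^sup>2 = 1 / y\<^sup>2 - 1" using assms by (simp add: t_def power_divide)
  then have "damp \<alpha> t = 1 / sqrt (1 / y\<^sup>2)" unfolding damp_def by simp
  also have "\<dots> = y" using assms by (simp add: real_sqrt_divide)
  finally show ?thesis using \<open>1 / y\<^sup>2 \<ge> 1\<close> assms by (intro exI[of _ t]) (auto simp: t_def)
qed

text \<open>\<open>damp \<alpha>\<close> decreases strictly from 1 to 0, so each level
  \<open>y\<close> in \<open>(0, 1]\<close> is \<open>damp \<alpha> t\<close> for some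
  \<open>t\<close>, and the hypothesis says that \<open>X\<close> dominates the damped Pareto
  variable stochastically.\<close>

lemma expectation_ge_pareto:
  fixes X :: "'w \<Rightarrow> real"
  assumes M: "prob_space M" and X [measurable]: "X \<in> borel_measurable M"
    and \<alpha>: "\<alpha> > 0" and D: "D > 0" and d: "d > 0"
    and tail: "\<And>t. t \<ge> D \<Longrightarrow> emeasure M {\<omega> \<in> space M. X \<omega> < damp \<alpha> t} \<le> ennreal ((D / t) ^ d)"
  shows "(\<integral>\<^sup>+s. ennreal (damp \<alpha> s) \<partial>pareto D d) \<le> (\<integral>\<^sup>+\<omega>. ennreal (X \<omega>) \<partial>M)"
proof (rule nn_integral_le_of_tails_le)
  interpret P: prob_space "pareto D d" using D d by (rule prob_space_pareto)
  interpret M: prob_space M by (rule M)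
  show "sigma_finite_measure M" "sigma_finite_measure (pareto D d)"
    by (simp_all add: M.sigma_finite_measure_axioms P.sigma_finite_measure_axioms)
  fix y :: real assume y: "y > 0"
  have lower: "emeasure (pareto D d) {..<D} = 0"
    unfolding pareto_def
    by (subst emeasure_density) (auto simp: nn_integral_0_iff_AE indicator_def)
  show "emeasure (pareto D d) {s \<in> space (pareto D d). y \<le> damp \<alpha> s} \<le> emeasure M {\<omega> \<in> space M. y \<le> X \<omega>}"
  proof (cases "y \<le> damp \<alpha> D")
    \<comment> \<open>Levels above \<open>damp \<alpha> D\<close> are reached only below the support
      of the Pareto law.\<close>
    case False
    then have "{s \<in> space (pareto D d). y \<le> damp \<alpha> s} \<subseteq> {..<D}"
      using damp_strict_antimono[OF \<alpha>, of D] D by (force simp: not_less le_less)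
    then have "emeasure (pareto D d) {s \<in> space (pareto D d). y \<le> damp \<alpha> s} \<le> emeasure (pareto D d) {..<D}"
      by (rule emeasure_mono) simp
    then show ?thesis using lower by simp
  next
    case True
    have "damp \<alpha> D \<le> 1" unfolding damp_def by (simp add: divide_le_eq add_nonneg_nonneg)
    then obtain t where t: "t \<ge> 0" "damp \<alpha> t = y" using damp_surj[OF \<alpha> y] True by auto
    have tD: "t \<ge> D"
    proof (rule ccontr)
      assume "\<not> ?thesis"
      then have "damp \<alpha> D < damp \<alpha> t" using t by (intro damp_strict_antimono \<alpha>) auto
      then show False using True t by simp
    qed
    have "{s \<in> space (pareto D d). y \<le> damp \<alpha> s} \<subseteq> {..<D} \<union> {D..t}"
      using damp_strict_antimono[OF \<alpha> t(1)] t(2) by (force simp: not_le)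
    then have "emeasure (pareto D d) {s \<in> space (pareto D d). y \<le> damp \<alpha> s} \<le> emeasure (pareto D d) ({..<D} \<union> {D..t})"
      by (rule emeasure_mono) simp
    also have "{..<D} \<union> {D..t} = space (pareto D d) - {t<..}" using tD by auto
    also have "emeasure (pareto D d) \<dots> = 1 - emeasure (pareto D d) {t<..}"
      by (subst emeasure_compl) (auto simp: P.emeasure_space_1[simplified] P.emeasure_finite)
    also have "emeasure (pareto D d) {t<..} = emeasure (pareto D d) {t..}"
      unfolding pareto_def
      by (subst (1 2) emeasure_density, auto intro!: nn_integral_cong_AE)
        (use AE_lborel_singleton[of t] in \<open>auto elim!: eventually_mono simp: indicator_def\<close>)
    also have "\<dots> = ennreal ((D / t) ^ d)" by (rule emeasure_pareto_atLeast) fact+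
    also have "1 - ennreal ((D / t) ^ d) \<le> 1 - emeasure M {\<omega> \<in> space M. X \<omega> < damp \<alpha> t}"
      using tail[OF tD] by (rule ennreal_minus_mono[OF order_refl])
    also have "\<dots> = emeasure M (space M - {\<omega> \<in> space M. X \<omega> < damp \<alpha> t})"
      by (subst emeasure_compl) (auto simp: M.emeasure_space_1)
    also have "space M - {\<omega> \<in> space M. X \<omega> < damp \<alpha> t} = {\<omega> \<in> space M. y \<le> X \<omega>}"
      using t by auto
    finally show ?thesis .
  qed
qed (use X in auto)

section \<open>The expected damping factor under a Pareto law\<close>

lemma nn_integral_pareto_antiderivative:
  assumes D: "D > 0" and f: "f \<in> borel_measurable borel" "\<And>s. f s \<ge> 0"
    and G: "\<And>s. s \<ge> D \<Longrightarrow> (G has_real_derivative real d * D ^ d / s ^ (d + 1) * f s) (at s)"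
    and lim: "(G \<longlongrightarrow> T) at_top"
  shows "(\<integral>\<^sup>+s. ennreal (f s) \<partial>pareto D d) = ennreal (T - G D)"
proof -
  have "(\<integral>\<^sup>+s. ennreal (f s) \<partial>pareto D d) =
    (\<integral>\<^sup>+s. ennreal (real d * D ^ d / s ^ (d + 1) * f s) * indicator {D..} s \<partial>lborel)"
    unfolding nn_integral_pareto[OF measurable_compose[OF f(1) measurable_ennreal]]
    by (rule nn_integral_cong) (use D f in \<open>auto simp: indicator_def ennreal_mult[symmetric]\<close>)
  also have "\<dots> = ennreal (T - G D)"
    by (rule nn_integral_FTC_atLeast) (use D f G lim in auto)
  finally show ?thesis .
qed

text \<open>For shape 1 the integral is explicit: with \<open>x = \<alpha> * D\<close> it equals
  \<open>sqrt (1 + x\<^sup>2) - x\<close>, the reciprocal of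
  \<open>sqrt (1 + x\<^sup>2) + x\<close>, which is at most \<open>1 + 2 * x\<close>. With
  \<open>D = C / 2\<close> this is the bound for \<open>p = 0\<close>.\<close>

lemma pareto_damp_one:
  assumes D: "D > 0" and \<alpha>: "\<alpha> > 0"
  shows "ennreal (1 / (1 + 2 * D * \<alpha>)) \<le> (\<integral>\<^sup>+s. ennreal (damp \<alpha> s) \<partial>pareto D 1)"
proof -
  define G where "G s = - D * sqrt (1 + \<alpha>\<^sup>2 * s\<^sup>2) / s" for s
  define x where "x = \<alpha> * D"
  have x: "x > 0" using D \<alpha> by (simp add: x_def)
  have "(\<integral>\<^sup>+s. ennreal (damp \<alpha> s) \<partial>pareto D 1) = ennreal (- D * \<alpha> - G D)"
  proof (rule nn_integral_pareto_antiderivative[OF D])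
    fix s assume "s \<ge> D"
    then have s: "s > 0" using D by simp
    define r where "r = sqrt (1 + \<alpha>\<^sup>2 * s\<^sup>2)"
    have p: "1 + \<alpha>\<^sup>2 * s\<^sup>2 > 0" by (simp add: add_pos_nonneg)
    then have r: "r > 0" "r\<^sup>2 = 1 + \<alpha>\<^sup>2 * s\<^sup>2" by (auto simp: r_def)
    have d1: "((\<lambda>s. 1 + \<alpha>\<^sup>2 * s\<^sup>2) has_real_derivative \<alpha>\<^sup>2 * (2 * s)) (at s)"
      by (auto intro!: derivative_eq_intros)
    have d2: "((\<lambda>s. sqrt (1 + \<alpha>\<^sup>2 * s\<^sup>2)) has_real_derivative inverse r / 2 * (\<alpha>\<^sup>2 * (2 * s))) (at s)"
      unfolding r_def by (rule DERIV_chain2[OF DERIV_real_sqrt[OF p] d1])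
    have "(G has_real_derivative (- D * (inverse r / 2 * (\<alpha>\<^sup>2 * (2 * s))) * s - - D * r * 1) / (s * s)) (at s)"
      unfolding G_def using DERIV_divide[OF DERIV_cmult[OF d2, of "- D"] DERIV_ident] s
      unfolding r_def[symmetric] by simp
    moreover have "(- D * (inverse r / 2 * (\<alpha>\<^sup>2 * (2 * s))) * s - - D * r * 1) / (s * s) = D / s\<^sup>2 * (1 / r)"
    proof -
      have "(- D * (inverse r / 2 * (A * (2 * s))) * s - - D * r * 1) = D * (r * r - A * (s * s)) / r" for A
        using r(1) by (simp add: field_simps)
      moreover have "r * r - \<alpha>\<^sup>2 * (s * s) = 1" using r(2) by (simp add: power2_eq_square)
      ultimately have "(- D * (inverse r / 2 * (\<alpha>\<^sup>2 * (2 * s))) * s - - D * r * 1) = D / r" by simp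
      then show ?thesis by (simp only:) (simp add: power2_eq_square)
    qed
    ultimately show "(G has_real_derivative real 1 * D ^ 1 / s ^ (1 + 1) * damp \<alpha> s) (at s)"
      by (simp add: damp_def r_def power2_eq_square)
  next
    show "(G \<longlongrightarrow> - D * \<alpha>) at_top"
      unfolding G_def using \<alpha> D by real_asymp
  qed (use damp_pos[of \<alpha>] in \<open>auto simp: less_imp_le\<close>)
  also have "- D * \<alpha> - G D = sqrt (1 + x\<^sup>2) - x"
    using D by (simp add: G_def x_def power_mult_distrib mult.commute)
  finally have int: "(\<integral>\<^sup>+s. ennreal (damp \<alpha> s) \<partial>pareto D 1) = ennreal (sqrt (1 + x\<^sup>2) - x)" .
  have "1 / (1 + 2 * x) \<le> sqrt (1 + x\<^sup>2) - x"
  proof -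
    define r where "r = sqrt (1 + x\<^sup>2)"
    have r: "r > 0" "r\<^sup>2 = 1 + x\<^sup>2" unfolding r_def by (auto simp: add_pos_nonneg)
    have "r \<le> 1 + x" using x unfolding r_def by (intro real_le_lsqrt) (auto simp: power2_sum)
    then have "1 / (1 + 2 * x) \<le> 1 / (r + x)" using r x by (intro divide_left_mono) auto
    also have "(r - x) * (r + x) = 1" using r by (simp add: power2_eq_square algebra_simps)
    then have "1 / (r + x) = r - x" using r x by (simp add: field_simps)
    finally show ?thesis unfolding r_def .
  qed
  moreover have "1 + 2 * D * \<alpha> = 1 + 2 * x" by (simp add: x_def)
  ultimately show ?thesis unfolding int by (simp only: ennreal_leI)
qed

text \<open>The inequality \<open>ln y \<le> (y - 1 / y) / 2\<close> for \<open>y \<ge> 1\<close>,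
  whose two sides agree at 1 and whose difference has derivative
  \<open>(1 - 1 / y)\<^sup>2 / 2\<close>, taken at \<open>y = 1 + 1 / v\<close>.\<close>

lemma ln_one_plus_inverse_le:
  assumes v: "v > (0::real)" shows "v * ln (1 + 1 / v) \<le> 1 - 1 / (2 * (1 + v))"
proof -
  define f where "f u = ((1 + u) - inverse (1 + u)) / 2 - ln (1 + u)" for u :: real
  have "f 0 \<le> f (1 / v)"
  proof (rule DERIV_nonneg_imp_nondecreasing[of 0 "1 / v" f])
    fix u :: real assume u: "0 \<le> u" "u \<le> 1 / v"
    define i where "i = inverse (1 + u)"
    have y: "1 + u > 0" using u by simp
    have 1: "((\<lambda>u. 1 + u) has_real_derivative 1) (at u)" by (auto intro!: derivative_eq_intros)
    have "((\<lambda>u. inverse (1 + u)) has_real_derivative - (i * 1 * i)) (at u)"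
      unfolding i_def by (rule DERIV_inverse'[OF 1]) (use y in simp)
    moreover have "((\<lambda>u. ln (1 + u)) has_real_derivative i) (at u)"
      using DERIV_chain2[OF DERIV_ln[OF y] 1] by (simp add: i_def)
    ultimately have "(f has_real_derivative (1 - - (i * 1 * i)) / 2 - i) (at u)"
      unfolding f_def using 1 by (intro DERIV_diff DERIV_cdivide)
    then have "(f has_real_derivative (1 + i * i) / 2 - i) (at u)" by simp
    moreover have "(1 + i * i) / 2 - i = (1 - i)\<^sup>2 / 2"
      by (simp add: power2_eq_square algebra_simps)
    ultimately show "\<exists>y. DERIV f u :> y \<and> 0 \<le> y" by (intro exI[of _ "(1 - i)\<^sup>2 / 2"]) simp
  qed (use v in simp)
  then have "ln (1 + 1 / v) \<le> ((1 + 1 / v) - inverse (1 + 1 / v)) / 2" by (simp add: f_def)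
  also have "\<dots> = (2 * v + 1) / (2 * v * (1 + v))"
  proof -
    have "1 + 1 / v = (1 + v) / v" using v by (simp add: field_simps)
    then have "(1 + 1 / v) - inverse (1 + 1 / v) = (1 + v) / v - v / (1 + v)" by simp
    also have "\<dots> = (2 * v + 1) / (v * (1 + v))" using v by (simp add: field_simps)
    finally show ?thesis by simp
  qed
  finally have "v * ln (1 + 1 / v) \<le> v * ((2 * v + 1) / (2 * v * (1 + v)))"
    using v by (intro mult_left_mono) auto
  also have "\<dots> = (2 * v + 1) / (2 * (1 + v))" using v by simp
  also have "\<dots> = 1 - 1 / (2 * (1 + v))" using v by (simp add: field_simps)
  finally show ?thesis .
qed

text \<open>By \<open>sqrt (1 + u) \<le> 1 + u / 2\<close> the damping factor is at least the
  rational function \<open>h\<close>, whose Pareto integral is \<open>1 - v * ln (1 + 1 / v)\<close>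
  with \<open>v = C\<^sup>2 * \<alpha>\<^sup>2 / 8\<close>. In terms of \<open>v\<close> the
  logarithmic term of the claim is
  \<open>L = 4 * v * ln (C\<^sup>2 + 1 / \<alpha>\<^sup>2)\<close>.\<close>

lemma pareto_damp_two:
  assumes C: "C\<^sup>2 \<ge> 8" "C > 0" and \<alpha>: "\<alpha> > 0"
  shows "ennreal (1 / (1 + C\<^sup>2 * \<alpha>\<^sup>2 * ln (sqrt (C\<^sup>2 + 1 / \<alpha>\<^sup>2)))) \<le> (\<integral>\<^sup>+s. ennreal (damp \<alpha> s) \<partial>pareto (C / 2) 2)"
proof -
  define D where "D = C / 2"
  have D: "D > 0" using C by (simp add: D_def)
  define v where "v = \<alpha>\<^sup>2 * D\<^sup>2 / 2"
  have v: "v > 0" using D \<alpha> by (simp add: v_def)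
  define h where "h s = 1 / (1 + \<alpha>\<^sup>2 * s\<^sup>2 / 2)" for s
  define c where "c = 2 / \<alpha>\<^sup>2"
  have c: "c > 0" "v * c = D\<^sup>2" using \<alpha> by (auto simp: c_def v_def)
  define G where "G s = - (D\<^sup>2 * inverse (s\<^sup>2)) + v * ln (1 + c * inverse (s\<^sup>2))" for s
  have hpos: "1 + \<alpha>\<^sup>2 * s\<^sup>2 / 2 > 0" for s by (simp add: add_pos_nonneg)
  have h: "0 \<le> h s" "h s \<le> damp \<alpha> s" for s
  proof -
    show "0 \<le> h s" using hpos[of s] by (simp add: h_def)
    have "sqrt (1 + \<alpha>\<^sup>2 * s\<^sup>2) \<le> 1 + \<alpha>\<^sup>2 * s\<^sup>2 / 2"
    proof (rule real_le_lsqrt)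
      have "0 \<le> (\<alpha>\<^sup>2 * s\<^sup>2 / 2)\<^sup>2" by simp
      then show "1 + \<alpha>\<^sup>2 * s\<^sup>2 \<le> (1 + \<alpha>\<^sup>2 * s\<^sup>2 / 2)\<^sup>2"
        unfolding power2_sum[of 1] by simp
    qed (use hpos[of s] in simp)
    moreover have "sqrt (1 + \<alpha>\<^sup>2 * s\<^sup>2) > 0" by (simp add: add_pos_nonneg)
    ultimately show "h s \<le> damp \<alpha> s" unfolding h_def damp_def using hpos[of s]
      by (intro divide_left_mono) auto
  qed
  define z where "z = v * ln (1 + 1 / v)"
  have "(\<integral>\<^sup>+s. ennreal (h s) \<partial>pareto D 2) = ennreal (0 - G D)"
  proof (rule nn_integral_pareto_antiderivative[OF D])
    fix s assume "s \<ge> D"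
    then have s: "s > 0" using D by simp
    define i where "i = inverse (s\<^sup>2)"
    have i: "i > 0" using s by (simp add: i_def)
    have q: "1 + c * inverse (s\<^sup>2) > 0" using s c by (simp add: add_pos_nonneg)
    have d1: "((\<lambda>s. inverse (s\<^sup>2)) has_real_derivative - (i * (2 * s) * i)) (at s)"
      unfolding i_def using DERIV_inverse'[OF DERIV_pow[of 2 s UNIV]] s by simp
    have d2: "((\<lambda>s. 1 + c * inverse (s\<^sup>2)) has_real_derivative c * - (i * (2 * s) * i)) (at s)"
      using DERIV_add[OF DERIV_const[of 1] DERIV_cmult[OF d1, of c]] by simp
    have "((\<lambda>s. ln (1 + c * inverse (s\<^sup>2))) has_real_derivative inverse (1 + c * i) * (c * - (i * (2 * s) * i))) (at s)"
      using DERIV_chain2[OF DERIV_ln[OF q] d2] unfolding i_def .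
    then have "(G has_real_derivative - (D\<^sup>2 * - (i * (2 * s) * i)) + v * (inverse (1 + c * i) * (c * - (i * (2 * s) * i)))) (at s)"
      unfolding G_def using d1 by (intro DERIV_add DERIV_minus DERIV_cmult)
    moreover have "- (D\<^sup>2 * - (i * (2 * s) * i)) + v * (inverse (1 + c * i) * (c * - (i * (2 * s) * i))) =
      real 2 * D ^ 2 / s ^ (2 + 1) * h s"
    proof -
      have "- (D\<^sup>2 * - (i * (2 * s) * i)) + v * (inverse (1 + c * i) * (c * - (i * (2 * s) * i))) =
        2 * i * i * s * (D\<^sup>2 - v * c * inverse (1 + c * i))"
        by (simp add: algebra_simps)
      also have "\<dots> = 2 * i * i * s * D\<^sup>2 * (1 - inverse (1 + c * i))"
        unfolding c(2) by (simp add: algebra_simps)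
      also have "1 - inverse (1 + c * i) = h s"
      proof -
        have "\<alpha>\<^sup>2 * s\<^sup>2 / 2 = inverse (c * i)"
          unfolding c_def i_def inverse_mult_distrib inverse_inverse_eq by simp
        then have "h s = 1 / (1 + inverse (c * i))" unfolding h_def by (simp only:)
        moreover have "1 - inverse (1 + x) = 1 / (1 + inverse x)" if "x > 0" for x :: real
          using that by (simp add: field_simps)
        from this[of "c * i"] have "1 - inverse (1 + c * i) = 1 / (1 + inverse (c * i))" using c i by simp
        ultimately show ?thesis by (simp only:)
      qed
      also have "2 * i * i * s * D\<^sup>2 * h s = real 2 * D ^ 2 / s ^ (2 + 1) * h s"
      proof -
        have "2 * i * i * s = 2 / s ^ 3"
          using s by (simp add: i_def field_simps eval_nat_numeral)
        then show ?thesis by simp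
      qed
      finally show ?thesis .
    qed
    ultimately show "(G has_real_derivative real 2 * D ^ 2 / s ^ (2 + 1) * h s) (at s)" by simp
  next
    show "(G \<longlongrightarrow> 0) at_top"
      unfolding G_def using c D v by real_asymp
  qed (use h in \<open>auto simp: h_def\<close>)
  also have "0 - G D = 1 - z"
  proof -
    have "c * inverse (D\<^sup>2) = 1 / v" using D c v by (simp add: field_simps)
    then show ?thesis using D by (simp add: G_def z_def)
  qed
  finally have int: "ennreal (1 - z) \<le> (\<integral>\<^sup>+s. ennreal (damp \<alpha> s) \<partial>pareto D 2)"
    using nn_integral_mono[of "pareto D 2" "\<lambda>s. ennreal (h s)" "\<lambda>s. ennreal (damp \<alpha> s)"] h
    by (auto intro: ennreal_leI)
  define L where "L = C\<^sup>2 * \<alpha>\<^sup>2 * ln (sqrt (C\<^sup>2 + 1 / \<alpha>\<^sup>2))"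
  have pos: "C\<^sup>2 + 1 / \<alpha>\<^sup>2 > 0" using C \<alpha> by (simp add: add_pos_nonneg)
  have L: "L = 4 * v * ln (C\<^sup>2 + 1 / \<alpha>\<^sup>2)"
    using pos by (simp add: L_def v_def D_def ln_sqrt power2_eq_square)
  have z0: "z \<ge> 0" using v by (simp add: z_def)
  have z1: "1 - z \<ge> 1 / (2 * (1 + v))" using ln_one_plus_inverse_le[OF v] unfolding z_def by simp
  have "1 \<le> C\<^sup>2 + 1 / \<alpha>\<^sup>2" using C by (intro add_increasing2) auto
  then have L0: "L \<ge> 0" unfolding L using v by (intro mult_nonneg_nonneg ln_ge_zero) auto
  \<comment> \<open>For small \<open>v\<close> the claim is rewritten as
    \<open>z \<le> L * (1 - z)\<close>, which follows from \<open>4 * z \<le> L\<close> and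
    \<open>1 - z \<ge> 1 / 4\<close>; here \<open>8 \<le> C\<^sup>2\<close> gives
    \<open>1 / v \<le> 1 / \<alpha>\<^sup>2\<close>. For large \<open>v\<close> the logarithm is at
    least 1, so \<open>1 + L\<close> exceeds \<open>2 * (1 + v)\<close>.\<close>
  have "1 / (1 + L) \<le> 1 - z"
  proof (cases "v \<le> 1")
    case True
    have "1 + 1 / v \<le> C\<^sup>2 + 1 / \<alpha>\<^sup>2"
    proof -
      have "1 / v = 8 / C\<^sup>2 * (1 / \<alpha>\<^sup>2)" using C \<alpha> by (simp add: v_def D_def field_simps)
      also have "\<dots> \<le> 1 * (1 / \<alpha>\<^sup>2)" using C by (intro mult_right_mono) auto
      finally show ?thesis using C by simp
    qed
    then have "ln (1 + 1 / v) \<le> ln (C\<^sup>2 + 1 / \<alpha>\<^sup>2)" using v by (subst ln_le_cancel_iff) (auto simp: add_pos_pos pos)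
    then have "4 * v * ln (1 + 1 / v) \<le> L" unfolding L using v by (intro mult_left_mono) auto
    then have Lz: "4 * z \<le> L" by (simp add: z_def mult.assoc)
    have "1 / 4 \<le> 1 / (2 * (1 + v))" using True v by (intro divide_left_mono) auto
    then have z4: "1 / 4 \<le> 1 - z" using z1 by linarith
    then have "z \<le> L * (1 - z)" using mult_mono[OF Lz z4] z0 L0 by simp
    then have "1 \<le> (1 - z) * (1 + L)" by (simp add: algebra_simps)
    then show ?thesis using L0 by (subst pos_divide_le_eq) auto
  next
    case False
    have "exp 1 \<le> (3::real)" by (rule exp_le)
    then have "exp 1 \<le> C\<^sup>2 + 1 / \<alpha>\<^sup>2" using C \<alpha> by (intro add_increasing2) auto
    then have "1 \<le> ln (C\<^sup>2 + 1 / \<alpha>\<^sup>2)" using pos by (subst ln_ge_iff) auto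
    then have "4 * v * 1 \<le> L" unfolding L using v by (intro mult_left_mono) auto
    then have "2 * (1 + v) \<le> 1 + L" using False by simp
    then have "1 / (1 + L) \<le> 1 / (2 * (1 + v))" using v L0 by (intro divide_left_mono) auto
    then show ?thesis using z1 by linarith
  qed
  then have "ennreal (1 / (1 + L)) \<le> ennreal (1 - z)" by (rule ennreal_leI)
  then show ?thesis using int unfolding L_def D_def by (rule order_trans)
qed

text \<open>The tangent line at \<open>C\<^sup>2\<close> of \<open>w \<mapsto> 1 / sqrt (1 + \<alpha>\<^sup>2 w)\<close>, which is Jensen's inequality
  once the second moment is \<open>C\<^sup>2\<close>.\<close>

lemma damp_ge_tangent:
  assumes "\<alpha> > 0"
  shows "damp \<alpha> c + \<alpha>\<^sup>2 / 2 * damp \<alpha> c ^ 3 * c\<^sup>2 \<le> damp \<alpha> s + \<alpha>\<^sup>2 / 2 * damp \<alpha> c ^ 3 * s\<^sup>2"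
proof -
  define x where "x = damp \<alpha> c"
  define y where "y = damp \<alpha> s"
  have p: "1 + \<alpha>\<^sup>2 * t\<^sup>2 > 0" for t by (simp add: add_pos_nonneg)
  have xy: "x > 0" "y > 0" using damp_pos by (auto simp: x_def y_def)
  have sq: "\<alpha>\<^sup>2 * t\<^sup>2 = 1 / (damp \<alpha> t)\<^sup>2 - 1" for t
    using p[of t] by (simp add: damp_def power_divide)
  \<comment> \<open>In the variables \<open>x\<close> and \<open>y\<close> the difference of the two
    sides is a rational function with the double zero \<open>y = x\<close> of a tangent.\<close>
  have "x + 1 / 2 * x ^ 3 * (1 / x\<^sup>2 - 1) \<le> y + 1 / 2 * x ^ 3 * (1 / y\<^sup>2 - 1)"
  proof -
    have "y + 1 / 2 * x ^ 3 * (1 / y\<^sup>2 - 1) - (x + 1 / 2 * x ^ 3 * (1 / x\<^sup>2 - 1)) =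
      (y - x)\<^sup>2 * (2 * y + x) / (2 * y\<^sup>2)"
      using xy by (simp add: field_simps power2_eq_square power3_eq_cube)
    also have "\<dots> \<ge> 0" using xy by simp
    finally show ?thesis by simp
  qed
  then show ?thesis unfolding x_def y_def sq[symmetric] by (simp add: mult_ac)
qed

lemma pareto_second_moment:
  assumes D: "D > 0" and d: "d \<ge> 3"
  shows "(\<integral>\<^sup>+s. ennreal (s\<^sup>2) \<partial>pareto D d) = ennreal (D\<^sup>2 * real d / (real d - 2))"
proof -
  \<comment> \<open>The antiderivative is a multiple of \<open>s\<close> to the power
    \<open>- (d - 2)\<close>, written with exponent \<open>k + 1\<close> to avoid natural
    subtraction.\<close>
  obtain k where k: "d = k + 3" using d by (metis add.commute le_Suc_ex)
  define G where "G s = - (real d * D ^ d / real (k + 1)) * inverse (s ^ (k + 1))" for s :: real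
  have "(\<integral>\<^sup>+s. ennreal (s\<^sup>2) \<partial>pareto D d) = ennreal (0 - G D)"
  proof (rule nn_integral_pareto_antiderivative[OF D])
    fix s assume "s \<ge> D"
    then have s: "s > 0" using D by simp
    have "((\<lambda>s. s ^ (k + 1)) has_real_derivative real (k + 1) * s ^ k) (at s)"
      using DERIV_pow[of "k + 1" s UNIV] by simp
    then have "(G has_real_derivative - (real d * D ^ d / real (k + 1)) *
        - (inverse (s ^ (k + 1)) * (real (k + 1) * s ^ k) * inverse (s ^ (k + 1)))) (at s)"
      unfolding G_def using s by (intro DERIV_cmult DERIV_inverse') auto
    moreover have "- (real d * D ^ d / real (k + 1)) *
        - (inverse (s ^ (k + 1)) * (real (k + 1) * s ^ k) * inverse (s ^ (k + 1))) =
      real d * D ^ d / s ^ (d + 1) * s\<^sup>2"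
    proof -
      have eq: "inverse (s ^ (k + 1)) * s ^ k * inverse (s ^ (k + 1)) = s\<^sup>2 / s ^ (d + 1)"
        using s by (simp add: k field_simps eval_nat_numeral)
      have gen: "- (A / B) * - (i * (B * x) * i) = A * (i * x * i)" if "B \<noteq> 0" for A B i x :: real
        using that by simp
      have "- (real d * D ^ d / real (k + 1)) *
          - (inverse (s ^ (k + 1)) * (real (k + 1) * s ^ k) * inverse (s ^ (k + 1))) =
        real d * D ^ d * (inverse (s ^ (k + 1)) * s ^ k * inverse (s ^ (k + 1)))"
        by (rule gen) simp
      also have "\<dots> = real d * D ^ d * (s\<^sup>2 / s ^ (d + 1))" by (simp only: eq)
      finally show ?thesis by simp
    qed
    ultimately show "(G has_real_derivative real d * D ^ d / s ^ (d + 1) * s\<^sup>2) (at s)" by simp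
  next
    have "((\<lambda>s::real. inverse (s ^ (k + 1))) \<longlongrightarrow> 0) at_top"
      by (intro tendsto_inverse_0_at_top filterlim_pow_at_top filterlim_ident) simp
    then show "(G \<longlongrightarrow> 0) at_top" unfolding G_def by (rule tendsto_mult_right_zero)
  qed auto
  also have "0 - G D = D\<^sup>2 * real d / (real d - 2)"
  proof -
    have "D ^ d = D\<^sup>2 * D ^ (k + 1)" by (simp add: k power2_eq_square eval_nat_numeral)
    then have "0 - G D = real d * (D\<^sup>2 * D ^ (k + 1)) / real (k + 1) * inverse (D ^ (k + 1))"
      by (simp add: G_def)
    also have "\<dots> = D\<^sup>2 * real d / real (k + 1)"
      using D by (simp del: power_Suc add: field_simps)
    also have "real (k + 1) = real d - 2" by (simp add: k)
    finally show ?thesis .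
  qed
  finally show ?thesis .
qed

text \<open>The scale is chosen so that the second moment
  \<open>D\<^sup>2 * (p + 1) / (p - 1)\<close> is exactly \<open>C\<^sup>2\<close>. Integrating the
  tangent inequality then leaves the same term \<open>\<kappa> * C\<^sup>2\<close> on both sides,
  where it is finite and cancels.\<close>

lemma pareto_damp_large:
  assumes C: "C > 0" and \<alpha>: "\<alpha> > 0" and p: "p \<ge> 2"
  shows "ennreal (damp \<alpha> C) \<le> (\<integral>\<^sup>+s. ennreal (damp \<alpha> s) \<partial>pareto (C * sqrt ((real p - 1) / (real p + 1))) (p + 1))"
proof -
  define D where "D = C * sqrt ((real p - 1) / (real p + 1))"
  have D: "D > 0" using C p by (simp add: D_def)
  interpret P: prob_space "pareto D (p + 1)" using D by (intro prob_space_pareto) auto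
  define \<kappa> where "\<kappa> = \<alpha>\<^sup>2 / 2 * damp \<alpha> C ^ 3"
  have \<kappa>: "\<kappa> \<ge> 0" unfolding \<kappa>_def using damp_pos[of \<alpha> C] by simp
  have "D\<^sup>2 * real (p + 1) / (real (p + 1) - 2) = C\<^sup>2"
  proof -
    have "D\<^sup>2 = C\<^sup>2 * ((real p - 1) / (real p + 1))"
      using p by (simp add: D_def power_mult_distrib)
    moreover have "C\<^sup>2 * (x / y) * y / x = C\<^sup>2" if "x > 0" "y > 0" for x y
      using that by simp
    from this[of "real p - 1" "real p + 1"] have "C\<^sup>2 * ((real p - 1) / (real p + 1)) * (real p + 1) / (real p - 1) = C\<^sup>2"
      using p by simp
    moreover have "real (p + 1) = real p + 1" "real (p + 1) - 2 = real p - 1" by simp_all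
    ultimately show ?thesis by (simp only:)
  qed
  then have mom: "(\<integral>\<^sup>+s. ennreal (s\<^sup>2) \<partial>pareto D (p + 1)) = ennreal (C\<^sup>2)"
    using pareto_second_moment[OF D, of "p + 1"] p by simp
  have "ennreal (damp \<alpha> C + \<kappa> * C\<^sup>2) = (\<integral>\<^sup>+s. ennreal (damp \<alpha> C + \<kappa> * C\<^sup>2) \<partial>pareto D (p + 1))"
    by (simp add: P.emeasure_space_1[simplified])
  also have "\<dots> \<le> (\<integral>\<^sup>+s. ennreal (damp \<alpha> s) + ennreal \<kappa> * ennreal (s\<^sup>2) \<partial>pareto D (p + 1))"
  proof (rule nn_integral_mono)
    fix s
    have "damp \<alpha> C + \<kappa> * C\<^sup>2 \<le> damp \<alpha> s + \<kappa> * s\<^sup>2"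
      unfolding \<kappa>_def by (rule damp_ge_tangent[OF \<alpha>])
    then show "ennreal (damp \<alpha> C + \<kappa> * C\<^sup>2) \<le> ennreal (damp \<alpha> s) + ennreal \<kappa> * ennreal (s\<^sup>2)"
      using \<kappa> damp_pos[of \<alpha> s] by (simp add: ennreal_leI flip: ennreal_mult ennreal_plus)
  qed
  also have "\<dots> = (\<integral>\<^sup>+s. ennreal (damp \<alpha> s) \<partial>pareto D (p + 1)) + ennreal \<kappa> * ennreal (C\<^sup>2)"
    using mom by (subst nn_integral_add) (auto simp: nn_integral_cmult)
  also have "ennreal (damp \<alpha> C + \<kappa> * C\<^sup>2) = ennreal (damp \<alpha> C) + ennreal \<kappa> * ennreal (C\<^sup>2)"
    using \<kappa> damp_pos[of \<alpha> C] by (simp flip: ennreal_mult ennreal_plus)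
  finally have "ennreal \<kappa> * ennreal (C\<^sup>2) + ennreal (damp \<alpha> C) \<le>
    ennreal \<kappa> * ennreal (C\<^sup>2) + (\<integral>\<^sup>+s. ennreal (damp \<alpha> s) \<partial>pareto D (p + 1))"
    by (simp only: add.commute)
  then show ?thesis
    unfolding D_def[symmetric] ennreal_add_left_cancel_le by (auto simp: ennreal_mult_eq_top_iff)
qed

section \<open>Singular values of the computed approximation\<close>

lemma orthonormal_cols_preserve_scalar_prod:
  assumes Q: "Q \<in> carrier_mat m r" "orthonormal_cols Q" and z: "z \<in> carrier_vec r" "z' \<in> carrier_vec r"
  shows "(Q *\<^sub>v z) \<bullet> (Q *\<^sub>v z') = z \<bullet> z'"
proof -
  have "(Q *\<^sub>v z) \<bullet> (Q *\<^sub>v z') = (Q *\<^sub>v z') \<bullet> (Q *\<^sub>v z)"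
    by (rule comm_scalar_prod[of _ m]) (use Q z in auto)
  also have "\<dots> = (Q\<^sup>T *\<^sub>v (Q *\<^sub>v z')) \<bullet> z"
    by (rule transpose_vec_mult_scalar[OF Q(1) z(1), symmetric]) (use Q z in auto)
  also have "Q\<^sup>T *\<^sub>v (Q *\<^sub>v z') = (Q\<^sup>T * Q) *\<^sub>v z'"
    by (rule assoc_mult_mat_vec[symmetric]) (use Q z in auto)
  also have "Q\<^sup>T * Q = 1\<^sub>m r" using Q unfolding orthonormal_cols_def by auto
  finally show ?thesis using z comm_scalar_prod[of z r z'] by simp
qed

lemma orthonormal_cols_square:
  assumes "V \<in> carrier_mat n n" "orthonormal_cols V"
  shows "V * V\<^sup>T = 1\<^sub>m n" "orthonormal_cols (V\<^sup>T)"
proof -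
  show "V * V\<^sup>T = 1\<^sub>m n"
    using assms mat_mult_left_right_inverse[of "V\<^sup>T" n V] unfolding orthonormal_cols_def by auto
  then show "orthonormal_cols (V\<^sup>T)" using assms unfolding orthonormal_cols_def by auto
qed

lemma singular_value_cong:
  "X\<^sup>T * X = X'\<^sup>T * X' \<Longrightarrow> singular_value X j = singular_value X' j"
  unfolding singular_value_def singular_values_def by simp

text \<open>Singular values depend on \<open>X\<^sup>T * X\<close> only, and
  \<open>D * V\<^sup>T\<close> has the same Gram matrix and an obvious SVD. So left singular vectors
  of \<open>X\<close> need not be constructed.\<close>

lemma singular_value_of_gram_diagonalization:
  assumes V: "V \<in> carrier_mat n n" "orthonormal_cols V"
    and X: "X\<^sup>T * X = V * mat n n (\<lambda>(i, i'). if i = i' then (d i)\<^sup>2 else 0) * V\<^sup>T"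
    and d: "\<And>i. i < n \<Longrightarrow> 0 \<le> d i" "\<And>i i'. i \<le> i' \<Longrightarrow> i' < n \<Longrightarrow> d i' \<le> d i"
    and j: "1 \<le> j" "j \<le> n"
  shows "singular_value X j = d (j - 1)"
proof -
  define D where "D = mat n n (\<lambda>(i, i'). if i = i' then d i else 0)"
  define X' where "X' = D * V\<^sup>T"
  have D: "D \<in> carrier_mat n n" "D\<^sup>T = D" by (auto simp: D_def)
  have X': "X' \<in> carrier_mat n n" using D V by (auto simp: X'_def)
  have "X'\<^sup>T = V * D"
    unfolding X'_def using transpose_mult[of D n n "V\<^sup>T" n] D V by simp
  then have "X'\<^sup>T * X' = V * (D * D) * V\<^sup>T"
    unfolding X'_def using D(1) V(1) by (simp add: assoc_mult_mat[of _ n n _ n _ n])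
  also have "D * D = mat n n (\<lambda>(i, i'). if i = i' then (d i)\<^sup>2 else 0)"
    unfolding D_def
    by (intro eq_matI) (auto simp: scalar_prod_def if_distrib power2_eq_square cong: if_cong)
  finally have "singular_value X j = singular_value X' j" using X by (intro singular_value_cong) simp
  also have "\<dots> = D $$ (j - 1, j - 1)"
  proof (rule singular_value_eq_svd_diagonal)
    have "X' = 1\<^sub>m n * D * V\<^sup>T" using D by (simp add: X'_def)
    then show "is_svd X' (1\<^sub>m n) D V"
      using X' D V d unfolding is_svd_def by (auto simp: orthonormal_cols_def diagonal_mat_def D_def)
  qed (use j X' in auto)
  finally show ?thesis using j by (simp add: D_def)
qed

text \<open>\<open>Q\<close> and \<open>U\<close> drop out of \<open>X\<^sup>T * X\<close>, and the
  truncation does not touch the first \<open>k\<close> values. The value 0 belongs to the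
  exceptional case in which \<open>Q\<close> has fewer than \<open>j\<close> columns.\<close>

lemma is_svd_truncated_singular_value:
  assumes svd: "is_svd B U S V" and B: "B \<in> carrier_mat r n"
    and Q: "Q \<in> carrier_mat m r" "orthonormal_cols Q"
    and X: "X = Q * (U * mat r n (\<lambda>(i, j). if i < k then S $$ (i, j) else 0) * V\<^sup>T)"
    and j: "1 \<le> j" "j \<le> k" "j \<le> n"
  shows "singular_value X j = (if j - 1 < r then S $$ (j - 1, j - 1) else 0)"
proof -
  define Sk where "Sk = mat r n (\<lambda>(i, j). if i < k then S $$ (i, j) else 0)"
  define d where "d i = (if i < r \<and> i < k then S $$ (i, i) else 0)" for i
  note svd' = svd[unfolded is_svd_def]
  have c: "U \<in> carrier_mat r r" "V \<in> carrier_mat n n" "S \<in> carrier_mat r n" and o: "orthonormal_cols U" "orthonormal_cols V"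
    and diag: "diagonal_mat S"
    and nn: "\<And>i. i < r \<Longrightarrow> i < n \<Longrightarrow> 0 \<le> S $$ (i, i)"
    and dec: "\<And>i i'. i \<le> i' \<Longrightarrow> i' < r \<Longrightarrow> i' < n \<Longrightarrow> S $$ (i', i') \<le> S $$ (i, i)"
    using svd' B by auto
  have Sk: "Sk \<in> carrier_mat r n" by (simp add: Sk_def)
  have UU: "U\<^sup>T * U = 1\<^sub>m r" and QQ: "Q\<^sup>T * Q = 1\<^sub>m r"
    using o(1) c(1) Q unfolding orthonormal_cols_def by auto
  have "X = Q * (U * (Sk * V\<^sup>T))" unfolding X Sk_def[symmetric] using c Sk by simp
  then have "X\<^sup>T * X = (U * (Sk * V\<^sup>T))\<^sup>T * (Q\<^sup>T * Q) * (U * (Sk * V\<^sup>T))"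
    using transpose_mult[OF Q(1), of "U * (Sk * V\<^sup>T)" n] Q(1) c Sk
    by (simp add: assoc_mult_mat[of _ n r _ m _ n] assoc_mult_mat[of _ r m _ r _ n] assoc_mult_mat[of _ n r _ r _ n])
  also have "\<dots> = (U * (Sk * V\<^sup>T))\<^sup>T * (U * (Sk * V\<^sup>T))" unfolding QQ using c Sk by simp
  also have "\<dots> = (Sk * V\<^sup>T)\<^sup>T * (U\<^sup>T * U) * (Sk * V\<^sup>T)"
    using transpose_mult[OF c(1), of "Sk * V\<^sup>T" n] c Sk
    by (simp add: assoc_mult_mat[of _ n r _ r _ n] assoc_mult_mat[of _ r r _ r _ n])
  also have "\<dots> = (Sk * V\<^sup>T)\<^sup>T * (Sk * V\<^sup>T)" unfolding UU using c Sk by simp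
  also have "\<dots> = V * (Sk\<^sup>T * Sk) * V\<^sup>T"
    using transpose_mult[OF Sk, of "V\<^sup>T" n] c Sk
    by (simp add: assoc_mult_mat[of _ n n _ r _ n] assoc_mult_mat[of _ n r _ n _ n] assoc_mult_mat[of _ n n _ n _ n])
  also have "Sk\<^sup>T * Sk = mat n n (\<lambda>(i, i'). if i = i' then (d i)\<^sup>2 else 0)"
  proof (intro eq_matI)
    fix i i' assume "i < dim_row (mat n n (\<lambda>(i, i'). if i = i' then (d i)\<^sup>2 else 0))"
      "i' < dim_col (mat n n (\<lambda>(i, i'). if i = i' then (d i)\<^sup>2 else 0))"
    then have i: "i < n" "i' < n" by auto
    have "(Sk\<^sup>T * Sk) $$ (i, i') = (\<Sum>t\<in>{0..<r}. Sk $$ (t, i) * Sk $$ (t, i'))"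
      using i Sk by (simp add: scalar_prod_def)
    also have "\<dots> = (\<Sum>t\<in>{0..<r}. if t = i then (if i = i' then (d i)\<^sup>2 else 0) else 0)"
      using i diag c(3) unfolding diagonal_mat_def Sk_def d_def
      by (intro sum.cong) (auto simp: power2_eq_square)
    also have "\<dots> = (if i = i' then (d i)\<^sup>2 else 0)" by (auto simp: d_def)
    finally show "(Sk\<^sup>T * Sk) $$ (i, i') = mat n n (\<lambda>(i, i'). if i = i' then (d i)\<^sup>2 else 0) $$ (i, i')"
      using i by simp
  qed (use Sk in auto)
  finally have "singular_value X j = d (j - 1)"
    by (rule singular_value_of_gram_diagonalization[OF c(2) o(2)]) (use j nn dec in \<open>auto simp: d_def\<close>)
  then show ?thesis using j by (auto simp: d_def)
qed

text \<open>The Courant--Fischer maximum over subspaces of the column space of \<open>Y\<close>, a subspace being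
  given by its preimage under \<open>Y\<close>: this does not mention \<open>Q\<close> or an SVD.\<close>

lemma truncated_singular_value_gt_iff:
  fixes A Y Q X :: "real mat"
  assumes A: "A \<in> carrier_mat m n" and Y: "Y \<in> carrier_mat m l"
    and Q: "orthonormal_basis_of_col_space Q Y"
    and Bk: "is_truncated_svd k (Q\<^sup>T * A) Bk" and X: "X = Q * Bk"
    and j: "1 \<le> j" "j \<le> k" "j \<le> n" and c: "0 \<le> c"
  shows "0 \<le> singular_value X j"
    "c < singular_value X j \<longleftrightarrow> (\<exists>W \<in> carrier_mat l j. \<forall>u \<in> carrier_vec j. u \<noteq> 0\<^sub>v j \<longrightarrow>
      c\<^sup>2 * ((Y *\<^sub>v (W *\<^sub>v u)) \<bullet> (Y *\<^sub>v (W *\<^sub>v u))) <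
      (A\<^sup>T *\<^sub>v (Y *\<^sub>v (W *\<^sub>v u))) \<bullet> (A\<^sup>T *\<^sub>v (Y *\<^sub>v (W *\<^sub>v u))))"
    (is "_ \<longleftrightarrow> ?R")
proof -
  define r where "r = dim_col Q"
  have Qc: "Q \<in> carrier_mat m r" "orthonormal_cols Q"
    using Q Y unfolding orthonormal_basis_of_col_space_def r_def by auto
  define B where "B = Q\<^sup>T * A"
  have B: "B \<in> carrier_mat r n" using Qc A by (auto simp: B_def)
  obtain U S V where svd: "is_svd B U S V"
    and Bk': "Bk = U * mat r n (\<lambda>(i, j). if i < k then S $$ (i, j) else 0) * V\<^sup>T"
    using Bk B unfolding is_truncated_svd_def B_def[symmetric] by auto
  define s where "s = (if j - 1 < r then S $$ (j - 1, j - 1) else 0)"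
  have sv: "singular_value X j = s"
    unfolding s_def by (rule is_svd_truncated_singular_value[OF svd B Qc]) (use X Bk' j in auto)
  note svd' = svd[unfolded is_svd_def]
  have cr: "U \<in> carrier_mat r r" "V \<in> carrier_mat n n" "S \<in> carrier_mat r n" and o: "orthonormal_cols U" "orthonormal_cols V"
    and diag: "diagonal_mat S"
    and nn: "\<And>i. i < r \<Longrightarrow> i < n \<Longrightarrow> 0 \<le> S $$ (i, i)"
    and dec: "\<And>i i'. i \<le> i' \<Longrightarrow> i' < r \<Longrightarrow> i' < n \<Longrightarrow> S $$ (i', i') \<le> S $$ (i, i)"
    and BU: "B = U * S * V\<^sup>T"
    using svd' B by auto
  have s0: "0 \<le> s" using nn[of "j - 1"] j by (auto simp: s_def)
  then show "0 \<le> singular_value X j" by (simp add: sv)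
  have UT: "U\<^sup>T \<in> carrier_mat r r" "U * U\<^sup>T = 1\<^sub>m r" "orthonormal_cols (U\<^sup>T)"
    using orthonormal_cols_square[OF cr(1) o(1)] cr by auto
  have space: "{y \<in> carrier_vec m. \<exists>x\<in>carrier_vec r. Q *\<^sub>v x = y} = {y \<in> carrier_vec m. \<exists>x\<in>carrier_vec l. Y *\<^sub>v x = y}"
  proof -
    interpret vec_space "TYPE(real)" m .
    have "col_space Q = col_space Y"
      using Q Y unfolding orthonormal_basis_of_col_space_def by auto
    then show ?thesis using col_space_eq[OF Qc(1)] col_space_eq[OF Y] Qc Y by auto
  qed
  have energy: "(A\<^sup>T *\<^sub>v (Q *\<^sub>v z)) \<bullet> (A\<^sup>T *\<^sub>v (Q *\<^sub>v z)) =
      (\<Sum>i<n. if i < r then (S $$ (i, i) * (U\<^sup>T *\<^sub>v z) $ i)\<^sup>2 else 0)" if z: "z \<in> carrier_vec r" for z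
  proof -
    define x where "x = U\<^sup>T *\<^sub>v z"
    have x: "x \<in> carrier_vec r" using z UT by (auto simp: x_def)
    have BT: "B\<^sup>T = V * (S\<^sup>T * U\<^sup>T)"
    proof -
      have "B\<^sup>T = (V\<^sup>T)\<^sup>T * (U * S)\<^sup>T" unfolding BU by (rule transpose_mult) (use cr in auto)
      also have "(U * S)\<^sup>T = S\<^sup>T * U\<^sup>T" by (rule transpose_mult) (use cr in auto)
      finally show ?thesis by simp
    qed
    have "A\<^sup>T *\<^sub>v (Q *\<^sub>v z) = (A\<^sup>T * Q) *\<^sub>v z"
      by (rule assoc_mult_mat_vec[symmetric]) (use A Qc z in auto)
    also have "A\<^sup>T * Q = B\<^sup>T" unfolding B_def using transpose_mult[of "Q\<^sup>T" r m A n] A Qc by simp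
    also have "B\<^sup>T *\<^sub>v z = V *\<^sub>v (S\<^sup>T *\<^sub>v x)"
      unfolding BT x_def using cr UT z
      by (subst assoc_mult_mat_vec[of _ n n _ r]) (auto simp: assoc_mult_mat_vec[of "S\<^sup>T" n r "U\<^sup>T" r])
    finally have e: "A\<^sup>T *\<^sub>v (Q *\<^sub>v z) = V *\<^sub>v (S\<^sup>T *\<^sub>v x)" .
    have "(A\<^sup>T *\<^sub>v (Q *\<^sub>v z)) \<bullet> (A\<^sup>T *\<^sub>v (Q *\<^sub>v z)) = (S\<^sup>T *\<^sub>v x) \<bullet> (S\<^sup>T *\<^sub>v x)"
      unfolding e by (rule orthonormal_cols_preserve_scalar_prod[OF cr(2) o(2)]) (use cr x in auto)
    also have "\<dots> = (\<Sum>i<n. ((S\<^sup>T *\<^sub>v x) $ i)\<^sup>2)"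
      using cr x by (simp add: scalar_prod_def power2_eq_square atLeast0LessThan)
    also have "\<dots> = (\<Sum>i<n. if i < r then (S $$ (i, i) * x $ i)\<^sup>2 else 0)"
    proof (rule sum.cong[OF refl])
      fix i assume i: "i \<in> {..<n}"
      have "(S\<^sup>T *\<^sub>v x) $ i = (\<Sum>t\<in>{0..<r}. S $$ (t, i) * x $ t)"
        using i cr x by (simp add: scalar_prod_def)
      also have "\<dots> = (\<Sum>t\<in>{0..<r}. if t = i then S $$ (i, i) * x $ i else 0)"
        using i diag cr unfolding diagonal_mat_def by (intro sum.cong) auto
      finally show "((S\<^sup>T *\<^sub>v x) $ i)\<^sup>2 = (if i < r then (S $$ (i, i) * x $ i)\<^sup>2 else 0)" by simp
    qed
    finally show ?thesis unfolding x_def .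
  qed
  have normQ: "(Q *\<^sub>v z) \<bullet> (Q *\<^sub>v z) = (\<Sum>i<r. ((U\<^sup>T *\<^sub>v z) $ i)\<^sup>2)" if z: "z \<in> carrier_vec r" for z
  proof -
    have "(Q *\<^sub>v z) \<bullet> (Q *\<^sub>v z) = z \<bullet> z"
      by (rule orthonormal_cols_preserve_scalar_prod[OF Qc z z])
    also have "\<dots> = (U\<^sup>T *\<^sub>v z) \<bullet> (U\<^sup>T *\<^sub>v z)"
      by (rule orthonormal_cols_preserve_scalar_prod[OF UT(1,3) z z, symmetric])
    also have "\<dots> = (\<Sum>i<r. ((U\<^sup>T *\<^sub>v z) $ i)\<^sup>2)"
      using UT z by (simp add: scalar_prod_def power2_eq_square atLeast0LessThan)
    finally show ?thesis .
  qed
  show "c < singular_value X j \<longleftrightarrow> ?R"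
    unfolding sv
  proof
    assume cs: "c < s"
    then have jr: "j - 1 < r" using c by (auto simp: s_def split: if_splits)
    then have sS: "s = S $$ (j - 1, j - 1)" by (simp add: s_def)
    \<comment> \<open>The first \<open>j\<close> columns of \<open>Q * U\<close> lie in the column
      space of \<open>Y\<close>; their preimages under \<open>Y\<close> span the optimal test
      space.\<close>
    have "\<exists>w. w \<in> carrier_vec l \<and> Y *\<^sub>v w = Q *\<^sub>v col U i" if "i < j" for i
    proof -
      have "Q *\<^sub>v col U i \<in> {y \<in> carrier_vec m. \<exists>x\<in>carrier_vec r. Q *\<^sub>v x = y}"
        using Qc cr that jr by (auto intro!: bexI[of _ "col U i"])
      then show ?thesis unfolding space by auto
    qed
    then obtain w where w: "\<And>i. i < j \<Longrightarrow> w i \<in> carrier_vec l" "\<And>i. i < j \<Longrightarrow> Y *\<^sub>v w i = Q *\<^sub>v col U i"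
      by metis
    define W where "W = mat l j (\<lambda>(t, i). w i $ t)"
    have W: "W \<in> carrier_mat l j" by (simp add: W_def)
    define P where "P = mat r j (\<lambda>(t, i). if t = i then 1 else (0::real))"
    have P: "P \<in> carrier_mat r j" by (simp add: P_def)
    have UP: "U * P \<in> carrier_mat r j" using cr P by auto
    have colP: "col (U * P) i = col U i" if "i < j" for i
    proof (intro eq_vecI)
      fix t assume "t < dim_vec (col U i)"
      then have t: "t < r" using cr by auto
      have "col (U * P) i $ t = (\<Sum>t'\<in>{0..<r}. U $$ (t, t') * P $$ (t', i))"
        using that t cr P by (simp add: scalar_prod_def)
      also have "\<dots> = (\<Sum>t'\<in>{0..<r}. if t' = i then U $$ (t, i) else 0)"
        using that by (intro sum.cong) (auto simp: P_def)
      finally show "col (U * P) i $ t = col U i $ t" using that t jr cr by simp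
    qed (use cr P in auto)
    have YW: "Y * W = Q * (U * P)"
    proof (rule mat_col_eqI)
      fix i assume "i < dim_col (Q * (U * P))"
      then have i: "i < j" using UP by auto
      have "col (Y * W) i = Y *\<^sub>v col W i" using W Y i by (subst col_mult2[of _ m l _ j]) auto
      also have "col W i = w i" using w(1)[OF i] i by (intro eq_vecI) (auto simp: W_def)
      also have "Y *\<^sub>v w i = Q *\<^sub>v col U i" by (rule w(2)[OF i])
      also have "\<dots> = Q *\<^sub>v col (U * P) i" by (simp only: colP[OF i])
      also have "\<dots> = col (Q * (U * P)) i" using Qc UP i by (subst col_mult2[of _ m r _ j]) auto
      finally show "col (Y * W) i = col (Q * (U * P)) i" .
    qed (use Y W Qc UP in auto)
    show "?R"
    proof (intro bexI[OF _ W] ballI impI)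
      fix u :: "real vec" assume u: "u \<in> carrier_vec j" "u \<noteq> 0\<^sub>v j"
      define z where "z = U *\<^sub>v (P *\<^sub>v u)"
      have z: "z \<in> carrier_vec r" using cr P u by (auto simp: z_def)
      have "Y *\<^sub>v (W *\<^sub>v u) = (Y * W) *\<^sub>v u" by (rule assoc_mult_mat_vec[symmetric]) (use Y W u in auto)
      also have "\<dots> = Q *\<^sub>v ((U * P) *\<^sub>v u)" unfolding YW by (rule assoc_mult_mat_vec) (use Qc UP u in auto)
      also have "(U * P) *\<^sub>v u = z" unfolding z_def by (rule assoc_mult_mat_vec) (use cr P u in auto)
      finally have y: "Y *\<^sub>v (W *\<^sub>v u) = Q *\<^sub>v z" .
      have UTz: "(U\<^sup>T *\<^sub>v z) $ i = (if i < j then u $ i else 0)" if "i < r" for i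
      proof -
        have "U\<^sup>T *\<^sub>v z = (U\<^sup>T * U) *\<^sub>v (P *\<^sub>v u)"
          unfolding z_def by (rule assoc_mult_mat_vec[symmetric]) (use cr P u in auto)
        also have "U\<^sup>T * U = 1\<^sub>m r" using o(1) cr unfolding orthonormal_cols_def by auto
        also have "1\<^sub>m r *\<^sub>v (P *\<^sub>v u) = P *\<^sub>v u" using P u by auto
        finally have "(U\<^sup>T *\<^sub>v z) $ i = (\<Sum>t\<in>{0..<j}. (if i = t then 1 else 0) * u $ t)"
          using that u P by (simp add: P_def scalar_prod_def)
        also have "\<dots> = (\<Sum>t\<in>{0..<j}. if t = i then u $ i else 0)" by (intro sum.cong) auto
        finally show ?thesis by simp
      qed
      have jr': "j \<le> r" using jr j by simp
      have N: "(Q *\<^sub>v z) \<bullet> (Q *\<^sub>v z) = (\<Sum>i<j. (u $ i)\<^sup>2)"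
      proof -
        have "(Q *\<^sub>v z) \<bullet> (Q *\<^sub>v z) = (\<Sum>i<r. if i < j then (u $ i)\<^sup>2 else 0)"
          unfolding normQ[OF z] by (intro sum.cong) (auto simp: UTz)
        also have "\<dots> = (\<Sum>i<j. if i < j then (u $ i)\<^sup>2 else 0)"
          using jr' by (intro sum.mono_neutral_right) auto
        finally show ?thesis by simp
      qed
      obtain i where i: "i < j" "u $ i \<noteq> 0" using u by (metis carrier_vecD eq_vecI index_zero_vec(1) zero_carrier_vec)
      have "0 < (\<Sum>i<j. (u $ i)\<^sup>2)" by (rule sum_pos2[of _ i]) (use i in auto)
      moreover have "c\<^sup>2 < s\<^sup>2" using cs c by (intro power_strict_mono) auto
      ultimately have "c\<^sup>2 * (\<Sum>i<j. (u $ i)\<^sup>2) < s\<^sup>2 * (\<Sum>i<j. (u $ i)\<^sup>2)" by simp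
      also have "\<dots> \<le> (\<Sum>i<j. (S $$ (i, i) * u $ i)\<^sup>2)"
        unfolding sum_distrib_left power_mult_distrib
      proof (intro sum_mono mult_right_mono power_mono)
        fix i assume "i \<in> {..<j}"
        then show "s \<le> S $$ (i, i)" unfolding sS using jr j by (intro dec) auto
      qed (use s0 in auto)
      also have "\<dots> = (\<Sum>i<j. if i < r then (S $$ (i, i) * (U\<^sup>T *\<^sub>v z) $ i)\<^sup>2 else 0)"
        using jr' UTz by (intro sum.cong) auto
      also have "\<dots> \<le> (\<Sum>i<n. if i < r then (S $$ (i, i) * (U\<^sup>T *\<^sub>v z) $ i)\<^sup>2 else 0)"
        using j by (intro sum_mono2) auto
      finally show "c\<^sup>2 * ((Y *\<^sub>v (W *\<^sub>v u)) \<bullet> (Y *\<^sub>v (W *\<^sub>v u))) <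
        (A\<^sup>T *\<^sub>v (Y *\<^sub>v (W *\<^sub>v u))) \<bullet> (A\<^sup>T *\<^sub>v (Y *\<^sub>v (W *\<^sub>v u)))"
        unfolding y N energy[OF z] .
    qed
  next
    assume "?R"
    then obtain W where W: "W \<in> carrier_mat l j" and Wu: "\<And>u. u \<in> carrier_vec j \<Longrightarrow> u \<noteq> 0\<^sub>v j \<Longrightarrow>
      c\<^sup>2 * ((Y *\<^sub>v (W *\<^sub>v u)) \<bullet> (Y *\<^sub>v (W *\<^sub>v u))) <
      (A\<^sup>T *\<^sub>v (Y *\<^sub>v (W *\<^sub>v u))) \<bullet> (A\<^sup>T *\<^sub>v (Y *\<^sub>v (W *\<^sub>v u)))" by blast
    \<comment> \<open>\<open>K * u\<close> holds the coordinates of \<open>Y W u\<close> with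
      respect to the columns of \<open>Q * U\<close>. Making the first \<open>j - 1\<close> of them
      vanish is a system of \<open>j - 1\<close> equations in \<open>j\<close> unknowns, so some
      nonzero \<open>u\<close> sees only diagonal entries of \<open>S\<close> from number
      \<open>j\<close> on.\<close>
    define K where "K = U\<^sup>T * (Q\<^sup>T * (Y * W))"
    have K: "K \<in> carrier_mat r j" using UT Qc Y W by (auto simp: K_def)
    obtain e where e: "\<exists>i<j. e i \<noteq> 0" "\<And>i. i < j - 1 \<Longrightarrow> dot {..<j} (\<lambda>t. if i < r then K $$ (i, t) else 0) e = 0"
      using homogeneous_system_nontrivial[of "j - 1" j "\<lambda>i t. if i < r then K $$ (i, t) else 0"] j by auto
    define u where "u = vec j e"
    have u: "u \<in> carrier_vec j" "u \<noteq> 0\<^sub>v j"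
      using e(1) by (auto simp: u_def vec_eq_iff)
    define y where "y = Y *\<^sub>v (W *\<^sub>v u)"
    have "y \<in> {y \<in> carrier_vec m. \<exists>x\<in>carrier_vec l. Y *\<^sub>v x = y}"
      using Y W u by (auto simp: y_def)
    then obtain z where z: "z \<in> carrier_vec r" "y = Q *\<^sub>v z" unfolding space[symmetric] by auto
    have "Q\<^sup>T *\<^sub>v y = (Q\<^sup>T * Q) *\<^sub>v z"
      unfolding z(2) by (rule assoc_mult_mat_vec[symmetric]) (use Qc z in auto)
    also have "\<dots> = z" using Qc z unfolding orthonormal_cols_def by auto
    finally have "U\<^sup>T *\<^sub>v z = U\<^sup>T *\<^sub>v (Q\<^sup>T *\<^sub>v (Y *\<^sub>v (W *\<^sub>v u)))" by (simp add: y_def)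
    also have "\<dots> = K *\<^sub>v u"
      unfolding K_def using UT Qc Y W u
      by (simp add: assoc_mult_mat_vec[of _ r r _ j] assoc_mult_mat_vec[of _ r m _ j] assoc_mult_mat_vec[of _ m l _ j])
    finally have UTz: "U\<^sup>T *\<^sub>v z = K *\<^sub>v u" .
    have zero: "(U\<^sup>T *\<^sub>v z) $ i = 0" if "i < j - 1" "i < r" for i
      using e(2)[OF that(1)] that K unfolding UTz by (simp add: u_def scalar_prod_def dot_def atLeast0LessThan)
    have "(A\<^sup>T *\<^sub>v y) \<bullet> (A\<^sup>T *\<^sub>v y) \<le> (\<Sum>i<n. if i < r then s\<^sup>2 * ((U\<^sup>T *\<^sub>v z) $ i)\<^sup>2 else 0)"
      unfolding z(2) energy[OF z(1)]
    proof (intro sum_mono)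
      fix i assume i: "i \<in> {..<n}"
      show "(if i < r then (S $$ (i, i) * (U\<^sup>T *\<^sub>v z) $ i)\<^sup>2 else 0) \<le> (if i < r then s\<^sup>2 * ((U\<^sup>T *\<^sub>v z) $ i)\<^sup>2 else 0)"
      proof (cases "i < r \<and> \<not> i < j - 1")
        case True
        then have "S $$ (i, i) \<le> s" unfolding s_def using i by (auto intro: dec)
        moreover have "0 \<le> S $$ (i, i)" using True i by (intro nn) auto
        ultimately show ?thesis using True by (auto simp: power_mult_distrib intro!: mult_right_mono power_mono)
      qed (use zero in auto)
    qed
    also have "\<dots> \<le> s\<^sup>2 * (\<Sum>i<r. ((U\<^sup>T *\<^sub>v z) $ i)\<^sup>2)"
    proof -
      have "(\<Sum>i<n. if i < r then s\<^sup>2 * ((U\<^sup>T *\<^sub>v z) $ i)\<^sup>2 else 0) = (\<Sum>i\<in>{..<n} \<inter> {..<r}. s\<^sup>2 * ((U\<^sup>T *\<^sub>v z) $ i)\<^sup>2)"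
        by (subst sum.inter_restrict) auto
      also have "\<dots> \<le> (\<Sum>i<r. s\<^sup>2 * ((U\<^sup>T *\<^sub>v z) $ i)\<^sup>2)" by (intro sum_mono2) auto
      finally show ?thesis by (simp add: sum_distrib_left)
    qed
    also have "\<dots> = s\<^sup>2 * (y \<bullet> y)" unfolding z(2) normQ[OF z(1)] ..
    finally have "c\<^sup>2 * (y \<bullet> y) < s\<^sup>2 * (y \<bullet> y)" using Wu[OF u] unfolding y_def by linarith
    moreover have "0 \<le> y \<bullet> y" unfolding z(2) normQ[OF z(1)] by (simp add: sum_nonneg)
    ultimately have "c\<^sup>2 < s\<^sup>2" by (metis mult_less_cancel_right not_less)
    then show "c < s" using s0 by (rule power2_less_imp_less)
  qed
qed

section \<open>Reduction to coordinates along the right singular vectors\<close>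

lemma full_rank_mult_eq_0:
  assumes A: "A \<in> carrier_mat m n" and rank: "vec_space.rank m A = n"
    and v: "v \<in> carrier_vec n" "A *\<^sub>v v = 0\<^sub>v m"
  shows "v = (0\<^sub>v n :: real vec)"
proof (rule ccontr)
  assume v0: "v \<noteq> 0\<^sub>v n"
  interpret vec_space "TYPE(real)" m .
  \<comment> \<open>Rank and linear dependence refer to the set of columns, so repetitions have to
    be excluded first: \<open>n\<close> independent columns exist only if all \<open>n\<close> are
    distinct.\<close>
  have d: "distinct (cols A)"
  proof -
    obtain S where S: "maximal S (\<lambda>T. T \<subseteq> set (cols A) \<and> lin_indpt T)"
      using maximal_exists[of "(\<lambda>T. T \<subseteq> set (cols A) \<and> lin_indpt T)" "card (set (cols A))" "{}"]
      by (meson List.finite_set card_mono empty_iff empty_subsetI finite_lin_indpt2 rev_finite_subset)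
    then have "n = card S" using rank_card_indpt[OF A S] rank by simp
    also have "\<dots> \<le> card (set (cols A))" using S by (intro card_mono) (auto simp: maximal_def)
    finally show ?thesis using A card_length[of "cols A"] by (intro card_distinct) auto
  qed
  have "lin_dep (set (cols A))" by (rule lin_depI[OF A v(1) v0 v(2) d])
  then show False using full_rank_lin_indpt[OF A rank d] by simp
qed

text \<open>With weights \<open>d i ^ (4 * q + 4) - c\<^sup>2 * d i ^ (4 * q + 2)\<close> and
  \<open>g\<close> the entries of \<open>V\<^sup>T \<Omega>\<close>, this is
  \<open>|A\<^sup>T y|\<^sup>2 - c\<^sup>2 * |y|\<^sup>2\<close> for \<open>y = Y x\<close>.\<close>

definition weighted_energy :: "nat \<Rightarrow> nat \<Rightarrow> (nat \<Rightarrow> real) \<Rightarrow> (nat \<times> nat \<Rightarrow> real) \<Rightarrow> (nat \<Rightarrow> real) \<Rightarrow> real" where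
  "weighted_energy n l \<kappa> g x = (\<Sum>i<n. \<kappa> i * (dot {..<l} (\<lambda>c. g (i, c)) x)\<^sup>2)"

text \<open>The entries of \<open>V\<^sup>T * Om\<close>, where \<open>V\<close> has the columns
  \<open>w i\<close>.\<close>

definition rotated :: "(nat \<Rightarrow> nat \<Rightarrow> real) \<Rightarrow> nat \<Rightarrow> real mat \<Rightarrow> nat \<times> nat \<Rightarrow> real" where
  "rotated w n Om = (\<lambda>(i, c). \<Sum>r<n. w i r * Om $$ (r, c))"

text \<open>The subspace is given by spanning vectors \<open>W t\<close>. Positivity for all nonzero
  coefficients forces them to be independent, so its dimension is \<open>j\<close>.\<close>

definition positive_on_subspace :: "nat \<Rightarrow> nat \<Rightarrow> nat \<Rightarrow> (nat \<Rightarrow> real) \<Rightarrow> (nat \<times> nat \<Rightarrow> real) \<Rightarrow> bool" where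
  "positive_on_subspace n l j \<kappa> g \<longleftrightarrow> (\<exists>W :: nat \<Rightarrow> nat \<Rightarrow> real. \<forall>u. (\<exists>t<j. u t \<noteq> 0) \<longrightarrow>
    0 < weighted_energy n l \<kappa> g (\<lambda>c. \<Sum>t<j. u t * W t c))"

lemma weighted_energy_cong:
  "(\<And>i c. i < n \<Longrightarrow> c < l \<Longrightarrow> g (i, c) = g' (i, c)) \<Longrightarrow> (\<And>c. c < l \<Longrightarrow> x c = x' c) \<Longrightarrow>
    weighted_energy n l \<kappa> g x = weighted_energy n l \<kappa> g' x'"
  unfolding weighted_energy_def by (intro sum.cong refl arg_cong[of _ _ "\<lambda>t. _ * t\<^sup>2"] dot_cong) auto

lemma index_mult_mat_vec_dot:
  "M \<in> carrier_mat r n \<Longrightarrow> x \<in> carrier_vec n \<Longrightarrow> i < r \<Longrightarrow>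
    (M *\<^sub>v x) $ i = dot {..<n} (\<lambda>s. M $$ (i, s)) (\<lambda>s. x $ s)"
  by (auto simp: scalar_prod_def dot_def atLeast0LessThan)

text \<open>The right half of an SVD, as an eigensystem of \<open>A\<^sup>T * A\<close>. The index
  starts at 0: \<open>d i\<close> is singular value number \<open>i + 1\<close>.\<close>

locale right_singular_vectors =
  fixes A :: "real mat" and m n :: nat and w :: "nat \<Rightarrow> nat \<Rightarrow> real" and d :: "nat \<Rightarrow> real"
  assumes A: "A \<in> carrier_mat m n" and w: "orthonormal n n w"
    and eig: "\<And>i r. i < n \<Longrightarrow> r < n \<Longrightarrow> dot {..<n} (\<lambda>s. (A\<^sup>T * A) $$ (r, s)) (w i) = (d i)\<^sup>2 * w i r"
    and d_nonneg: "\<And>i. i < n \<Longrightarrow> 0 \<le> d i"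
    and d_mono: "\<And>i i'. i \<le> i' \<Longrightarrow> i' < n \<Longrightarrow> d i' \<le> d i"
begin

definition lin :: "(nat \<Rightarrow> real) \<Rightarrow> real vec" where
  "lin e = vec n (\<lambda>r. \<Sum>i<n. e i * w i r)"

lemma lin_carrier [simp]: "lin e \<in> carrier_vec n"
  by (simp add: lin_def)

lemma lin_scalar_prod: "lin e \<bullet> lin e' = (\<Sum>i<n. e i * e' i)"
proof -
  have "lin e \<bullet> lin e' = dot {..<n} (\<lambda>r. \<Sum>i<n. e i * w i r) (\<lambda>r. \<Sum>i<n. e' i * w i r)"
    by (simp add: lin_def scalar_prod_def dot_def atLeast0LessThan)
  also have "\<dots> = (\<Sum>i<n. e i * (\<Sum>i'<n. e' i' * dot {..<n} (w i) (w i')))"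
    unfolding dot_sum_left by (simp add: dot_sum_right)
  also have "\<dots> = (\<Sum>i<n. e i * (\<Sum>i'<n. if i' = i then e' i' else 0))"
    using w unfolding orthonormal_def by (intro sum.cong arg_cong[of _ _ "(*) _"]) auto
  finally show ?thesis by simp
qed

lemma gram_lin: "A\<^sup>T *\<^sub>v (A *\<^sub>v lin e) = lin (\<lambda>i. (d i)\<^sup>2 * e i)"
proof -
  have "A\<^sup>T *\<^sub>v (A *\<^sub>v lin e) = (A\<^sup>T * A) *\<^sub>v lin e"
    by (rule assoc_mult_mat_vec[symmetric]) (use A in auto)
  also have "\<dots> = lin (\<lambda>i. (d i)\<^sup>2 * e i)"
  proof (intro eq_vecI)
    fix r assume "r < dim_vec (lin (\<lambda>i. (d i)\<^sup>2 * e i))"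
    then have r: "r < n" by (simp add: lin_def)
    have "((A\<^sup>T * A) *\<^sub>v lin e) $ r = dot {..<n} (\<lambda>s. (A\<^sup>T * A) $$ (r, s)) (\<lambda>s. lin e $ s)"
      by (rule index_mult_mat_vec_dot) (use A r in auto)
    also have "\<dots> = dot {..<n} (\<lambda>s. (A\<^sup>T * A) $$ (r, s)) (\<lambda>s. \<Sum>i<n. e i * w i s)"
      by (intro dot_cong) (auto simp: lin_def)
    also have "\<dots> = (\<Sum>i<n. e i * ((d i)\<^sup>2 * w i r))"
      unfolding dot_sum_right using eig r by (intro sum.cong) auto
    finally show "((A\<^sup>T * A) *\<^sub>v lin e) $ r = lin (\<lambda>i. (d i)\<^sup>2 * e i) $ r"
      using r by (simp add: lin_def mult_ac)
  qed (use A in \<open>auto simp: lin_def\<close>)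
  finally show ?thesis .
qed

text \<open>Since \<open>(A A\<^sup>T)\<^sup>q A = A (A\<^sup>T A)\<^sup>q\<close>, the iteration
  can be followed on the right singular vectors alone.\<close>

lemma power_lin: "((A * A\<^sup>T) ^\<^sub>m q) *\<^sub>v (A *\<^sub>v lin e) = A *\<^sub>v lin (\<lambda>i. d i ^ (2 * q) * e i)"
proof (induction q arbitrary: e)
  case 0
  then show ?case using A by simp
next
  case (Suc q)
  have X: "A * A\<^sup>T \<in> carrier_mat m m" using A by auto
  have "((A * A\<^sup>T) ^\<^sub>m Suc q) *\<^sub>v (A *\<^sub>v lin e) = ((A * A\<^sup>T) ^\<^sub>m q) *\<^sub>v ((A * A\<^sup>T) *\<^sub>v (A *\<^sub>v lin e))"
    unfolding pow_mat.simps by (rule assoc_mult_mat_vec) (use X A in auto)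
  also have "(A * A\<^sup>T) *\<^sub>v (A *\<^sub>v lin e) = A *\<^sub>v (A\<^sup>T *\<^sub>v (A *\<^sub>v lin e))"
    by (rule assoc_mult_mat_vec) (use A in auto)
  also have "\<dots> = A *\<^sub>v lin (\<lambda>i. (d i)\<^sup>2 * e i)" unfolding gram_lin ..
  also have "((A * A\<^sup>T) ^\<^sub>m q) *\<^sub>v (A *\<^sub>v lin (\<lambda>i. (d i)\<^sup>2 * e i)) = A *\<^sub>v lin (\<lambda>i. d i ^ (2 * q) * ((d i)\<^sup>2 * e i))"
    by (rule Suc.IH)
  also have "(\<lambda>i. d i ^ (2 * q) * ((d i)\<^sup>2 * e i)) = (\<lambda>i. d i ^ (2 * Suc q) * e i)"
    by (simp add: mult_ac power2_eq_square)
  finally show ?case .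
qed

text \<open>If \<open>Om v\<close> has coordinates \<open>e i\<close>, then \<open>Y v\<close> is
  \<open>A\<close> applied to the vector with coordinates \<open>d i ^ (2 * q) * e i\<close>. One
  more factor \<open>d i\<close> gives the norm of \<open>Y v\<close>, two more give that of
  \<open>A\<^sup>T Y v\<close>.\<close>

lemma sample_energies:
  fixes q l :: nat
  assumes Om: "Om \<in> carrier_mat n l" and v: "v \<in> carrier_vec l"
  defines "Y \<equiv> ((A * A\<^sup>T) ^\<^sub>m q) * A * Om"
  shows "(Y *\<^sub>v v) \<bullet> (Y *\<^sub>v v) = weighted_energy n l (\<lambda>i. d i ^ (4 * q + 2)) (rotated w n Om) (\<lambda>c. v $ c)"
    "(A\<^sup>T *\<^sub>v (Y *\<^sub>v v)) \<bullet> (A\<^sup>T *\<^sub>v (Y *\<^sub>v v)) =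
      weighted_energy n l (\<lambda>i. d i ^ (4 * q + 4)) (rotated w n Om) (\<lambda>c. v $ c)"
proof -
  define e where "e i = dot {..<l} (\<lambda>c. rotated w n Om (i, c)) (\<lambda>c. v $ c)" for i
  have Ov: "Om *\<^sub>v v = lin e"
  proof (intro eq_vecI)
    fix r assume "r < dim_vec (lin e)"
    then have r: "r < n" by (simp add: lin_def)
    have "(Om *\<^sub>v v) $ r = (\<Sum>i<n. dot {..<n} (w i) (\<lambda>r. (Om *\<^sub>v v) $ r) * w i r)"
      by (rule orthonormal_basis_expansion[OF w r])
    also have "\<dots> = (\<Sum>i<n. e i * w i r)"
    proof (intro sum.cong refl arg_cong2[of _ _ _ _ "(*)"])
      fix i
      have "dot {..<n} (w i) (\<lambda>r. (Om *\<^sub>v v) $ r) = (\<Sum>r<n. w i r * (\<Sum>c<l. Om $$ (r, c) * v $ c))"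
        using Om v by (simp add: dot_def scalar_prod_def atLeast0LessThan)
      also have "\<dots> = e i"
        unfolding e_def dot_def rotated_def
        by (simp add: sum_distrib_left sum_distrib_right mult_ac) (rule sum.swap)
      finally show "dot {..<n} (w i) (\<lambda>r. (Om *\<^sub>v v) $ r) = e i" .
    qed
    finally show "(Om *\<^sub>v v) $ r = lin e $ r" using r by (simp add: lin_def)
  qed (use Om in \<open>simp add: lin_def\<close>)
  define f where "f i = d i ^ (2 * q) * e i" for i
  have X: "(A * A\<^sup>T) ^\<^sub>m q \<in> carrier_mat m m" using A by auto
  have "Y *\<^sub>v v = ((A * A\<^sup>T) ^\<^sub>m q * A) *\<^sub>v (Om *\<^sub>v v)"
    unfolding Y_def by (rule assoc_mult_mat_vec) (use X A Om v in auto)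
  also have "\<dots> = (A * A\<^sup>T) ^\<^sub>m q *\<^sub>v (A *\<^sub>v lin e)"
    unfolding Ov by (rule assoc_mult_mat_vec) (use X A in auto)
  finally have Yv: "Y *\<^sub>v v = A *\<^sub>v lin f" unfolding power_lin f_def .
  have "(Y *\<^sub>v v) \<bullet> (Y *\<^sub>v v) = (A\<^sup>T *\<^sub>v (A *\<^sub>v lin f)) \<bullet> lin f"
    unfolding Yv by (rule transpose_vec_mult_scalar[symmetric]) (use A in auto)
  also have "\<dots> = (\<Sum>i<n. d i ^ (4 * q + 2) * (e i)\<^sup>2)"
    unfolding gram_lin lin_scalar_prod f_def
    by (intro sum.cong) (auto simp: power_add power2_eq_square mult_ac numeral_eq_Suc power_mult_distrib simp flip: power_mult)
  finally show "(Y *\<^sub>v v) \<bullet> (Y *\<^sub>v v) = weighted_energy n l (\<lambda>i. d i ^ (4 * q + 2)) (rotated w n Om) (\<lambda>c. v $ c)"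
    unfolding weighted_energy_def e_def .
  have "(A\<^sup>T *\<^sub>v (Y *\<^sub>v v)) \<bullet> (A\<^sup>T *\<^sub>v (Y *\<^sub>v v)) = (\<Sum>i<n. d i ^ (4 * q + 4) * (e i)\<^sup>2)"
    unfolding Yv gram_lin lin_scalar_prod f_def
    by (intro sum.cong) (auto simp: power_add power2_eq_square mult_ac numeral_eq_Suc power_mult_distrib simp flip: power_mult)
  then show "(A\<^sup>T *\<^sub>v (Y *\<^sub>v v)) \<bullet> (A\<^sup>T *\<^sub>v (Y *\<^sub>v v)) =
      weighted_energy n l (\<lambda>i. d i ^ (4 * q + 4)) (rotated w n Om) (\<lambda>c. v $ c)"
    unfolding weighted_energy_def e_def .
qed

lemma singular_value_eq:
  assumes j: "1 \<le> j" "j \<le> n"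
  shows "singular_value A j = d (j - 1)"
proof (rule singular_value_of_gram_diagonalization[OF _ _ _ d_nonneg d_mono j])
  define V where "V = mat n n (\<lambda>(r, i). w i r)"
  define D2 where "D2 = mat n n (\<lambda>(i, i'). if i = i' then (d i)\<^sup>2 else 0)"
  show V: "V \<in> carrier_mat n n" by (simp add: V_def)
  show o: "orthonormal_cols V"
    using w unfolding orthonormal_cols_def orthonormal_def
    by (intro eq_matI) (auto simp: V_def scalar_prod_def dot_def atLeast0LessThan)
  have P: "A\<^sup>T * A \<in> carrier_mat n n" using A by auto
  have D2: "D2 \<in> carrier_mat n n" by (simp add: D2_def)
  have "A\<^sup>T * A * V = V * D2"
  proof (intro eq_matI)
    fix r i assume "r < dim_row (V * D2)" "i < dim_col (V * D2)"
    then have ri: "r < n" "i < n" by (auto simp: V_def D2_def)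
    have "(A\<^sup>T * A * V) $$ (r, i) = dot {..<n} (\<lambda>s. (A\<^sup>T * A) $$ (r, s)) (w i)"
      using ri P by (subst index_mult_mat(1)) (auto simp: V_def scalar_prod_def dot_def atLeast0LessThan simp del: index_mult_mat(1))
    also have "\<dots> = (d i)\<^sup>2 * w i r" by (rule eig) (use ri in auto)
    also have "\<dots> = (V * D2) $$ (r, i)"
      using ri by (simp add: V_def D2_def scalar_prod_def if_distrib mult.commute cong: if_cong)
    finally show "(A\<^sup>T * A * V) $$ (r, i) = (V * D2) $$ (r, i)" .
  qed (use A V D2 in auto)
  then have "V * D2 * V\<^sup>T = A\<^sup>T * A * (V * V\<^sup>T)"
    using P V D2 by (metis assoc_mult_mat transpose_carrier_mat)
  then show "A\<^sup>T * A = V * mat n n (\<lambda>(i, i'). if i = i' then (d i)\<^sup>2 else 0) * V\<^sup>T"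
    unfolding orthonormal_cols_square(1)[OF V o] D2_def right_mult_one_mat[OF P] by (rule sym)
qed auto

lemma d_pos:
  assumes "vec_space.rank m A = n" "i < n"
  shows "0 < d i"
proof -
  have "d i \<noteq> 0"
  proof
    assume d0: "d i = 0"
    define e where "e = (\<lambda>i'. if i' = i then 1 else (0::real))"
    have "(A *\<^sub>v lin e) \<bullet> (A *\<^sub>v lin e) = (A\<^sup>T *\<^sub>v (A *\<^sub>v lin e)) \<bullet> lin e"
      by (rule transpose_vec_mult_scalar[symmetric]) (use A in auto)
    also have "\<dots> = 0" unfolding gram_lin lin_scalar_prod e_def using d0 by (intro sum.neutral) auto
    finally have "\<forall>r\<in>{..<m}. (A *\<^sub>v lin e) $ r = 0"
      using A by (subst dot_self_eq_0_iff[symmetric]) (auto simp: scalar_prod_def dot_def atLeast0LessThan)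
    then have "A *\<^sub>v lin e = 0\<^sub>v m" using A by (intro eq_vecI) auto
    then have "lin e = 0\<^sub>v n" by (rule full_rank_mult_eq_0[OF A assms(1) lin_carrier])
    then have "lin e \<bullet> lin e = 0" by simp
    then show False unfolding lin_scalar_prod e_def using assms(2) by (simp add: if_distrib cong: if_cong)
  qed
  then show ?thesis using d_nonneg[OF assms(2)] by simp
qed

text \<open>The right-hand side depends on \<open>Om\<close> only. So the singular value is the same
  for all outputs that the algorithm can return, which makes it a random variable whatever choices
  are made.\<close>

lemma subspace_iteration_singular_value:
  assumes X: "randomized_subspace_iteration A k l q Om X"
    and j: "1 \<le> j" "j \<le> k" "j \<le> n"
  shows "0 \<le> singular_value X j"
    "0 \<le> c \<Longrightarrow> c < singular_value X j \<longleftrightarrow>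
      positive_on_subspace n l j (\<lambda>i. d i ^ (4 * q + 4) - c\<^sup>2 * d i ^ (4 * q + 2)) (rotated w n Om)"
proof -
  define Y where "Y = ((A * A\<^sup>T) ^\<^sub>m q) * A * Om"
  have Om: "Om \<in> carrier_mat n l" using X A unfolding randomized_subspace_iteration_def by auto
  have "(A * A\<^sup>T) ^\<^sub>m q \<in> carrier_mat m m" using A by auto
  then have Y: "Y \<in> carrier_mat m l" unfolding Y_def using A Om by auto
  obtain Q Bk where Q: "orthonormal_basis_of_col_space Q Y" "is_truncated_svd k (Q\<^sup>T * A) Bk" "X = Q * Bk"
    using X unfolding randomized_subspace_iteration_def Y_def by auto
  note sv = truncated_singular_value_gt_iff[OF A Y Q j]
  show "0 \<le> singular_value X j" by (rule sv(1)[OF order_refl])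
  define \<kappa> where "\<kappa> i = d i ^ (4 * q + 4) - c\<^sup>2 * d i ^ (4 * q + 2)" for i
  assume c: "0 \<le> c"
  have diff: "weighted_energy n l \<kappa> g x =
    weighted_energy n l (\<lambda>i. d i ^ (4 * q + 4)) g x - c\<^sup>2 * weighted_energy n l (\<lambda>i. d i ^ (4 * q + 2)) g x" for g x
    unfolding weighted_energy_def \<kappa>_def sum_distrib_left
    by (simp add: left_diff_distrib sum_subtractf mult.assoc)
  have gt: "c\<^sup>2 * ((Y *\<^sub>v v) \<bullet> (Y *\<^sub>v v)) < (A\<^sup>T *\<^sub>v (Y *\<^sub>v v)) \<bullet> (A\<^sup>T *\<^sub>v (Y *\<^sub>v v)) \<longleftrightarrow>
      0 < weighted_energy n l \<kappa> (rotated w n Om) (\<lambda>c. v $ c)" if "v \<in> carrier_vec l" for v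
    unfolding diff Y_def sample_energies[OF Om that] by simp
  have Wu: "weighted_energy n l \<kappa> g (\<lambda>c. (mat l j (\<lambda>(c, t). W t c) *\<^sub>v vec j u) $ c) =
    weighted_energy n l \<kappa> g (\<lambda>c. \<Sum>t<j. u t * W t c)" for g W u
    by (rule weighted_energy_cong) (auto simp: scalar_prod_def atLeast0LessThan mult.commute)
  show "c < singular_value X j \<longleftrightarrow> positive_on_subspace n l j \<kappa> (rotated w n Om)"
    unfolding sv(2)[OF c]
  proof
    assume "\<exists>W \<in> carrier_mat l j. \<forall>u \<in> carrier_vec j. u \<noteq> 0\<^sub>v j \<longrightarrow>
      c\<^sup>2 * ((Y *\<^sub>v (W *\<^sub>v u)) \<bullet> (Y *\<^sub>v (W *\<^sub>v u))) <
      (A\<^sup>T *\<^sub>v (Y *\<^sub>v (W *\<^sub>v u))) \<bullet> (A\<^sup>T *\<^sub>v (Y *\<^sub>v (W *\<^sub>v u)))"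
    then obtain W where W: "W \<in> carrier_mat l j" "\<And>u. u \<in> carrier_vec j \<Longrightarrow> u \<noteq> 0\<^sub>v j \<Longrightarrow>
      c\<^sup>2 * ((Y *\<^sub>v (W *\<^sub>v u)) \<bullet> (Y *\<^sub>v (W *\<^sub>v u))) <
      (A\<^sup>T *\<^sub>v (Y *\<^sub>v (W *\<^sub>v u))) \<bullet> (A\<^sup>T *\<^sub>v (Y *\<^sub>v (W *\<^sub>v u)))" by blast
    have Weq: "W = mat l j (\<lambda>(c, t). W $$ (c, t))" using W(1) by (intro eq_matI) auto
    show "positive_on_subspace n l j \<kappa> (rotated w n Om)"
      unfolding positive_on_subspace_def
    proof (intro exI[of _ "\<lambda>t c. W $$ (c, t)"] allI impI)
      fix u :: "nat \<Rightarrow> real" assume u: "\<exists>t<j. u t \<noteq> 0"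
      have "vec j u \<noteq> 0\<^sub>v j" using u by (auto simp: vec_eq_iff)
      then have "0 < weighted_energy n l \<kappa> (rotated w n Om) (\<lambda>c. (W *\<^sub>v vec j u) $ c)"
        using W by (intro gt[THEN iffD1]) auto
      then show "0 < weighted_energy n l \<kappa> (rotated w n Om) (\<lambda>c. \<Sum>t<j. u t * W $$ (c, t))"
        using Wu[of _ "\<lambda>t c. W $$ (c, t)" u] Weq by simp
    qed
  next
    assume "positive_on_subspace n l j \<kappa> (rotated w n Om)"
    then obtain W where W: "\<And>u. \<exists>t<j. u t \<noteq> 0 \<Longrightarrow> 0 < weighted_energy n l \<kappa> (rotated w n Om) (\<lambda>c. \<Sum>t<j. u t * W t c)"
      unfolding positive_on_subspace_def by blast
    show "\<exists>W \<in> carrier_mat l j. \<forall>u \<in> carrier_vec j. u \<noteq> 0\<^sub>v j \<longrightarrow>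
      c\<^sup>2 * ((Y *\<^sub>v (W *\<^sub>v u)) \<bullet> (Y *\<^sub>v (W *\<^sub>v u))) <
      (A\<^sup>T *\<^sub>v (Y *\<^sub>v (W *\<^sub>v u))) \<bullet> (A\<^sup>T *\<^sub>v (Y *\<^sub>v (W *\<^sub>v u)))"
    proof (intro bexI[of _ "mat l j (\<lambda>(c, t). W t c)"] ballI impI)
      fix u :: "real vec" assume u: "u \<in> carrier_vec j" "u \<noteq> 0\<^sub>v j"
      have ueq: "u = vec j (\<lambda>t. u $ t)" using u(1) by auto
      have "\<exists>t<j. u $ t \<noteq> 0" using u by (metis carrier_vecD eq_vecI index_zero_vec(1) zero_carrier_vec)
      then have "0 < weighted_energy n l \<kappa> (rotated w n Om) (\<lambda>c. (mat l j (\<lambda>(c, t). W t c) *\<^sub>v u) $ c)"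
        using W[of "\<lambda>t. u $ t"] Wu[of _ W "\<lambda>t. u $ t"] ueq by simp
      then show "c\<^sup>2 * ((Y *\<^sub>v (mat l j (\<lambda>(c, t). W t c) *\<^sub>v u)) \<bullet> (Y *\<^sub>v (mat l j (\<lambda>(c, t). W t c) *\<^sub>v u))) <
        (A\<^sup>T *\<^sub>v (Y *\<^sub>v (mat l j (\<lambda>(c, t). W t c) *\<^sub>v u))) \<bullet> (A\<^sup>T *\<^sub>v (Y *\<^sub>v (mat l j (\<lambda>(c, t). W t c) *\<^sub>v u)))"
        by (intro gt[THEN iffD2] mult_mat_vec_carrier) (use u in auto)
    qed simp
  qed
qed

end

lemma right_singular_vectors_exist:
  assumes A: "A \<in> carrier_mat m n"
  shows "\<exists>w d. right_singular_vectors A m n w d"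
proof -
  have sym: "(A\<^sup>T * A) $$ (i, j) = (A\<^sup>T * A) $$ (j, i)" if "i < n" "j < n" for i j
    using that A by (auto simp: scalar_prod_def mult.commute)
  have "\<exists>w l. orthonormal n n w \<and> (\<forall>i<n. \<forall>j<n. dot {..<n} (\<lambda>s. (A\<^sup>T * A) $$ (j, s)) (w i) = l i * w i j) \<and>
    (\<forall>i j. i \<le> j \<longrightarrow> j < n \<longrightarrow> l j \<le> l i)"
    by (rule symmetric_spectral[of n "\<lambda>i j. (A\<^sup>T * A) $$ (i, j)"]) (rule sym)
  then obtain w l where wl: "orthonormal n n w \<and> (\<forall>i<n. \<forall>j<n. dot {..<n} (\<lambda>s. (A\<^sup>T * A) $$ (j, s)) (w i) = l i * w i j) \<and>
    (\<forall>i j. i \<le> j \<longrightarrow> j < n \<longrightarrow> l j \<le> l i)"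
    by (elim exE)
  then have w: "orthonormal n n w" by simp
  from wl have "\<forall>i<n. \<forall>j<n. dot {..<n} (\<lambda>s. (A\<^sup>T * A) $$ (j, s)) (w i) = l i * w i j"
    by (elim conjE)
  then have l: "dot {..<n} (\<lambda>s. (A\<^sup>T * A) $$ (r, s)) (w i) = l i * w i r" if "i < n" "r < n" for i r
    using that by (simp only:)
  from wl have mono: "l j \<le> l i" if "i \<le> j" "j < n" for i j
    using that by simp
  \<comment> \<open>The eigenvalue is \<open>|A w|\<^sup>2\<close> for the unit eigenvector
    \<open>w\<close>.\<close>
  have nn: "0 \<le> l i" if i: "i < n" for i
  proof -
    define x where "x = vec n (w i)"
    have x: "x \<in> carrier_vec n" by (simp add: x_def)
    have e: "A\<^sup>T *\<^sub>v (A *\<^sub>v x) = (A\<^sup>T * A) *\<^sub>v x"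
      by (rule assoc_mult_mat_vec[symmetric]) (use A x in auto)
    have c: "(A\<^sup>T * A) *\<^sub>v x \<in> carrier_vec n" using A x by auto
    have "(A\<^sup>T *\<^sub>v (A *\<^sub>v x)) \<bullet> x = dot {..<n} (\<lambda>r. ((A\<^sup>T * A) *\<^sub>v x) $ r) (w i)"
      unfolding e using c by (simp add: x_def scalar_prod_def dot_def atLeast0LessThan del: index_mult_mat_vec)
    also have "\<dots> = dot {..<n} (\<lambda>r. l i * w i r) (w i)"
    proof (rule dot_cong)
      fix r assume "r \<in> {..<n}"
      then have r: "r < n" by simp
      have "((A\<^sup>T * A) *\<^sub>v x) $ r = dot {..<n} (\<lambda>s. (A\<^sup>T * A) $$ (r, s)) (\<lambda>s. x $ s)"
        by (rule index_mult_mat_vec_dot) (use A r x in auto)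
      also have "\<dots> = dot {..<n} (\<lambda>s. (A\<^sup>T * A) $$ (r, s)) (w i)"
        by (intro dot_cong) (auto simp: x_def)
      finally show "((A\<^sup>T * A) *\<^sub>v x) $ r = l i * w i r" using l[OF i r] by simp
    qed simp
    also have "\<dots> = l i" using w i unfolding orthonormal_def by (simp add: dot_scale_left)
    finally have "l i = (A *\<^sub>v x) \<bullet> (A *\<^sub>v x)"
      using transpose_vec_mult_scalar[OF A x, of "A *\<^sub>v x"] A x by simp
    then show ?thesis using A by (simp add: scalar_prod_def sum_nonneg)
  qed
  show ?thesis
  proof (intro exI)
    show "right_singular_vectors A m n w (\<lambda>i. sqrt (l i))"
      using A w l nn mono by unfold_locales (auto simp: real_sqrt_le_mono)
  qed
qed

section \<open>Measurability of the singular values of the output\<close>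

lemma rational_sequence_tendsto: "\<exists>f :: nat \<Rightarrow> rat. (\<lambda>N. real_of_rat (f N)) \<longlonglongrightarrow> x"
proof -
  have "\<forall>N. \<exists>q. x < real_of_rat q \<and> real_of_rat q < x + inverse (real (Suc N))"
    by (intro allI of_rat_dense) simp
  then obtain f where f: "\<And>N. x < real_of_rat (f N)" "\<And>N. real_of_rat (f N) < x + inverse (real (Suc N))"
    by metis
  have "(\<lambda>N. x + inverse (real (Suc N))) \<longlonglongrightarrow> x + 0"
    by (intro tendsto_intros LIMSEQ_inverse_real_of_nat)
  then have lim: "(\<lambda>N. x + inverse (real (Suc N))) \<longlonglongrightarrow> x" by (simp only: add_0_right)
  have "(\<lambda>N. real_of_rat (f N)) \<longlonglongrightarrow> x"
  proof (rule tendsto_sandwich[OF _ _ tendsto_const lim])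
    show "\<forall>\<^sub>F N in sequentially. x \<le> real_of_rat (f N)"
      by (intro always_eventually allI less_imp_le f(1))
    show "\<forall>\<^sub>F N in sequentially. real_of_rat (f N) \<le> x + inverse (real (Suc N))"
      by (intro always_eventually allI less_imp_le f(2))
  qed
  then show ?thesis by blast
qed

definition energy_matrix :: "nat \<Rightarrow> nat \<Rightarrow> (nat \<Rightarrow> real) \<Rightarrow> (nat \<times> nat \<Rightarrow> real) \<Rightarrow> (nat \<Rightarrow> nat \<Rightarrow> real) \<Rightarrow> nat \<Rightarrow> nat \<Rightarrow> real" where
  "energy_matrix n l \<kappa> g W t t' =
    (\<Sum>i<n. \<kappa> i * dot {..<l} (\<lambda>c. g (i, c)) (W t) * dot {..<l} (\<lambda>c. g (i, c)) (W t'))"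

lemma weighted_energy_eq_form:
  "weighted_energy n l \<kappa> g (\<lambda>c. \<Sum>t<j. u t * W t c) = dot {..<j} u (mv j (energy_matrix n l \<kappa> g W) u)"
proof -
  have "weighted_energy n l \<kappa> g (\<lambda>c. \<Sum>t<j. u t * W t c) =
    (\<Sum>i<n. \<Sum>t<j. \<Sum>t'<j. u t * (\<kappa> i * dot {..<l} (\<lambda>c. g (i, c)) (W t) * dot {..<l} (\<lambda>c. g (i, c)) (W t') * u t'))"
    unfolding weighted_energy_def dot_sum_right power2_eq_square
    by (simp add: sum_distrib_left sum_distrib_right mult_ac)
  also have "\<dots> = (\<Sum>t<j. \<Sum>t'<j. \<Sum>i<n. u t * (\<kappa> i * dot {..<l} (\<lambda>c. g (i, c)) (W t) * dot {..<l} (\<lambda>c. g (i, c)) (W t') * u t'))"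
    by (subst sum.swap) (intro sum.cong refl sum.swap)
  also have "\<dots> = dot {..<j} u (mv j (energy_matrix n l \<kappa> g W) u)"
    by (simp add: dot_def[of "{..<j}"] energy_matrix_def sum_distrib_left sum_distrib_right mult_ac)
  finally show ?thesis .
qed

text \<open>The least eigenvalue serves as \<open>\<delta>\<close>, which replaces a compactness
  argument on the unit sphere.\<close>

lemma positive_form_bounded_below:
  assumes sym: "\<And>t t'. t < j \<Longrightarrow> t' < j \<Longrightarrow> H t t' = H t' t"
    and pos: "\<And>u. \<exists>t<j. u t \<noteq> 0 \<Longrightarrow> 0 < dot {..<j} u (mv j H u)" and j: "j > 0"
  shows "\<exists>\<delta>>0. \<forall>u. \<delta> * dot {..<j} u u \<le> dot {..<j} u (mv j H u)"
proof -
  have "\<exists>v ev. orthonormal j j v \<and> (\<forall>i<j. \<forall>k<j. mv j H (v i) k = ev i * v i k) \<and>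
    (\<forall>i k. i \<le> k \<longrightarrow> k < j \<longrightarrow> ev k \<le> ev i)"
    by (rule symmetric_spectral) (rule sym)
  then obtain v ev where spec: "orthonormal j j v \<and> (\<forall>i<j. \<forall>k<j. mv j H (v i) k = ev i * v i k) \<and>
    (\<forall>i k. i \<le> k \<longrightarrow> k < j \<longrightarrow> ev k \<le> ev i)" by (elim exE)
  then have v: "orthonormal j j v" by simp
  from spec have "\<forall>i<j. \<forall>k<j. mv j H (v i) k = ev i * v i k" by (elim conjE)
  then have eig: "mv j H (v i) k = ev i * v i k" if "i < j" "k < j" for i k
    using that by (simp only:)
  from spec have mono: "ev k \<le> ev i" if "i \<le> k" "k < j" for i k using that by simp
  define \<delta> where "\<delta> = ev (j - 1)"
  have vv: "dot {..<j} (v i) (v i) = 1" if "i < j" for i using v that unfolding orthonormal_def by simp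
  have "\<delta> > 0"
  proof -
    have "\<exists>t<j. v (j - 1) t \<noteq> 0"
    proof (rule ccontr)
      assume "\<not> ?thesis"
      then have "dot {..<j} (v (j - 1)) (v (j - 1)) = 0" by (simp add: dot_def)
      then show False using vv[of "j - 1"] j by simp
    qed
    then have "0 < dot {..<j} (v (j - 1)) (mv j H (v (j - 1)))" by (rule pos)
    also have "\<dots> = dot {..<j} (v (j - 1)) (\<lambda>k. \<delta> * v (j - 1) k)"
      using eig j by (intro dot_cong) (auto simp: \<delta>_def)
    also have "\<dots> = \<delta>" using vv[of "j - 1"] j by (simp add: dot_scale_right)
    finally show ?thesis .
  qed
  moreover have "\<delta> * dot {..<j} u u \<le> dot {..<j} u (mv j H u)" for u
  proof -
    have "\<delta> * dot {..<j} u u = (\<Sum>i<j. \<delta> * (dot {..<j} (v i) u)\<^sup>2)"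
      by (subst parseval[OF v]) (simp add: sum_distrib_left power2_eq_square)
    also have "\<dots> \<le> (\<Sum>i<j. ev i * (dot {..<j} (v i) u)\<^sup>2)"
      unfolding \<delta>_def by (intro sum_mono mult_right_mono mono) auto
    also have "\<dots> = (\<Sum>i<j. dot {..<j} (v i) u * dot {..<j} (v i) (mv j H u))"
    proof (intro sum.cong refl)
      fix i assume i: "i \<in> {..<j}"
      have "dot {..<j} (v i) (mv j H u) = dot {..<j} (mv j H (v i)) u"
        by (rule mv_symmetric) (rule sym)
      also have "\<dots> = dot {..<j} (\<lambda>k. ev i * v i k) u"
        using eig i by (intro dot_cong) auto
      finally show "ev i * (dot {..<j} (v i) u)\<^sup>2 = dot {..<j} (v i) u * dot {..<j} (v i) (mv j H u)"
        by (simp add: dot_scale_left power2_eq_square)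
    qed
    also have "\<dots> = dot {..<j} u (mv j H u)" by (rule parseval[OF v, symmetric])
    finally show ?thesis .
  qed
  ultimately show ?thesis by blast
qed

text \<open>An entrywise error \<open>\<epsilon>\<close> changes the form by at most
  \<open>\<epsilon>\<close> times the square of the sum of the \<open>|u t|\<close>, and
  Cauchy--Schwarz bounds that square by \<open>j * |u|\<^sup>2\<close>.\<close>

lemma form_perturbation:
  assumes H: "\<And>t t'. t < j \<Longrightarrow> t' < j \<Longrightarrow> \<bar>H' t t' - H t t'\<bar> \<le> \<epsilon>" and \<epsilon>: "\<epsilon> \<ge> 0"
  shows "dot {..<j} u (mv j H u) - \<epsilon> * real j * dot {..<j} u u \<le> dot {..<j} u (mv j H' u)"
proof -
  have "dot {..<j} u (mv j H u) - dot {..<j} u (mv j H' u) = (\<Sum>t<j. \<Sum>t'<j. u t * ((H t t' - H' t t') * u t'))"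
    by (simp add: dot_def sum_distrib_left left_diff_distrib right_diff_distrib sum_subtractf)
  also have "\<dots> \<le> (\<Sum>t<j. \<Sum>t'<j. \<epsilon> * (\<bar>u t\<bar> * \<bar>u t'\<bar>))"
  proof (intro sum_mono)
    fix t t' assume t: "t \<in> {..<j}" "t' \<in> {..<j}"
    have "u t * ((H t t' - H' t t') * u t') \<le> \<bar>H' t t' - H t t'\<bar> * (\<bar>u t\<bar> * \<bar>u t'\<bar>)"
      using abs_ge_self[of "u t * ((H t t' - H' t t') * u t')"] by (simp add: abs_mult abs_minus_commute mult_ac)
    also have "\<dots> \<le> \<epsilon> * (\<bar>u t\<bar> * \<bar>u t'\<bar>)" using H t by (intro mult_right_mono) auto
    finally show "u t * ((H t t' - H' t t') * u t') \<le> \<epsilon> * (\<bar>u t\<bar> * \<bar>u t'\<bar>)" .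
  qed
  also have "\<dots> = \<epsilon> * (\<Sum>t<j. \<bar>u t\<bar> * 1)\<^sup>2"
    by (simp add: power2_eq_square sum_distrib_left sum_distrib_right mult_ac)
  also have "\<dots> \<le> \<epsilon> * ((\<Sum>t<j. \<bar>u t\<bar>\<^sup>2) * (\<Sum>t<j. 1\<^sup>2))"
    by (intro mult_left_mono Cauchy_Schwarz_ineq_sum \<epsilon>)
  also have "\<dots> = \<epsilon> * real j * dot {..<j} u u" by (simp add: dot_def power2_eq_square mult_ac)
  finally show ?thesis by simp
qed

text \<open>Positivity is an open condition, so that countably many conditions decide it.\<close>

lemma positive_on_subspace_iff_rational:
  assumes j: "j > 0"
  shows "positive_on_subspace n l j \<kappa> g \<longleftrightarrow> (\<exists>(ws :: rat list list) N :: nat. \<forall>us :: rat list.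
    inverse (real (Suc N)) * (\<Sum>t<j. (real_of_rat (us ! t))\<^sup>2) \<le>
      weighted_energy n l \<kappa> g (\<lambda>c. \<Sum>t<j. real_of_rat (us ! t) * real_of_rat (ws ! t ! c)))"
proof
  assume "positive_on_subspace n l j \<kappa> g"
  then obtain W where W: "\<And>u. \<exists>t<j. u t \<noteq> 0 \<Longrightarrow> 0 < weighted_energy n l \<kappa> g (\<lambda>c. \<Sum>t<j. u t * W t c)"
    unfolding positive_on_subspace_def by blast
  define H where "H = energy_matrix n l \<kappa> g"
  have sym: "H W t t' = H W t' t" for W t t' by (simp add: H_def energy_matrix_def mult_ac)
  have "\<exists>\<delta>>0. \<forall>u. \<delta> * dot {..<j} u u \<le> dot {..<j} u (mv j (H W) u)"
  proof (rule positive_form_bounded_below[OF sym _ j])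
    show "0 < dot {..<j} u (mv j (H W) u)" if "\<exists>t<j. u t \<noteq> 0" for u
      using W[OF that] unfolding H_def weighted_energy_eq_form .
  qed
  then obtain \<delta> where "\<delta> > 0 \<and> (\<forall>u. \<delta> * dot {..<j} u u \<le> dot {..<j} u (mv j (H W) u))" by (elim exE)
  then have \<delta>: "\<delta> > 0" "\<And>u. \<delta> * dot {..<j} u u \<le> dot {..<j} u (mv j (H W) u)" by simp_all
  define f where "f t c = (SOME f :: nat \<Rightarrow> rat. (\<lambda>N. real_of_rat (f N)) \<longlonglongrightarrow> W t c)" for t c
  have f: "(\<lambda>N. real_of_rat (f t c N)) \<longlonglongrightarrow> W t c" for t c
    unfolding f_def by (rule someI_ex[OF rational_sequence_tendsto])
  define WN where "WN N t c = real_of_rat (f t c N)" for N t c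
  have "(\<lambda>N. H (WN N) t t') \<longlonglongrightarrow> H W t t'" for t t'
    unfolding H_def energy_matrix_def dot_def WN_def by (intro tendsto_intros f)
  \<comment> \<open>With this \<open>\<epsilon>\<close> the passage to rational spanning vectors
    uses up half of the margin \<open>\<delta>\<close>; the other half is kept for
    \<open>inverse (Suc N')\<close>.\<close>
  moreover define \<epsilon> where "\<epsilon> = \<delta> / (2 * real j)"
  have \<epsilon>: "\<epsilon> > 0" using \<delta> j by (simp add: \<epsilon>_def)
  ultimately have "\<forall>\<^sub>F N in sequentially. \<bar>H (WN N) t t' - H W t t'\<bar> < \<epsilon>" for t t'
    using tendstoD[of "\<lambda>N. H (WN N) t t'" "H W t t'" sequentially \<epsilon>] by (simp add: dist_real_def)
  then have "\<forall>\<^sub>F N in sequentially. \<forall>p\<in>{..<j} \<times> {..<j}. \<bar>H (WN N) (fst p) (snd p) - H W (fst p) (snd p)\<bar> < \<epsilon>"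
    by (intro eventually_ball_finite) auto
  then obtain N where N: "\<And>t t'. t < j \<Longrightarrow> t' < j \<Longrightarrow> \<bar>H (WN N) t t' - H W t t'\<bar> < \<epsilon>"
    by (auto simp: eventually_sequentially)
  obtain N' where N': "inverse (real (Suc N')) < \<delta> / 2" using reals_Archimedean[of "\<delta> / 2"] \<delta> by auto
  \<comment> \<open>Lists of rationals form a countable type, so the quantifiers over
    \<open>ws\<close> and \<open>us\<close> become countable unions and intersections.\<close>
  define ws where "ws = map (\<lambda>t. map (\<lambda>c. f t c N) [0..<l]) [0..<j]"
  show "\<exists>(ws :: rat list list) N :: nat. \<forall>us :: rat list.
    inverse (real (Suc N)) * (\<Sum>t<j. (real_of_rat (us ! t))\<^sup>2) \<le>
      weighted_energy n l \<kappa> g (\<lambda>c. \<Sum>t<j. real_of_rat (us ! t) * real_of_rat (ws ! t ! c))"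
  proof (intro exI allI)
    fix us :: "rat list"
    define u where "u t = real_of_rat (us ! t)" for t
    have "inverse (real (Suc N')) * dot {..<j} u u \<le> \<delta> / 2 * dot {..<j} u u"
      using N' by (intro mult_right_mono dot_self_nonneg) auto
    also have "\<dots> = \<delta> * dot {..<j} u u - \<epsilon> * real j * dot {..<j} u u"
      using j by (simp add: \<epsilon>_def field_simps)
    also have "\<dots> \<le> dot {..<j} u (mv j (H W) u) - \<epsilon> * real j * dot {..<j} u u"
      using \<delta>(2) by simp
    also have "\<dots> \<le> dot {..<j} u (mv j (H (WN N)) u)"
      using N \<epsilon> by (intro form_perturbation) (auto simp: less_imp_le)
    also have "\<dots> = weighted_energy n l \<kappa> g (\<lambda>c. \<Sum>t<j. u t * WN N t c)"
      unfolding H_def weighted_energy_eq_form ..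
    also have "\<dots> = weighted_energy n l \<kappa> g (\<lambda>c. \<Sum>t<j. real_of_rat (us ! t) * real_of_rat (ws ! t ! c))"
      by (rule weighted_energy_cong) (auto simp: u_def WN_def ws_def)
    finally show "inverse (real (Suc N')) * (\<Sum>t<j. (real_of_rat (us ! t))\<^sup>2) \<le>
      weighted_energy n l \<kappa> g (\<lambda>c. \<Sum>t<j. real_of_rat (us ! t) * real_of_rat (ws ! t ! c))"
      by (simp add: dot_def u_def power2_eq_square)
  qed
next
  assume "\<exists>(ws :: rat list list) N :: nat. \<forall>us :: rat list.
    inverse (real (Suc N)) * (\<Sum>t<j. (real_of_rat (us ! t))\<^sup>2) \<le>
      weighted_energy n l \<kappa> g (\<lambda>c. \<Sum>t<j. real_of_rat (us ! t) * real_of_rat (ws ! t ! c))"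
  then obtain ws :: "rat list list" and N :: nat where wN: "\<And>us :: rat list.
    inverse (real (Suc N)) * (\<Sum>t<j. (real_of_rat (us ! t))\<^sup>2) \<le>
      weighted_energy n l \<kappa> g (\<lambda>c. \<Sum>t<j. real_of_rat (us ! t) * real_of_rat (ws ! t ! c))" by blast
  define W where "W t c = real_of_rat (ws ! t ! c)" for t c
  show "positive_on_subspace n l j \<kappa> g"
    unfolding positive_on_subspace_def
  proof (intro exI[of _ W] allI impI)
    fix u :: "nat \<Rightarrow> real" assume "\<exists>t<j. u t \<noteq> 0"
    then obtain t0 where t0: "t0 < j" "u t0 \<noteq> 0" by auto
    define f where "f t = (SOME f :: nat \<Rightarrow> rat. (\<lambda>K. real_of_rat (f K)) \<longlonglongrightarrow> u t)" for t
    have f: "(\<lambda>K. real_of_rat (f t K)) \<longlonglongrightarrow> u t" for t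
      unfolding f_def by (rule someI_ex[OF rational_sequence_tendsto])
    have lim1: "(\<lambda>K. inverse (real (Suc N)) * (\<Sum>t<j. (real_of_rat (f t K))\<^sup>2)) \<longlonglongrightarrow>
      inverse (real (Suc N)) * (\<Sum>t<j. (u t)\<^sup>2)"
      by (intro tendsto_intros f)
    have lim2: "(\<lambda>K. weighted_energy n l \<kappa> g (\<lambda>c. \<Sum>t<j. real_of_rat (f t K) * W t c)) \<longlonglongrightarrow>
      weighted_energy n l \<kappa> g (\<lambda>c. \<Sum>t<j. u t * W t c)"
      unfolding weighted_energy_def dot_def by (intro tendsto_intros f)
    \<comment> \<open>The fixed margin survives the limit from rational to real coefficients, where
      bare strict positivity would not.\<close>
    have "inverse (real (Suc N)) * (\<Sum>t<j. (u t)\<^sup>2) \<le> weighted_energy n l \<kappa> g (\<lambda>c. \<Sum>t<j. u t * W t c)"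
    proof (rule LIMSEQ_le[OF lim1 lim2], intro exI allI impI)
      fix K :: nat
      define us where "us = map (\<lambda>t. f t K) [0..<j]"
      have us: "us ! t = f t K" if "t < j" for t using that by (simp add: us_def)
      show "inverse (real (Suc N)) * (\<Sum>t<j. (real_of_rat (f t K))\<^sup>2) \<le>
        weighted_energy n l \<kappa> g (\<lambda>c. \<Sum>t<j. real_of_rat (f t K) * W t c)"
        using wN[of us] us by (simp add: W_def)
    qed
    moreover have "0 < (\<Sum>t<j. (u t)\<^sup>2)" by (rule sum_pos2[of _ t0]) (use t0 in auto)
    then have "0 < inverse (real (Suc N)) * (\<Sum>t<j. (u t)\<^sup>2)" by (intro mult_pos_pos) auto
    ultimately show "0 < weighted_energy n l \<kappa> g (\<lambda>c. \<Sum>t<j. u t * W t c)" by linarith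
  qed
qed

lemma measurable_positive_on_subspace:
  assumes j: "j > 0" and g: "\<And>i c. i < n \<Longrightarrow> c < l \<Longrightarrow> (\<lambda>\<omega>. g \<omega> (i, c)) \<in> borel_measurable N"
  shows "Measurable.pred N (\<lambda>\<omega>. positive_on_subspace n l j \<kappa> (g \<omega>))"
proof -
  have [measurable]: "(\<lambda>\<omega>. weighted_energy n l \<kappa> (g \<omega>) x) \<in> borel_measurable N" for x
    unfolding weighted_energy_def dot_def
    by (intro borel_measurable_sum borel_measurable_times borel_measurable_power borel_measurable_const g) auto
  show ?thesis
    unfolding positive_on_subspace_iff_rational[OF j] by measurable
qed

text \<open>On the image of the pseudoinverse the first \<open>a\<close> coordinates are prescribed
  and the others are controlled by the norm bound \<open>t\<close>. The first part contributes at
  least \<open>(s\<^sup>2 - c\<^sup>2) * U\<close>, the second at least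
  \<open>- c\<^sup>2 * \<alpha>\<^sup>2 * t\<^sup>2 * U\<close>, and the assumption on
  \<open>c\<close> says
  \<open>c\<^sup>2 * (1 + \<alpha>\<^sup>2 * t\<^sup>2) < s\<^sup>2\<close>.\<close>

lemma (in right_singular_vectors) positive_on_subspace_of_small_tail:
  fixes q :: nat
  assumes dpos: "\<And>i. i < n \<Longrightarrow> 0 < d i"
    and det: "det (gram a l g) \<noteq> 0" and tail: "\<And>x. tail_energy a n l g x \<le> t\<^sup>2 * dot {..<a} x x"
    and a: "a < n" and j: "1 \<le> j" "j \<le> a"
    and c: "0 \<le> c" "c < d (j - 1) * damp ((d a / d (j - 1)) ^ (2 * q + 1)) t"
  shows "positive_on_subspace n l j (\<lambda>i. d i ^ (4 * q + 4) - c\<^sup>2 * d i ^ (4 * q + 2)) g"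
proof -
  define \<kappa> where "\<kappa> i = d i ^ (4 * q + 4) - c\<^sup>2 * d i ^ (4 * q + 2)" for i
  define \<alpha> where "\<alpha> = (d a / d (j - 1)) ^ (2 * q + 1)"
  define s where "s = d (j - 1)"
  have s: "s > 0" unfolding s_def using dpos j a by simp
  have da: "d a > 0" using dpos a by simp
  have \<alpha>2: "\<alpha>\<^sup>2 = d a ^ (4 * q + 2) / s ^ (4 * q + 2)"
  proof -
    have "\<alpha>\<^sup>2 = (d a / s) ^ ((2 * q + 1) * 2)" unfolding \<alpha>_def s_def by (simp only: power_mult)
    also have "(2 * q + 1) * 2 = 4 * q + 2" by simp
    finally show ?thesis by (simp add: power_divide)
  qed
  have c2: "c\<^sup>2 * (1 + \<alpha>\<^sup>2 * t\<^sup>2) < s\<^sup>2"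
  proof -
    have p: "1 + \<alpha>\<^sup>2 * t\<^sup>2 > 0" by (simp add: add_pos_nonneg)
    have "c\<^sup>2 < (s * damp \<alpha> t)\<^sup>2" using c unfolding s_def \<alpha>_def by (intro power_strict_mono) auto
    also have "\<dots> = s\<^sup>2 / (1 + \<alpha>\<^sup>2 * t\<^sup>2)" using p by (simp add: damp_def power_divide)
    finally show ?thesis using p by (simp add: pos_less_divide_eq)
  qed
  \<comment> \<open>Dividing column \<open>k\<close> of the pseudoinverse by
    \<open>d k ^ (2 * q + 1)\<close> normalizes the weight \<open>d k ^ (4 * q + 2)\<close> of that
    coordinate to 1. The coordinates from \<open>j\<close> to \<open>a - 1\<close> are set to
    0.\<close>
  define W where "W k c' = 1 / d k ^ (2 * q + 1) * pinv a l g k c'" for k c'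
  have "0 < weighted_energy n l \<kappa> g (\<lambda>c. \<Sum>k<j. u k * W k c)" if u: "\<exists>k<j. u k \<noteq> 0" for u
  proof -
    define x where "x i = (if i < j then u i / d i ^ (2 * q + 1) else 0)" for i
    define U where "U = (\<Sum>i<j. (u i)\<^sup>2)"
    obtain k0 where k0: "k0 < j" "u k0 \<noteq> 0" using u by auto
    have U: "U > 0" unfolding U_def by (rule sum_pos2[of _ k0]) (use k0 in auto)
    have comb: "(\<Sum>k<j. u k * W k c') = pinv_vec a l g x c'" for c'
    proof -
      have "(\<Sum>k<j. u k * W k c') = (\<Sum>k<j. x k * pinv a l g k c')"
        by (intro sum.cong) (auto simp: x_def W_def)
      also have "\<dots> = (\<Sum>k<a. x k * pinv a l g k c')"
        using j by (intro sum.mono_neutral_left) (auto simp: x_def)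
      finally show ?thesis unfolding pinv_vec_def .
    qed
    define h where "h i = dot {..<l} (\<lambda>c. g (i, c)) (pinv_vec a l g x)" for i
    have hx: "h i = x i" if "i < a" for i unfolding h_def by (rule pinv_vec_right_inverse[OF det that])
    have xsq: "(x i)\<^sup>2 = (u i)\<^sup>2 / d i ^ (4 * q + 2)" if "i < j" for i
    proof -
      have "(d i ^ (2 * q + 1))\<^sup>2 = d i ^ ((2 * q + 1) * 2)" by (simp only: power_mult)
      also have "(2 * q + 1) * 2 = 4 * q + 2" by simp
      finally show ?thesis using that by (simp add: x_def power_divide)
    qed
    have dj: "s \<le> d i" if "i < j" for i unfolding s_def using that a j by (intro d_mono) auto
    have "weighted_energy n l \<kappa> g (\<lambda>c. \<Sum>k<j. u k * W k c) = (\<Sum>i<n. \<kappa> i * (h i)\<^sup>2)"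
      unfolding weighted_energy_def comb h_def ..
    also have "\<dots> = (\<Sum>i<a. \<kappa> i * (h i)\<^sup>2) + (\<Sum>i\<in>{a..<n}. \<kappa> i * (h i)\<^sup>2)"
      using a by (subst sum.union_disjoint[symmetric]) (auto intro!: sum.cong)
    also have "(\<Sum>i<a. \<kappa> i * (h i)\<^sup>2) = (\<Sum>i<j. \<kappa> i * (x i)\<^sup>2)"
      using j hx by (intro sum.mono_neutral_cong_right) (auto simp: x_def)
    finally have E: "weighted_energy n l \<kappa> g (\<lambda>c. \<Sum>k<j. u k * W k c) =
      (\<Sum>i<j. \<kappa> i * (x i)\<^sup>2) + (\<Sum>i\<in>{a..<n}. \<kappa> i * (h i)\<^sup>2)" .
    have "(s\<^sup>2 - c\<^sup>2) * U \<le> (\<Sum>i<j. \<kappa> i * (x i)\<^sup>2)"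
      unfolding U_def sum_distrib_left
    proof (rule sum_mono)
      fix i assume "i \<in> {..<j}"
      then have i: "i < j" by simp
      have di: "d i > 0" using dj[OF i] s by simp
      have "\<kappa> i = d i ^ (4 * q + 2) * ((d i)\<^sup>2 - c\<^sup>2)"
        unfolding \<kappa>_def by (simp add: algebra_simps power_add power2_eq_square eval_nat_numeral)
      then have "\<kappa> i * (x i)\<^sup>2 = ((d i)\<^sup>2 - c\<^sup>2) * (u i)\<^sup>2" using xsq[OF i] di by simp
      moreover have "s\<^sup>2 \<le> (d i)\<^sup>2" using dj[OF i] s by (intro power_mono) auto
      ultimately show "(s\<^sup>2 - c\<^sup>2) * (u i)\<^sup>2 \<le> \<kappa> i * (x i)\<^sup>2" by (simp add: mult_right_mono)
    qed
    moreover have "- (c\<^sup>2 * \<alpha>\<^sup>2 * t\<^sup>2 * U) \<le> (\<Sum>i\<in>{a..<n}. \<kappa> i * (h i)\<^sup>2)"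
    proof -
      have "dot {..<a} x x = (\<Sum>i<j. (x i)\<^sup>2)"
        unfolding dot_def power2_eq_square using j by (intro sum.mono_neutral_cong_right) (auto simp: x_def)
      also have "\<dots> \<le> (\<Sum>i<j. (u i)\<^sup>2 / s ^ (4 * q + 2))"
      proof (rule sum_mono)
        fix i assume "i \<in> {..<j}"
        then have i: "i < j" by simp
        have "s ^ (4 * q + 2) \<le> d i ^ (4 * q + 2)" using dj[OF i] s by (intro power_mono) auto
        then show "(x i)\<^sup>2 \<le> (u i)\<^sup>2 / s ^ (4 * q + 2)"
          unfolding xsq[OF i] using s dj[OF i] by (intro divide_left_mono) auto
      qed
      finally have X: "dot {..<a} x x \<le> U / s ^ (4 * q + 2)" by (simp add: U_def sum_divide_distrib)
      have T: "(\<Sum>i\<in>{a..<n}. (h i)\<^sup>2) \<le> t\<^sup>2 * dot {..<a} x x"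
        using tail[of x] unfolding tail_energy_def h_def .
      have "(\<Sum>i\<in>{a..<n}. - (\<kappa> i * (h i)\<^sup>2)) \<le> (\<Sum>i\<in>{a..<n}. c\<^sup>2 * d a ^ (4 * q + 2) * (h i)\<^sup>2)"
      proof (rule sum_mono)
        fix i assume i: "i \<in> {a..<n}"
        have "c\<^sup>2 * d i ^ (4 * q + 2) \<le> c\<^sup>2 * d a ^ (4 * q + 2)"
          using i d_nonneg d_mono[of a i] by (intro mult_left_mono power_mono) auto
        moreover have "0 \<le> d i ^ (4 * q + 4)" using i d_nonneg by simp
        ultimately have "- \<kappa> i \<le> c\<^sup>2 * d a ^ (4 * q + 2)" unfolding \<kappa>_def by linarith
        then have "- \<kappa> i * (h i)\<^sup>2 \<le> c\<^sup>2 * d a ^ (4 * q + 2) * (h i)\<^sup>2" by (rule mult_right_mono) simp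
        then show "- (\<kappa> i * (h i)\<^sup>2) \<le> c\<^sup>2 * d a ^ (4 * q + 2) * (h i)\<^sup>2" by simp
      qed
      also have "\<dots> = c\<^sup>2 * d a ^ (4 * q + 2) * (\<Sum>i\<in>{a..<n}. (h i)\<^sup>2)" by (simp add: sum_distrib_left)
      also have "\<dots> \<le> c\<^sup>2 * d a ^ (4 * q + 2) * (t\<^sup>2 * (U / s ^ (4 * q + 2)))"
      proof (intro mult_left_mono)
        show "(\<Sum>i\<in>{a..<n}. (h i)\<^sup>2) \<le> t\<^sup>2 * (U / s ^ (4 * q + 2))"
          by (rule order_trans[OF T mult_left_mono[OF X]]) simp
      qed (use da in auto)
      also have "\<dots> = c\<^sup>2 * \<alpha>\<^sup>2 * t\<^sup>2 * U" unfolding \<alpha>2 by simp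
      finally show ?thesis by (simp add: sum_negf)
    qed
    moreover have "0 < (s\<^sup>2 - c\<^sup>2) * U - c\<^sup>2 * \<alpha>\<^sup>2 * t\<^sup>2 * U"
    proof -
      have "0 < (s\<^sup>2 - c\<^sup>2 * (1 + \<alpha>\<^sup>2 * t\<^sup>2)) * U" using c2 U by simp
      then show ?thesis by (simp add: algebra_simps)
    qed
    ultimately show ?thesis unfolding E by linarith
  qed
  then show ?thesis unfolding positive_on_subspace_def \<kappa>_def[symmetric] by blast
qed

section \<open>The expectation bound\<close>

text \<open>Independence and the marginal laws identify the entries of \<open>\<Omega>\<close> with
  a product measure, which the orthogonal map acting on each column preserves. The restriction to
  \<open>I\<close> is there because product measures live on extensional functions.\<close>

lemma rotated_standard_gaussian:
  assumes M: "prob_space M" and \<Omega>: "standard_gaussian_matrix M n l \<Omega>" and w: "orthonormal n n w"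
    and nl: "0 < n" "0 < l"
  defines "I \<equiv> {..<n} \<times> {..<l}"
  shows "(\<lambda>\<omega>. \<lambda>k\<in>I. rotated w n (\<Omega> \<omega>) k) \<in> measurable M (gauss I)"
    "distr M (gauss I) (\<lambda>\<omega>. \<lambda>k\<in>I. rotated w n (\<Omega> \<omega>) k) = gauss I"
proof -
  interpret prob_space M by (rule M)
  define Z where "Z = (\<lambda>(i, j) \<omega>. \<Omega> \<omega> $$ (i, j))"
  have ind: "indep_vars (\<lambda>_. borel) Z I"
    and dist: "\<And>i j. i < n \<Longrightarrow> j < l \<Longrightarrow> distributed M lborel (\<lambda>\<omega>. \<Omega> \<omega> $$ (i, j)) std_normal_density"
    using \<Omega> unfolding standard_gaussian_matrix_def Z_def I_def by auto
  have distZ: "distributed M lborel (Z k) std_normal_density" if "k \<in> I" for k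
    using dist that by (auto simp: Z_def I_def)
  have Z [measurable]: "Z k \<in> borel_measurable M" if "k \<in> I" for k
    using distributed_measurable[OF distZ[OF that]] by simp
  have law1: "distr M borel (Z k) = std_gauss" if "k \<in> I" for k
  proof -
    have "distr M borel (Z k) = distr M lborel (Z k)" by (rule distr_cong) auto
    then show ?thesis using distributed_distr_eq_density[OF distZ[OF that]] by simp
  qed
  define ZZ where "ZZ \<omega> = (\<lambda>k\<in>I. Z k \<omega>)" for \<omega>
  have "I \<noteq> {}" using nl by (auto simp: I_def)
  then have "distr M (Pi\<^sub>M I (\<lambda>_. borel)) ZZ = Pi\<^sub>M I (\<lambda>k. distr M borel (Z k))"
    using indep_vars_iff_distr_eq_PiM'[of I Z "\<lambda>_. borel"] ind Z unfolding ZZ_def by simp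
  also have "\<dots> = gauss I" by (rule PiM_cong) (auto simp: law1)
  finally have lawZ: "distr M (Pi\<^sub>M I (\<lambda>_. borel)) ZZ = gauss I" .
  have mZ: "ZZ \<in> measurable M (gauss I)"
    unfolding ZZ_def by (rule measurable_restrict) (use Z in simp)
  have lawZ': "distr M (gauss I) ZZ = gauss I"
    using lawZ by (subst distr_cong[OF refl sets_gauss refl])
  define NN where "NN = (\<lambda>(i :: nat, c :: nat) (r, c'). if c' = c then w i r else 0)"
  define T where "T z = (\<lambda>k\<in>I. dot I (NN k) z)" for z
  have T: "T \<in> measurable (gauss I) (gauss I)"
    unfolding T_def by (intro measurable_restrict) (simp add: I_def)
  have Idot: "dot I u v = (\<Sum>r<n. \<Sum>c<l. u (r, c) * v (r, c))" for u v
    unfolding dot_def I_def sum.cartesian_product' ..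
  have NNdot: "dot I (NN (i, c)) z = (\<Sum>r<n. w i r * z (r, c))" if "c < l" for i c z
  proof -
    have "dot I (NN (i, c)) z = (\<Sum>r<n. \<Sum>c'<l. if c' = c then w i r * z (r, c) else 0)"
      unfolding Idot NN_def by (intro sum.cong) auto
    then show ?thesis using that by simp
  qed
  have eq: "T (ZZ \<omega>) = (\<lambda>k\<in>I. rotated w n (\<Omega> \<omega>) k)" for \<omega>
  proof
    fix k
    show "T (ZZ \<omega>) k = (\<lambda>k\<in>I. rotated w n (\<Omega> \<omega>) k) k"
    proof (cases "k \<in> I")
      case True
      then obtain i c where k: "k = (i, c)" "i < n" "c < l" by (auto simp: I_def)
      have "T (ZZ \<omega>) k = (\<Sum>r<n. w i r * ZZ \<omega> (r, c))" using True NNdot[OF k(3)] by (simp add: T_def k(1))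
      also have "\<dots> = (\<Sum>r<n. w i r * \<Omega> \<omega> $$ (r, c))"
        using k by (intro sum.cong) (auto simp: ZZ_def Z_def I_def)
      finally show ?thesis using True by (simp add: rotated_def k(1))
    qed (simp add: T_def)
  qed
  show mX: "(\<lambda>\<omega>. \<lambda>k\<in>I. rotated w n (\<Omega> \<omega>) k) \<in> measurable M (gauss I)"
    using measurable_compose[OF mZ T] unfolding eq .
  show "distr M (gauss I) (\<lambda>\<omega>. \<lambda>k\<in>I. rotated w n (\<Omega> \<omega>) k) = gauss I"
  proof (rule measure_eqI)
    fix E assume "E \<in> sets (distr M (gauss I) (\<lambda>\<omega>. \<lambda>k\<in>I. rotated w n (\<Omega> \<omega>) k))"
    then have E: "E \<in> sets (gauss I)" by simp
    have mE: "(\<lambda>z. indicator E (T z) :: ennreal) \<in> borel_measurable (gauss I)"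
      using measurable_compose[OF T borel_measurable_indicator[OF E]] .
    have "emeasure (distr M (gauss I) (\<lambda>\<omega>. \<lambda>k\<in>I. rotated w n (\<Omega> \<omega>) k)) E =
      (\<integral>\<^sup>+z. indicator E z \<partial>distr M (gauss I) (\<lambda>\<omega>. \<lambda>k\<in>I. rotated w n (\<Omega> \<omega>) k))"
      using E by simp
    also have "\<dots> = (\<integral>\<^sup>+\<omega>. indicator E (T (ZZ \<omega>)) \<partial>M)"
      unfolding eq using mX E by (intro nn_integral_distr) auto
    also have "\<dots> = (\<integral>\<^sup>+z. indicator E (T z) \<partial>distr M (gauss I) ZZ)"
      by (rule nn_integral_distr[symmetric]) (use mZ mE in auto)
    also have "\<dots> = (\<integral>\<^sup>+z. indicator E (T z) \<partial>gauss I)" unfolding lawZ' ..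
    also have "\<dots> = (\<integral>\<^sup>+z. indicator E z \<partial>gauss I)"
      unfolding T_def
    proof (rule nn_integral_gauss_orthonormal)
      fix k k' assume "k \<in> I" "k' \<in> I"
      then obtain i c i' c' where k: "k = (i, c)" "k' = (i', c')" and b: "i < n" "c < l" "i' < n" "c' < l"
        by (auto simp: I_def)
      show "dot I (NN k) (NN k') = (if k = k' then 1 else 0)"
      proof (cases "c = c'")
        case True
        then have "dot I (NN k) (NN k') = dot {..<n} (w i) (w i')"
          unfolding k NNdot[OF b(2)] by (simp add: NN_def dot_def)
        then show ?thesis using w b True unfolding k orthonormal_def by simp
      next
        case False
        then show ?thesis unfolding k NNdot[OF b(2)] by (simp add: NN_def)
      qed
    qed (use E in \<open>auto simp: I_def\<close>)
    also have "\<dots> = emeasure (gauss I) E" using E by simp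
    finally show "emeasure (distr M (gauss I) (\<lambda>\<omega>. \<lambda>k\<in>I. rotated w n (\<Omega> \<omega>) k)) E = emeasure (gauss I) E" .
  qed simp
qed

theorem theorem5p6:
  fixes M :: "'w measure"
    and \<Omega> :: "'w \<Rightarrow> real mat"
    and QBk :: "'w \<Rightarrow> real mat"
    and A :: "real mat"
    and m n k l p q j :: nat
    and C1 C2 C :: real
    and \<sigma> \<tau> :: "nat \<Rightarrow> real"
  assumes "prob_space M"
    and "A \<in> carrier_mat m n"
    and "m \<ge> n" and "n > max k 2"
    and "vec_space.rank m A = n"
    and "0 < k" and "k \<le> l" and "l < n" and "p \<le> l - k"
    and "standard_gaussian_matrix M n l \<Omega>"
    and "\<And>\<omega>. \<omega> \<in> space M \<Longrightarrow> randomized_subspace_iteration A k l q (\<Omega> \<omega>) (QBk \<omega>)"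
    and "\<sigma> = singular_value A"
    and "C1 = sqrt (real n - real l + real p) + sqrt (real l) + 7"
    and "C2 = 4 * exp 1 * sqrt (real l) / (real p + 1)"
    and "C = C1 * C2"
    and "\<tau> = (\<lambda>i. \<sigma> (l - p + 1) / \<sigma> i)"
    and "1 \<le> j" and "j \<le> k"
  shows "prob_space.expectation M (\<lambda>\<omega>. singular_value (QBk \<omega>) j) \<ge>
    (if p \<ge> 2 then \<sigma> j / sqrt (1 + C\<^sup>2 * \<tau> j ^ (4 * q + 2))
     else if p = 1 then
       \<sigma> j / (1 + C\<^sup>2 * \<tau> j ^ (4 * q + 2) * ln (sqrt (C\<^sup>2 + \<tau> j powi (- int (4 * q + 2)))))
     else \<sigma> j / (1 + C * \<tau> j ^ (2 * q + 1)))"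
proof -
  interpret M: prob_space M by fact
  obtain w d where "right_singular_vectors A m n w d"
    using right_singular_vectors_exist[OF \<open>A \<in> carrier_mat m n\<close>] by blast
  then interpret right_singular_vectors A m n w d .
  note rsi = \<open>\<And>\<omega>. \<omega> \<in> space M \<Longrightarrow> randomized_subspace_iteration A k l q (\<Omega> \<omega>) (QBk \<omega>)\<close>
  define a where "a = l - p"
  have a: "k \<le> a" "a < n" "p < l" "j \<le> a" "j \<le> n" "0 < n" "0 < l"
    using \<open>p \<le> l - k\<close> \<open>0 < k\<close> \<open>k \<le> l\<close> \<open>l < n\<close> \<open>j \<le> k\<close> unfolding a_def by linarith+
  have dpos: "0 < d i" if "i < n" for i using d_pos[OF \<open>vec_space.rank m A = n\<close> that] .
  define s where "s = d (j - 1)"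
  have s: "s > 0" unfolding s_def using dpos a \<open>1 \<le> j\<close> by simp
  have \<sigma>j: "\<sigma> j = s" unfolding \<open>\<sigma> = singular_value A\<close> s_def
    using a \<open>1 \<le> j\<close> by (intro singular_value_eq) auto
  have "\<sigma> (a + 1) = d (a + 1 - 1)" unfolding \<open>\<sigma> = singular_value A\<close>
    using a by (intro singular_value_eq) auto
  then have \<tau>j: "\<tau> j = d a / s" unfolding \<open>\<tau> = _\<close> by (simp add: \<sigma>j a_def)
  define \<alpha> where "\<alpha> = \<tau> j ^ (2 * q + 1)"
  have \<tau>pos: "\<tau> j > 0" unfolding \<tau>j using dpos a s by simp
  then have \<alpha>: "\<alpha> > 0" by (simp add: \<alpha>_def)
  have \<alpha>2: "\<alpha>\<^sup>2 = \<tau> j ^ (4 * q + 2)"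
  proof -
    have "\<alpha>\<^sup>2 = \<tau> j ^ ((2 * q + 1) * 2)" unfolding \<alpha>_def by (simp only: power_mult)
    also have "(2 * q + 1) * 2 = 4 * q + 2" by simp
    finally show ?thesis .
  qed
  define S where "S \<omega> = singular_value (QBk \<omega>) j" for \<omega>
  define I where "I = {..<n} \<times> {..<l}"
  define X where "X \<omega> = (\<lambda>k\<in>I. rotated w n (\<Omega> \<omega>) k)" for \<omega>
  have mX: "X \<in> measurable M (gauss I)" and lawX: "distr M (gauss I) X = gauss I"
    using rotated_standard_gaussian[OF \<open>prob_space M\<close> \<open>standard_gaussian_matrix M n l \<Omega>\<close> w a(6,7)]
    unfolding I_def X_def[abs_def] by auto
  have Xcomp: "(\<lambda>\<omega>. X \<omega> (i, c)) \<in> borel_measurable M" if "i < n" "c < l" for i c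
    by (rule measurable_compose[OF mX gauss_component_measurable]) (use that in \<open>simp add: I_def\<close>)
  have S0: "0 \<le> S \<omega>" if "\<omega> \<in> space M" for \<omega>
    unfolding S_def by (rule subspace_iteration_singular_value(1)[OF rsi[OF that]]) (use a \<open>1 \<le> j\<close> \<open>j \<le> k\<close> in auto)
  define \<kappa> where "\<kappa> c i = d i ^ (4 * q + 4) - c\<^sup>2 * d i ^ (4 * q + 2)" for c i
  have Sgt: "c < S \<omega> \<longleftrightarrow> positive_on_subspace n l j (\<kappa> c) (X \<omega>)" if "\<omega> \<in> space M" "0 \<le> c" for \<omega> c
  proof -
    have "weighted_energy n l (\<kappa> c) (rotated w n (\<Omega> \<omega>)) x = weighted_energy n l (\<kappa> c) (X \<omega>) x" for x
      by (rule weighted_energy_cong) (auto simp: X_def I_def)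
    then show ?thesis
      using subspace_iteration_singular_value(2)[OF rsi[OF that(1)] \<open>1 \<le> j\<close> \<open>j \<le> k\<close> a(5) that(2)]
      unfolding S_def \<kappa>_def[abs_def] positive_on_subspace_def by simp
  qed
  have mS: "S \<in> borel_measurable M"
  proof (rule borel_measurableI_greater)
    fix c :: real
    show "{\<omega> \<in> space M. c < S \<omega>} \<in> sets M"
    proof (cases "0 \<le> c")
      case True
      have "Measurable.pred M (\<lambda>\<omega>. positive_on_subspace n l j (\<kappa> c) (X \<omega>))"
        by (rule measurable_positive_on_subspace) (use \<open>1 \<le> j\<close> Xcomp in auto)
      moreover have "{\<omega> \<in> space M. c < S \<omega>} = {\<omega> \<in> space M. positive_on_subspace n l j (\<kappa> c) (X \<omega>)}"
        using Sgt[OF _ True] by auto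
      ultimately show ?thesis by simp
    next
      case False
      then have "{\<omega> \<in> space M. c < S \<omega>} = space M" using S0 by force
      then show ?thesis by simp
    qed
  qed
  \<comment> \<open>At the level \<open>d 0\<close> no weight is positive, so it is never exceeded;
    this bound makes \<open>S\<close> integrable.\<close>
  have Sle: "S \<omega> \<le> d 0" if \<omega>: "\<omega> \<in> space M" for \<omega>
  proof (rule ccontr)
    assume "\<not> ?thesis"
    moreover have "0 \<le> d 0" using dpos a by (simp add: less_imp_le)
    ultimately have "positive_on_subspace n l j (\<kappa> (d 0)) (X \<omega>)" using Sgt[OF \<omega>, of "d 0"] by simp
    then obtain W where *: "\<And>u. \<exists>t<j. u t \<noteq> 0 \<Longrightarrow> 0 < weighted_energy n l (\<kappa> (d 0)) (X \<omega>) (\<lambda>c. \<Sum>t<j. u t * W t c)"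
      unfolding positive_on_subspace_def by blast
    have "0 < weighted_energy n l (\<kappa> (d 0)) (X \<omega>) (\<lambda>c. \<Sum>t<j. 1 * W t c)"
    proof -
      have "\<exists>t<j. (1 :: real) \<noteq> 0" using \<open>1 \<le> j\<close> by (intro exI[of _ 0]) simp
      then show ?thesis using *[of "\<lambda>_. 1"] by simp
    qed
    moreover have "\<kappa> (d 0) i \<le> 0" if "i < n" for i
    proof -
      have "(d i)\<^sup>2 \<le> (d 0)\<^sup>2" using d_mono[of 0 i] d_nonneg that by (intro power_mono) auto
      then have "d i ^ (4 * q + 2) * (d i)\<^sup>2 \<le> d i ^ (4 * q + 2) * (d 0)\<^sup>2"
        using d_nonneg[OF that] by (intro mult_left_mono) auto
      then show ?thesis unfolding \<kappa>_def by (simp add: power_add power2_eq_square eval_nat_numeral mult_ac)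
    qed
    then have "weighted_energy n l (\<kappa> (d 0)) (X \<omega>) x \<le> 0" for x
      unfolding weighted_energy_def by (intro sum_nonpos mult_nonpos_nonneg) auto
    ultimately show False by (meson not_less)
  qed
  have integrable: "integrable M S"
    by (rule M.integrable_const_bound[of _ "d 0"]) (use S0 Sle mS in auto)
  define D where "D = (if p \<le> 1 then C / 2 else C * sqrt ((real p - 1) / (real p + 1)))"
  have C1: "C1 > 7" unfolding \<open>C1 = _\<close> using \<open>l < n\<close> a by (simp add: add_pos_nonneg add_nonneg_pos)
  have Cpos: "C > 0" unfolding \<open>C = _\<close> \<open>C2 = _\<close> using C1 a by simp
  have Dpos: "D > 0" unfolding D_def using Cpos by simp
  have tail: "emeasure M {\<omega> \<in> space M. S \<omega> / s < damp \<alpha> t} \<le> ennreal ((D / t) ^ (p + 1))" if "t \<ge> D" for t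
  proof -
    have t: "t > 0" using that Dpos by simp
    have "emeasure M {\<omega> \<in> space M. S \<omega> / s < damp \<alpha> t} \<le>
      ennreal (((if p \<le> 1 then (C1 * C2) / 2 else (C1 * C2) * sqrt ((real p - 1) / (real p + 1))) / t) ^ (p + 1))"
      unfolding \<open>C1 = _\<close> \<open>C2 = _\<close>
    proof (rule operator_norm_tail_constant[OF \<open>prob_space M\<close> mX[unfolded I_def] lawX[unfolded I_def] a(3) \<open>l < n\<close> t])
      show "{\<omega> \<in> space M. S \<omega> / s < damp \<alpha> t} \<in> sets M" using mS by measurable
      fix \<omega> assume \<omega>: "\<omega> \<in> {\<omega> \<in> space M. S \<omega> / s < damp \<alpha> t}" and det: "det (gram (l - p) l (X \<omega>)) \<noteq> 0"
      show "\<exists>x. t\<^sup>2 * dot {..<l - p} x x < tail_energy (l - p) n l (X \<omega>) x"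
      proof (rule ccontr)
        assume "\<not> ?thesis"
        then have small: "tail_energy a n l (X \<omega>) x \<le> t\<^sup>2 * dot {..<a} x x" for x
          by (simp add: a_def not_less)
        have "S \<omega> < d (j - 1) * damp ((d a / d (j - 1)) ^ (2 * q + 1)) t"
          using \<omega> s unfolding \<alpha>_def \<tau>j s_def by (simp add: pos_divide_less_eq mult.commute)
        \<comment> \<open>The level is the singular value itself: positivity at
          \<open>S \<omega>\<close> would mean \<open>S \<omega> < S \<omega>\<close>.\<close>
        then have "positive_on_subspace n l j (\<kappa> (S \<omega>)) (X \<omega>)"
          unfolding \<kappa>_def[abs_def]
          by (intro positive_on_subspace_of_small_tail[OF dpos det[folded a_def] small a(2) \<open>1 \<le> j\<close> a(4)])
            (use S0 \<omega> in auto)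
        then show False using Sgt[of \<omega> "S \<omega>"] S0[of \<omega>] \<omega> by simp
      qed
    qed
    then show ?thesis unfolding D_def \<open>C = _\<close> .
  qed
  have "(\<integral>\<^sup>+x. ennreal (damp \<alpha> x) \<partial>pareto D (p + 1)) \<le> (\<integral>\<^sup>+\<omega>. ennreal (S \<omega> / s) \<partial>M)"
    by (rule expectation_ge_pareto[OF \<open>prob_space M\<close> _ \<alpha> Dpos _ tail]) (use mS in auto)
  also have "\<dots> = ennreal (\<integral>\<omega>. S \<omega> / s \<partial>M)"
    using integrable S0 s by (intro nn_integral_eq_integral) auto
  also have "(\<integral>\<omega>. S \<omega> / s \<partial>M) = M.expectation S / s" by simp
  finally have main: "(\<integral>\<^sup>+x. ennreal (damp \<alpha> x) \<partial>pareto D (p + 1)) \<le> ennreal (M.expectation S / s)" .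
  have ES: "0 \<le> M.expectation S / s" using S0 s by (intro divide_nonneg_pos integral_nonneg_AE) auto
  have conclude: "s * b \<le> M.expectation S" if "ennreal b \<le> (\<integral>\<^sup>+x. ennreal (damp \<alpha> x) \<partial>pareto D (p + 1))" for b
  proof -
    have "ennreal b \<le> ennreal (M.expectation S / s)" using that main by (rule order_trans)
    then have "b \<le> M.expectation S / s" using ES by (simp add: ennreal_le_iff)
    then show ?thesis using s by (simp add: pos_le_divide_eq mult.commute)
  qed
  consider "p \<ge> 2" | "p = 1" | "p = 0" by linarith
  then show ?thesis
  proof cases
    case 1
    then have "ennreal (damp \<alpha> C) \<le> (\<integral>\<^sup>+x. ennreal (damp \<alpha> x) \<partial>pareto D (p + 1))"
      unfolding D_def using pareto_damp_large[OF Cpos \<alpha> 1] by simp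
    from conclude[OF this] show ?thesis
      using 1 unfolding S_def[abs_def] damp_def \<alpha>2 \<sigma>j by (simp add: mult.commute)
  next
    case 2
    \<comment> \<open>\<open>pareto_damp_two\<close> asks for \<open>8 \<le> C\<^sup>2\<close>;
      since \<open>C2 \<ge> 1\<close>, the summand 7 in \<open>C1\<close> provides it.\<close>
    have "C \<ge> 3"
    proof -
      have "1 \<le> exp (1::real)" by simp
      moreover have "1 \<le> sqrt (real l)" using a by simp
      ultimately have "1 * 1 \<le> exp 1 * sqrt (real l)" by (intro mult_mono) auto
      then have "1 \<le> C2" unfolding \<open>C2 = _\<close> 2 by simp
      then have "7 * 1 \<le> C1 * C2" using C1 by (intro mult_mono) auto
      then show ?thesis unfolding \<open>C = _\<close> by simp
    qed
    then have "3\<^sup>2 \<le> C\<^sup>2" by (intro power_mono) auto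
    then have "8 \<le> C\<^sup>2" by simp
    then have "ennreal (1 / (1 + C\<^sup>2 * \<alpha>\<^sup>2 * ln (sqrt (C\<^sup>2 + 1 / \<alpha>\<^sup>2)))) \<le> (\<integral>\<^sup>+x. ennreal (damp \<alpha> x) \<partial>pareto D (p + 1))"
      unfolding D_def using pareto_damp_two[OF _ Cpos \<alpha>] 2 by (simp add: numeral_2_eq_2)
    from conclude[OF this] have "s / (1 + C\<^sup>2 * \<alpha>\<^sup>2 * ln (sqrt (C\<^sup>2 + 1 / \<alpha>\<^sup>2))) \<le> M.expectation S" by simp
    moreover have "\<tau> j powi (- int (4 * q + 2)) = 1 / \<alpha>\<^sup>2"
      unfolding \<alpha>2 power_int_minus by (simp only: power_int_of_nat inverse_eq_divide)
    ultimately show ?thesis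
      unfolding S_def[abs_def] \<sigma>j \<alpha>2[symmetric] using 2 by (simp only: \<alpha>2[symmetric]) simp
  next
    case 3
    then have "ennreal (1 / (1 + 2 * D * \<alpha>)) \<le> (\<integral>\<^sup>+x. ennreal (damp \<alpha> x) \<partial>pareto D (p + 1))"
      using pareto_damp_one[OF Dpos \<alpha>] by simp
    from conclude[OF this] show ?thesis
      using 3 unfolding S_def[abs_def] \<sigma>j D_def \<alpha>_def by simp
  qed
qed

end
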